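(* Let $\Bbbk$ be a field of characteristic $0$, $Q$ a finite quiver with vertex set $I$ and double $\bar Q$, and for each $a\in Q$ choose $\gamma_a\in\Bbbk$, setting $\gamma_{a^*}=\gamma_a$. Let $A$ be the universal localisation of the path algebra $\Bbbk\bar Q$ at $S=\{1+(\gamma_a-1)e_{t(a)}+aa^*\mid a\in\bar Q\}$, viewed as an algebra over $B=\bigoplus_{s\in I}\Bbbk e_s$. Fix for each vertex $s$ a total ordering $<_s$ on $T_s=\{a\in\bar Q\mid t(a)=s\}$ with ordering function $o_s$. Then $A$ has a ($B$-linear) double quasi-Poisson bracket defined by $$\{\!\{a,a\}\!\}=\tfrac12o_{t(a)}(a,a^* )\big(a^2\otimes e_{t(a)}-e_{h(a)}\otimes a^2\big)\quad(a\in\bar Q),$$ $$\{\!\{a,a^*\}\!\}=\gamma_ae_{h(a)}\otimes e_{t(a)}+\tfrac12a^*a\otimes e_{t(a)}+\tfrac12e_{h(a)}\otimes aa^*+\tfrac12o_{t(a)}(a,a^* )(a^*\otimes a-a\otimes a^* )\quad(a\in Q),$$ and, for $b,c\in\bar Q$ with $c\ne b,b^*$, $$\{\!\{b,c\}\!\}=-\tfrac12o_{t(b)}(b,c)\,b\otimes c-\tfrac12o_{h(b)}(b^*,c^* )\,c\otimes b+\tfrac12o_{t(b)}(b,c^* )\,cb\otimes e_{t(b)}+\tfrac12o_{h(b)}(b^*,c)\,e_{h(b)}\otimes bc.$$ Furthermore, $A$ is quasi-Hamiltonian for the multiplicative moment map $\Phi=\sum_{s\in I}\Phi_s$, $\Phi_s=\prod^{\rightarrow}_{a\in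 T_s}(\gamma_ae_s+aa^* )^{\epsilon(a)}$, where the product is taken in increasing order with respect to $<_s$.
   Context: Quiver conventions: $t(a),h(a)$ are tail and head of an arrow $a$. The double $\bar Q$ has vertex set $I$ and arrows those of $Q$ together with an opposite arrow $a^*:h(a)\to t(a)$ for each $a\in Q$; set $(a^* )^*=a$. The path algebra $\Bbbk\bar Q$ is generated by arrows $a\in\bar Q$ and idempotents $e_s$ ($s\in I$) with $a=e_{t(a)}ae_{h(a)}$, $e_se_t=\delta_{st}e_s$, $\sum_se_s=1$ (paths read left to right). $\epsilon(a)=+1$ for $a\in Q$, $\epsilon(a)=-1$ for $a\in\bar Q\setminus Q$. Localising at $S$ amounts to adding inverses of $\gamma_ae_{t(a)}+aa^*$ in $e_{t(a)}Ae_{t(a)}$ for all $a\in\bar Q$; $(\gamma_ae_s+aa^* )^{-1}$ denotes this local inverse. The ordering function is $o_s(a,b)=+1$ if $a<_sb$, $-1$ if $b<_sa$, and $0$ if $a=b$ or $a\notin T_s$ or $b\notin T_s$. Double brackets: $\otimes=\otimes_\Bbbk$, Sweedler notation $d=d'\otimes d''$, outer bimodule structure $x(d'\otimes d'')y=xd'\otimes d''y$. A $B$-linear double bracket is a $\Bbbk$-bilinear map $A\times A\to A\otimes A$ vanishing when an argument lies in $B$, with $\{\!\{a,b\}\!\}=-\{\!\{b,a\}\!\}''\otimes\{\!\{b,a\}\!\}'$ and $\{\!\{a,bc\}\!\}=\{\!\{a,b\}\!\}c+b\{\!\{a,c\}\!\}$ (so it is determined by values on generators). Triple bracket: $\{\!\{a,b,c\}\!\}=\{\!\{a,\{\!\{b,c\}\!\}'\}\!\}\otimes\{\!\{b,c\}\!\}''+\tau\{\!\{b,\{\!\{c,a\}\!\}'\}\!\}\otimes\{\!\{c,a\}\!\}''+\tau^2\{\!\{c,\{\!\{a,b\}\!\}'\}\!\}\otimes\{\!\{a,b\}\!\}''$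 with $\tau(x_1\otimes x_2\otimes x_3)=x_3\otimes x_1\otimes x_2$. Quasi-Poisson: $\{\!\{a,b,c\}\!\}=\frac14\sum_{s}(ce_sa\otimes e_sb\otimes e_s-ce_sa\otimes e_s\otimes be_s-ce_s\otimes ae_sb\otimes e_s+ce_s\otimes ae_s\otimes be_s-e_sa\otimes e_sb\otimes e_sc+e_sa\otimes e_s\otimes be_sc+e_s\otimes ae_sb\otimes e_sc-e_s\otimes ae_s\otimes be_sc)$ for all $a,b,c$. Quasi-Hamiltonian: additionally an invertible $\Phi=\sum_s\Phi_s$, $\Phi_s\in e_sAe_s$, with $\{\!\{\Phi_s,a\}\!\}=\frac12(ae_s\otimes\Phi_s-e_s\otimes\Phi_sa+a\Phi_s\otimes e_s-\Phi_s\otimes e_sa)$ for all $a\in A$, $s\in I$. *)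

theory Defs
  imports Main
begin

datatype 'a darr = Pos 'a | Star 'a

fun dstar :: "'a darr \<Rightarrow> 'a darr" where
  "dstar (Pos a) = Star a" | "dstar (Star a) = Pos a"

fun dtl :: "('a \<Rightarrow> 'v) \<Rightarrow> ('a \<Rightarrow> 'v) \<Rightarrow> 'a darr \<Rightarrow> 'v" where
  "dtl t h (Pos a) = t a" | "dtl t h (Star a) = h a"

fun dhd :: "('a \<Rightarrow> 'v) \<Rightarrow> ('a \<Rightarrow> 'v) \<Rightarrow> 'a darr \<Rightarrow> 'v" where
  "dhd t h (Pos a) = h a" | "dhd t h (Star a) = t a"

fun dgam :: "('a \<Rightarrow> 'k) \<Rightarrow> 'a darr \<Rightarrow> 'k" where
  "dgam g (Pos a) = g a" | "dgam g (Star a) = g a"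

section \<open>Free algebra on generators, its tensor powers (as finitely supported functions)\<close>

datatype ('v,'a) gen = E 'v | Ar "'a darr" | Iv "'a darr"

definition fin1 :: "('g list \<Rightarrow> 'k::zero) \<Rightarrow> bool" where
  "fin1 f \<longleftrightarrow> finite {w. f w \<noteq> 0}"
definition fin2 :: "('g list \<times> 'g list \<Rightarrow> 'k::zero) \<Rightarrow> bool" where
  "fin2 f \<longleftrightarrow> finite {w. f w \<noteq> 0}"
definition fin3 :: "('g list \<times> 'g list \<times> 'g list \<Rightarrow> 'k::zero) \<Rightarrow> bool" where
  "fin3 f \<longleftrightarrow> finite {w. f w \<noteq> 0}"

definition vzero :: "'x \<Rightarrow> 'k::zero" where "vzero = (\<lambda>_. 0)"
definition vadd :: "('x \<Rightarrow> 'k::plus) \<Rightarrow> ('x \<Rightarrow> 'k) \<Rightarrow> 'x \<Rightarrow> 'k" where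
  "vadd f g = (\<lambda>x. f x + g x)"
definition vsub :: "('x \<Rightarrow> 'k::minus) \<Rightarrow> ('x \<Rightarrow> 'k) \<Rightarrow> 'x \<Rightarrow> 'k" where
  "vsub f g = (\<lambda>x. f x - g x)"
definition vneg :: "('x \<Rightarrow> 'k::uminus) \<Rightarrow> 'x \<Rightarrow> 'k" where
  "vneg f = (\<lambda>x. - f x)"
definition vscal :: "'k::times \<Rightarrow> ('x \<Rightarrow> 'k) \<Rightarrow> 'x \<Rightarrow> 'k" where
  "vscal c f = (\<lambda>x. c * f x)"

definition monom :: "'g list \<Rightarrow> 'g list \<Rightarrow> 'k::{zero,one}" where
  "monom w = (\<lambda>u. if u = w then 1 else 0)"
definition fone :: "'g list \<Rightarrow> 'k::{zero,one}" where "fone = monom []"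

text \<open>concatenation product of noncommutative polynomials (paths read left to right)\<close>
definition fmul :: "('g list \<Rightarrow> 'k::semiring_0) \<Rightarrow> ('g list \<Rightarrow> 'k) \<Rightarrow> 'g list \<Rightarrow> 'k" where
  "fmul f g = (\<lambda>w. \<Sum>i\<le>length w. f (take i w) * g (drop i w))"

definition tens :: "('g list \<Rightarrow> 'k::times) \<Rightarrow> ('g list \<Rightarrow> 'k) \<Rightarrow> 'g list \<times> 'g list \<Rightarrow> 'k" where
  "tens f g = (\<lambda>(u,v). f u * g v)"
definition tens3 :: "('g list \<Rightarrow> 'k::times) \<Rightarrow> ('g list \<Rightarrow> 'k) \<Rightarrow> ('g list \<Rightarrow> 'k)
    \<Rightarrow> 'g list \<times> 'g list \<times> 'g list \<Rightarrow> 'k" where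
  "tens3 f g h = (\<lambda>(u,v,w). f u * g v * h w)"

definition lmul2 :: "('g list \<Rightarrow> 'k::semiring_0) \<Rightarrow> ('g list \<times> 'g list \<Rightarrow> 'k) \<Rightarrow> 'g list \<times> 'g list \<Rightarrow> 'k" where
  "lmul2 x d = (\<lambda>(u,v). \<Sum>i\<le>length u. x (take i u) * d (drop i u, v))"
definition rmul2 :: "('g list \<times> 'g list \<Rightarrow> 'k::semiring_0) \<Rightarrow> ('g list \<Rightarrow> 'k) \<Rightarrow> 'g list \<times> 'g list \<Rightarrow> 'k" where
  "rmul2 d y = (\<lambda>(u,v). \<Sum>j\<le>length v. d (u, take j v) * y (drop j v))"

definition sw :: "('g list \<times> 'g list \<Rightarrow> 'k) \<Rightarrow> 'g list \<times> 'g list \<Rightarrow> 'k" where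
  "sw d = (\<lambda>(u,v). d (v,u))"

text \<open>tau(x1 \<otimes> x2 \<otimes> x3) = x3 \<otimes> x1 \<otimes> x2\<close>
definition tau :: "('g list \<times> 'g list \<times> 'g list \<Rightarrow> 'k) \<Rightarrow> 'g list \<times> 'g list \<times> 'g list \<Rightarrow> 'k" where
  "tau T = (\<lambda>(y1,y2,y3). T (y2,y3,y1))"

inductive_set fideal :: "('g list \<Rightarrow> 'k::field) set \<Rightarrow> ('g list \<Rightarrow> 'k) set" for R where
  fi_zero: "vzero \<in> fideal R"
| fi_gen: "r \<in> R \<Longrightarrow> fin1 x \<Longrightarrow> fin1 y \<Longrightarrow> fmul (fmul x r) y \<in> fideal R"
| fi_add: "p \<in> fideal R \<Longrightarrow> q \<in> fideal R \<Longrightarrow> vadd p q \<in> fideal R"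

inductive_set fideal2 :: "('g list \<Rightarrow> 'k::field) set \<Rightarrow> ('g list \<times> 'g list \<Rightarrow> 'k) set" for J where
  f2_zero: "vzero \<in> fideal2 J"
| f2_l: "x \<in> J \<Longrightarrow> fin1 y \<Longrightarrow> tens x y \<in> fideal2 J"
| f2_r: "fin1 x \<Longrightarrow> y \<in> J \<Longrightarrow> tens x y \<in> fideal2 J"
| f2_add: "p \<in> fideal2 J \<Longrightarrow> q \<in> fideal2 J \<Longrightarrow> vadd p q \<in> fideal2 J"

inductive_set fideal3 :: "('g list \<Rightarrow> 'k::field) set \<Rightarrow> ('g list \<times> 'g list \<times> 'g list \<Rightarrow> 'k) set" for J where
  f3_zero: "vzero \<in> fideal3 J"
| f3_1: "x \<in> J \<Longrightarrow> fin1 y \<Longrightarrow> fin1 z \<Longrightarrow> tens3 x y z \<in> fideal3 J"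
| f3_2: "fin1 x \<Longrightarrow> y \<in> J \<Longrightarrow> fin1 z \<Longrightarrow> tens3 x y z \<in> fideal3 J"
| f3_3: "fin1 x \<Longrightarrow> fin1 y \<Longrightarrow> z \<in> J \<Longrightarrow> tens3 x y z \<in> fideal3 J"
| f3_add: "p \<in> fideal3 J \<Longrightarrow> q \<in> fideal3 J \<Longrightarrow> vadd p q \<in> fideal3 J"

definition fe :: "'v \<Rightarrow> ('v,'a) gen list \<Rightarrow> 'k::{zero,one}" where "fe s = monom [E s]"
definition far :: "'a darr \<Rightarrow> ('v,'a) gen list \<Rightarrow> 'k::{zero,one}" where "far b = monom [Ar b]"
definition fiv :: "'a darr \<Rightarrow> ('v,'a) gen list \<Rightarrow> 'k::{zero,one}" where "fiv b = monom [Iv b]"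

definition locfac :: "('a \<Rightarrow> 'v) \<Rightarrow> ('a \<Rightarrow> 'v) \<Rightarrow> ('a \<Rightarrow> 'k::field) \<Rightarrow> 'a darr \<Rightarrow> ('v,'a) gen list \<Rightarrow> 'k" where
  "locfac t h g b = vadd (vscal (dgam g b) (fe (dtl t h b))) (fmul (far b) (far (dstar b)))"

text \<open>Relations: path algebra of the double quiver (idempotents, arrows), plus local
  inverses Iv b of gamma_b e_{t(b)} + b b^* in e_{t(b)} A e_{t(b)}, for all b in the double.\<close>
definition rels :: "('a \<Rightarrow> 'v) \<Rightarrow> ('a \<Rightarrow> 'v) \<Rightarrow> ('a \<Rightarrow> 'k::field) \<Rightarrow> (('v,'a) gen list \<Rightarrow> 'k) set" where
  "rels t h g =
     {vsub (fmul (fe s) (fe s')) (if s = s' then fe s else vzero) | s s'. True}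
   \<union> {vsub (\<lambda>w. \<Sum>s\<in>UNIV. fe s w) fone}
   \<union> {vsub (far b) (fmul (fmul (fe (dtl t h b)) (far b)) (fe (dhd t h b))) | b. True}
   \<union> {vsub (fiv b) (fmul (fmul (fe (dtl t h b)) (fiv b)) (fe (dtl t h b))) | b. True}
   \<union> {vsub (fmul (locfac t h g b) (fiv b)) (fe (dtl t h b)) | b. True}
   \<union> {vsub (fmul (fiv b) (locfac t h g b)) (fe (dtl t h b)) | b. True}"

definition Jid :: "('a \<Rightarrow> 'v) \<Rightarrow> ('a \<Rightarrow> 'v) \<Rightarrow> ('a \<Rightarrow> 'k::field) \<Rightarrow> (('v,'a) gen list \<Rightarrow> 'k) set" where
  "Jid t h g = fideal (rels t h g)"

text \<open>equality in A, A \<otimes> A, A \<otimes> A \<otimes> A (of finitely supported representatives)\<close>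
definition eqA :: "('a \<Rightarrow> 'v) \<Rightarrow> ('a \<Rightarrow> 'v) \<Rightarrow> ('a \<Rightarrow> 'k::field) \<Rightarrow> (('v,'a) gen list \<Rightarrow> 'k) \<Rightarrow> (('v,'a) gen list \<Rightarrow> 'k) \<Rightarrow> bool" where
  "eqA t h g f f' \<longleftrightarrow> vsub f f' \<in> Jid t h g"
definition eqA2 :: "('a \<Rightarrow> 'v) \<Rightarrow> ('a \<Rightarrow> 'v) \<Rightarrow> ('a \<Rightarrow> 'k::field) \<Rightarrow> (('v,'a) gen list \<times> ('v,'a) gen list \<Rightarrow> 'k) \<Rightarrow> (('v,'a) gen list \<times> ('v,'a) gen list \<Rightarrow> 'k) \<Rightarrow> bool" where
  "eqA2 t h g f f' \<longleftrightarrow> vsub f f' \<in> fideal2 (Jid t h g)"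
definition eqA3 :: "('a \<Rightarrow> 'v) \<Rightarrow> ('a \<Rightarrow> 'v) \<Rightarrow> ('a \<Rightarrow> 'k::field) \<Rightarrow> (('v,'a) gen list \<times> ('v,'a) gen list \<times> ('v,'a) gen list \<Rightarrow> 'k) \<Rightarrow> (('v,'a) gen list \<times> ('v,'a) gen list \<times> ('v,'a) gen list \<Rightarrow> 'k) \<Rightarrow> bool" where
  "eqA3 t h g f f' \<longleftrightarrow> vsub f f' \<in> fideal3 (Jid t h g)"

definition brx :: "('g list \<Rightarrow> 'g list \<Rightarrow> 'g list \<times> 'g list \<Rightarrow> 'k::field)
     \<Rightarrow> ('g list \<Rightarrow> 'k) \<Rightarrow> ('g list \<Rightarrow> 'k) \<Rightarrow> 'g list \<times> 'g list \<Rightarrow> 'k" where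
  "brx br f f' = (\<lambda>p. \<Sum>u\<in>{u. f u \<noteq> 0}. \<Sum>v\<in>{v. f' v \<noteq> 0}. f u * f' v * br u v p)"

definition trip_aux :: "('g list \<Rightarrow> 'g list \<Rightarrow> 'g list \<times> 'g list \<Rightarrow> 'k::field)
     \<Rightarrow> ('g list \<Rightarrow> 'k) \<Rightarrow> ('g list \<times> 'g list \<Rightarrow> 'k) \<Rightarrow> 'g list \<times> 'g list \<times> 'g list \<Rightarrow> 'k" where
  "trip_aux br x d = (\<lambda>(y1,y2,y3). \<Sum>u\<in>{u. d (u,y3) \<noteq> 0}. d (u,y3) * brx br x (monom u) (y1,y2))"

definition trip :: "('g list \<Rightarrow> 'g list \<Rightarrow> 'g list \<times> 'g list \<Rightarrow> 'k::field)
     \<Rightarrow> ('g list \<Rightarrow> 'k) \<Rightarrow> ('g list \<Rightarrow> 'k) \<Rightarrow> ('g list \<Rightarrow> 'k) \<Rightarrow> 'g list \<times> 'g list \<times> 'g list \<Rightarrow> 'k" where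
  "trip br a b c = vadd (trip_aux br a (brx br b c))
                     (vadd (tau (trip_aux br b (brx br c a))) (tau (tau (trip_aux br c (brx br a b)))))"

text \<open>B-linear double bracket on A, represented on the free algebra: well defined modulo the
  ideal, vanishing on B (spanned by the e_s), cyclically antisymmetric, Leibniz in 2nd argument.\<close>
definition is_dbracket :: "('a \<Rightarrow> 'v) \<Rightarrow> ('a \<Rightarrow> 'v) \<Rightarrow> ('a \<Rightarrow> 'k::field)
    \<Rightarrow> (('v,'a) gen list \<Rightarrow> ('v,'a) gen list \<Rightarrow> ('v,'a) gen list \<times> ('v,'a) gen list \<Rightarrow> 'k) \<Rightarrow> bool" where
  "is_dbracket t h g br \<longleftrightarrow>
     (\<forall>u v. fin2 (br u v))
   \<and> (\<forall>f f'. fin1 f \<and> fin1 f' \<and> f \<in> Jid t h g \<longrightarrow>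
         brx br f f' \<in> fideal2 (Jid t h g) \<and> brx br f' f \<in> fideal2 (Jid t h g))
   \<and> (\<forall>s f. fin1 f \<longrightarrow> eqA2 t h g (brx br (fe s) f) vzero \<and> eqA2 t h g (brx br f (fe s)) vzero)
   \<and> (\<forall>f f'. fin1 f \<and> fin1 f' \<longrightarrow> eqA2 t h g (brx br f f') (vneg (sw (brx br f' f))))
   \<and> (\<forall>f x y. fin1 f \<and> fin1 x \<and> fin1 y \<longrightarrow>
         eqA2 t h g (brx br f (fmul x y)) (vadd (rmul2 (brx br f x) y) (lmul2 x (brx br f y))))"

definition qp_rhs :: "(('v::finite,'a) gen list \<Rightarrow> 'k::field) \<Rightarrow> (('v,'a) gen list \<Rightarrow> 'k) \<Rightarrow> (('v,'a) gen list \<Rightarrow> 'k)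
    \<Rightarrow> ('v,'a) gen list \<times> ('v,'a) gen list \<times> ('v,'a) gen list \<Rightarrow> 'k" where
  "qp_rhs a b c = (\<lambda>p. (1/4) * (\<Sum>s\<in>UNIV.
        tens3 (fmul (fmul c (fe s)) a) (fmul (fe s) b) (fe s) p
      - tens3 (fmul (fmul c (fe s)) a) (fe s) (fmul b (fe s)) p
      - tens3 (fmul c (fe s)) (fmul (fmul a (fe s)) b) (fe s) p
      + tens3 (fmul c (fe s)) (fmul a (fe s)) (fmul b (fe s)) p
      - tens3 (fmul (fe s) a) (fmul (fe s) b) (fmul (fe s) c) p
      + tens3 (fmul (fe s) a) (fe s) (fmul (fmul b (fe s)) c) p
      + tens3 (fe s) (fmul (fmul a (fe s)) b) (fmul (fe s) c) p
      - tens3 (fe s) (fmul a (fe s)) (fmul (fmul b (fe s)) c) p))"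

definition is_qPoisson :: "('a \<Rightarrow> 'v::finite) \<Rightarrow> ('a \<Rightarrow> 'v) \<Rightarrow> ('a \<Rightarrow> 'k::field)
    \<Rightarrow> (('v,'a) gen list \<Rightarrow> ('v,'a) gen list \<Rightarrow> ('v,'a) gen list \<times> ('v,'a) gen list \<Rightarrow> 'k) \<Rightarrow> bool" where
  "is_qPoisson t h g br \<longleftrightarrow> is_dbracket t h g br \<and>
     (\<forall>a b c. fin1 a \<and> fin1 b \<and> fin1 c \<longrightarrow> eqA3 t h g (trip br a b c) (qp_rhs a b c))"

definition is_qHam :: "('a \<Rightarrow> 'v::finite) \<Rightarrow> ('a \<Rightarrow> 'v) \<Rightarrow> ('a \<Rightarrow> 'k::field)
    \<Rightarrow> (('v,'a) gen list \<Rightarrow> ('v,'a) gen list \<Rightarrow> ('v,'a) gen list \<times> ('v,'a) gen list \<Rightarrow> 'k)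
    \<Rightarrow> ('v \<Rightarrow> ('v,'a) gen list \<Rightarrow> 'k) \<Rightarrow> bool" where
  "is_qHam t h g br Phs \<longleftrightarrow> is_qPoisson t h g br
   \<and> (\<forall>s. fin1 (Phs s) \<and> eqA t h g (Phs s) (fmul (fmul (fe s) (Phs s)) (fe s)))
   \<and> (\<exists>\<psi>. fin1 \<psi> \<and> eqA t h g (fmul (\<lambda>w. \<Sum>s\<in>UNIV. Phs s w) \<psi>) fone
           \<and> eqA t h g (fmul \<psi> (\<lambda>w. \<Sum>s\<in>UNIV. Phs s w)) fone)
   \<and> (\<forall>s f. fin1 f \<longrightarrow> eqA2 t h g (brx br (Phs s) f)
        (vscal (1/2) (vadd (vsub (tens (fmul f (fe s)) (Phs s)) (tens (fe s) (fmul (Phs s) f)))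
                           (vsub (tens (fmul f (Phs s)) (fe s)) (tens (Phs s) (fmul (fe s) f))))))"

definition osgn :: "('v \<Rightarrow> 'a darr \<Rightarrow> 'a darr \<Rightarrow> bool) \<Rightarrow> ('a \<Rightarrow> 'v) \<Rightarrow> ('a \<Rightarrow> 'v) \<Rightarrow> 'v
    \<Rightarrow> 'a darr \<Rightarrow> 'a darr \<Rightarrow> 'k::ring_1" where
  "osgn lt t h s a b = (if a \<noteq> b \<and> dtl t h a = s \<and> dtl t h b = s
                         then (if lt s a b then 1 else -1) else 0)"

definition Tlist :: "('v \<Rightarrow> 'a darr \<Rightarrow> 'a darr \<Rightarrow> bool) \<Rightarrow> ('a \<Rightarrow> 'v) \<Rightarrow> ('a \<Rightarrow> 'v) \<Rightarrow> 'v \<Rightarrow> 'a darr list" where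
  "Tlist lt t h s = (THE xs. set xs = {b. dtl t h b = s} \<and> sorted_wrt (lt s) xs)"

text \<open>factor (gamma_b e_s + b b^*)^{eps(b)}; for eps = -1 this is the local inverse Iv b\<close>
definition mfac :: "('a \<Rightarrow> 'v) \<Rightarrow> ('a \<Rightarrow> 'v) \<Rightarrow> ('a \<Rightarrow> 'k::field) \<Rightarrow> 'a darr \<Rightarrow> ('v,'a) gen list \<Rightarrow> 'k" where
  "mfac t h g b = (case b of Pos _ \<Rightarrow> locfac t h g b | Star _ \<Rightarrow> fiv b)"

text \<open>Phi_s: ordered product, an empty product being e_s (the unit of e_s A e_s)\<close>
definition Phis :: "('v \<Rightarrow> 'a darr \<Rightarrow> 'a darr \<Rightarrow> bool) \<Rightarrow> ('a \<Rightarrow> 'v) \<Rightarrow> ('a \<Rightarrow> 'v) \<Rightarrow> ('a \<Rightarrow> 'k::field)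
    \<Rightarrow> 'v \<Rightarrow> ('v,'a) gen list \<Rightarrow> 'k" where
  "Phis lt t h g s = foldr (\<lambda>b acc. fmul (mfac t h g b) acc) (Tlist lt t h s) (fe s)"

end

theory Submission
  imports Defs Complex_Main
begin

text \<open>
  An element \<open>d\<close> of \<open>A \<otimes> A\<close> is encoded by the functional sending a bilinear form \<open>\<beta>\<close> to the value of \<open>\<beta>\<close>
  on \<open>d\<close>, and likewise for \<open>A \<otimes> A \<otimes> A\<close> and trilinear forms; every identity to be proved becomes an
  identity of scalars. The two sides of the quasi-Poisson identity are derivations in each argument, and
  local inverses are determined by what they invert, so only triples of arrows matter. On arrows
  the bracket is the sum of a part governed by the orderings alone, given by one uniform formula,
  and of a part pairing an arrow with its opposite. The identity
  \<open>o(x,y) o(y,z) + o(y,z) o(z,x) + o(z,x) o(x,y) = [x = y = z] - [same vertex]\<close> for the ordering function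
  shows that the first part satisfies the quasi-Poisson identity up to terms in which three half-edges
  coincide. The mixed terms cancel, and the second part contributes exactly these missing terms.
  The bracket of an arrow with an ordered product of factors \<open>\<gamma> + b b\<^sup>*\<close> or their inverses telescopes,
  which gives the moment map property.

  On the free algebra the bracket is obtained by feeding the noncommutative differentials of two words
  into the bracket of arrows; it descends to \<open>A\<close> because the differential kills the relations.
\<close>

section \<open>The bracket on arrows\<close>

text \<open>Tensor powers of \<open>A\<close> never appear as objects: the statement asks for
  membership in \<open>fideal2\<close> and \<open>fideal3\<close>. Over a field, a tensor outside
  such an ideal is detected by a product of coordinate forms of a linear complement, so scalar
  identities lose nothing. The quasi-Poisson right side has eight words because each of three arrows
  enters through one of its two ends, and the idempotent at \<open>s\<close> forces the three chosen
  half-edges to be attached to \<open>s\<close>. The nested ordering terms give, for each choice,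
  the sum of products of neighbouring signs around a cycle. Three signs around a cycle of distinct
  elements of a total order are never all equal, so this sum is -1; the factor 1/4 is the square of
  the 1/2 in the bracket. Products that use both ends of one arrow cancel in pairs. If the three
  half-edges coincide, the cyclic sum is 0 instead of -1. This can only happen when each of the
  three arrows is some x or \<open>dstar x\<close>, and the defect is repaired by the terms
  \<open>dstar a\<close> a \<otimes> e and e \<otimes> a \<open>dstar a\<close> in the bracket of a
  with \<open>dstar a\<close>. The constants \<gamma> cancel in that repair.\<close>

definition kron :: "'v \<Rightarrow> 'v \<Rightarrow> 'k::field" where "kron s s' = (if s = s' then 1 else 0)"

definition linear_form :: "('k \<Rightarrow> 'r \<Rightarrow> 'r) \<Rightarrow> ('r::plus \<Rightarrow> 'k::{plus,times}) \<Rightarrow> bool" where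
  "linear_form scl f \<longleftrightarrow> (\<forall>x y. f (x + y) = f x + f y) \<and> (\<forall>c x. f (scl c x) = c * f x)"

definition bilinear_form :: "('k \<Rightarrow> 'r \<Rightarrow> 'r) \<Rightarrow> ('r::plus \<Rightarrow> 'r \<Rightarrow> 'k::{plus,times}) \<Rightarrow> bool" where
  "bilinear_form scl \<beta> \<longleftrightarrow> (\<forall>y. linear_form scl (\<lambda>x. \<beta> x y)) \<and> (\<forall>x. linear_form scl (\<beta> x))"

definition trilinear_form :: "('k \<Rightarrow> 'r \<Rightarrow> 'r) \<Rightarrow> ('r::plus \<Rightarrow> 'r \<Rightarrow> 'r \<Rightarrow> 'k::{plus,times}) \<Rightarrow> bool" where
  "trilinear_form scl f \<longleftrightarrow> (\<forall>y z. linear_form scl (\<lambda>x. f x y z)) \<and> (\<forall>x z. linear_form scl (\<lambda>y. f x y z))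
     \<and> (\<forall>x y. linear_form scl (\<lambda>z. f x y z))"

definition kron3 :: "'d \<Rightarrow> 'd \<Rightarrow> 'd \<Rightarrow> 'k::field" where "kron3 x y z = (if x = y \<and> y = z then 1 else 0)"

lemma dstar_dstar [simp]: "dstar (dstar b) = b"
  by (cases b) auto

text \<open>
  A half-edge is an arrow \<open>b\<close> of the double, attached to the vertex \<open>tl b\<close>; the two ends of \<open>b\<close> are the half-edges
  \<open>b\<close> and \<open>dstar b\<close>. The ring need not be unital: the algebra will be embedded into a ring of
  endomorphisms by a homomorphism that sends its unit to a proper idempotent.
\<close>

locale arrow_algebra =
  fixes scl :: "'k::field_char_0 \<Rightarrow> 'r::ring \<Rightarrow> 'r"
    and tl hd :: "'a darr \<Rightarrow> 'v::finite" and gam :: "'a darr \<Rightarrow> 'k"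
    and os :: "'a darr \<Rightarrow> 'a darr \<Rightarrow> 'k" and eps :: "'a darr \<Rightarrow> 'k"
    and e :: "'v \<Rightarrow> 'r" and ar :: "'a darr \<Rightarrow> 'r"
  assumes scl_1: "scl 1 x = x" and scl_0: "scl 0 x = 0"
    and scl_mult_left: "scl k x * y = scl k (x * y)"
    and scl_mult_right: "x * scl k y = scl k (x * y)"
    and tl_dstar: "tl (dstar b) = hd b"
    and e_e: "e s * e s' = scl (kron s s') (e s)"
    and e_ar: "e s * ar b = scl (kron s (tl b)) (ar b)"
    and ar_e: "ar b * e s = scl (kron (hd b) s) (ar b)"
    and os_anti: "os b c = - os c b"
    and os_tl: "tl b \<noteq> tl c \<Longrightarrow> os b c = 0"
    and os_quad: "os b c * os c d + os c d * os d b + os d b * os b c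
        = kron3 b c d - kron (tl b) (tl c) * kron (tl c) (tl d)"
    and eps_dstar: "eps (dstar b) = - eps b" and eps_sq: "eps b * eps b = 1"
    and gam_dstar: "gam (dstar b) = gam b"
begin

abbreviation "lin \<equiv> linear_form scl"
abbreviation "bil \<equiv> bilinear_form scl"
abbreviation "tril \<equiv> trilinear_form scl"

text \<open>
  Twice the double bracket of two arrows is \<open>ord_bracket + edge_bracket\<close>, for all pairs of arrows: since
  \<open>os b b = 0\<close>, the general formula also covers the brackets of \<open>b\<close> with \<open>b\<close> and \<open>dstar b\<close>, up to the terms
  collected in \<open>edge_bracket\<close>.
\<close>

definition ord_bracket :: "'a darr \<Rightarrow> 'a darr \<Rightarrow> ('r \<Rightarrow> 'r \<Rightarrow> 'k) \<Rightarrow> 'k" where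
  "ord_bracket b c \<beta> = (- os b c * \<beta> (ar b) (ar c) - os (dstar b) (dstar c) * \<beta> (ar c) (ar b)
     + os b (dstar c) * \<beta> (ar c * ar b) (e (tl b)) + os (dstar b) c * \<beta> (e (hd b)) (ar b * ar c))"

text \<open>
  \<open>ord_nested I a b c\<close> is \<open>{{a, {{b, c}}'}} \<otimes> {{b, c}}''\<close> with \<open>ord_bracket\<close> as inner and \<open>I\<close> as outer bracket;
  brackets with idempotents vanish.
\<close>

definition ord_nested where
  "ord_nested I a b c f = (- os b c * I a b (\<lambda>p q. f p q (ar c))
      - os (dstar b) (dstar c) * I a c (\<lambda>p q. f p q (ar b))
   + os b (dstar c) * (I a c (\<lambda>p q. f p (q * ar b) (e (tl b))) + I a b (\<lambda>p q. f (ar c * p) q (e (tl b)))))"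

lemma trilD: assumes "tril f"
  shows "f (scl c x) y z = c * f x y z" "f x (scl c y) z = c * f x y z" "f x y (scl c z) = c * f x y z"
  using assms by (auto simp: trilinear_form_def linear_form_def)

definition qp_form :: "'r \<Rightarrow> 'r \<Rightarrow> 'r \<Rightarrow> ('r \<Rightarrow> 'r \<Rightarrow> 'r \<Rightarrow> 'k) \<Rightarrow> 'k" where "qp_form a b c f = (1/4) * (\<Sum>s\<in>UNIV.
      f (c * e s * a) (e s * b) (e s) - f (c * e s * a) (e s) (b * e s)
    - f (c * e s) (a * e s * b) (e s) + f (c * e s) (a * e s) (b * e s)
    - f (e s * a) (e s * b) (e s * c) + f (e s * a) (e s) (b * e s * c)
    + f (e s) (a * e s * b) (e s * c) - f (e s) (a * e s) (b * e s * c))"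

lemma sum_kron: "(\<Sum>s\<in>UNIV. kron s' s * g s) = g s'" "(\<Sum>s\<in>UNIV. kron s s' * g s) = g s'"
  for g :: "'v \<Rightarrow> 'k"
  by (simp_all add: kron_def if_distrib[of "\<lambda>x. x * _"] cong: if_cong)

lemma hd_dstar: "hd (dstar b) = tl b" using tl_dstar[of "dstar b"] by simp

lemma os_eq_0_or: "os x y = 0 \<or> tl x = tl y"
  using os_tl by blast

text \<open>All products vanish unless the three half-edges share their vertex, so the vertex at
  which \<open>g\<close> is evaluated may be named after any of them. The nested brackets produce
  the same idempotent under different names; \<open>s1\<close> to \<open>s4\<close> accommodate
  this.\<close>

lemma os_quad_apply:
  fixes g :: "'v \<Rightarrow> 'k"
  assumes "{s1,s2,s3,s4} \<subseteq> {tl x, tl y, tl z}"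
  shows "os x y * os y z * g s1 + os y z * os z x * g s2 + os z x * os x y * g s3
    = (kron3 x y z - kron (tl x) (tl y) * kron (tl y) (tl z)) * g s4"
proof (cases "tl x = tl y \<and> tl y = tl z")
  case True
  with assms have "s1 = tl x" "s2 = tl x" "s3 = tl x" "s4 = tl x" by auto
  then show ?thesis by (simp add: os_quad[symmetric] ring_distribs)
next
  case False
  then have 0: "os x y * os y z = 0" "os y z * os z x = 0" "os z x * os x y = 0"
    using os_eq_0_or False by (metis mult_zero_left mult_zero_right)+
  have 1: "kron3 x y z = (0::'k)" "kron (tl x) (tl y) * kron (tl y) (tl z) = (0::'k)"
    using False by (auto simp: kron_def kron3_def)
  show ?thesis unfolding 0 1 by simp
qed

text \<open>Two nonzero signs already connect all three half-edges, so a further comparison of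
  vertices is automatic.\<close>

lemma os_os_kron:
  "os x y * (os z y * (kron (tl z) (tl x) * w)) = os x y * (os z y * w)"
  "os x y * (os z x * (kron (tl y) (tl z) * w)) = os x y * (os z x * w)"
  "os x y * (os z x * (kron (tl z) (tl y) * w)) = os x y * (os z x * w)"
  "os x y * (os y z * (kron (tl z) (tl x) * w)) = os x y * (os y z * w)"
  subgoal using os_eq_0_or[of x y] os_eq_0_or[of z y] by (auto simp: kron_def)
  subgoal using os_eq_0_or[of x y] os_eq_0_or[of z x] by (auto simp: kron_def)
  subgoal using os_eq_0_or[of x y] os_eq_0_or[of z x] by (auto simp: kron_def)
  subgoal using os_eq_0_or[of x y] os_eq_0_or[of y z] by (auto simp: kron_def)
  done

text \<open>Arrows that do not compose have product zero. The factor \<open>scl 1\<close> lets a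
  multilinear form turn both sides into scalar multiples.\<close>

lemma ar_ar: "scl 1 (ar b * ar c) = scl (kron (hd b) (tl c)) (ar b * ar c)"
proof -
  have "ar b * e (hd b) * ar c = ar b * (e (hd b) * ar c)" by (simp add: mult.assoc)
  then show ?thesis by (simp add: e_ar ar_e scl_mult_left scl_mult_right kron_def)
qed

lemma tril_ar_ar: assumes "tril f"
  shows "f (ar b * ar c) y z = kron (hd b) (tl c) * f (ar b * ar c) y z"
    "f x (ar b * ar c) z = kron (hd b) (tl c) * f x (ar b * ar c) z"
    "f x y (ar b * ar c) = kron (hd b) (tl c) * f x y (ar b * ar c)"
  using arg_cong[OF ar_ar, of "\<lambda>w. f w y z" b c] arg_cong[OF ar_ar, of "\<lambda>w. f x w z" b c]
    arg_cong[OF ar_ar, of "\<lambda>w. f x y w" b c]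
  by (simp_all only: trilD[OF assms] mult_1)

text \<open>
  The words of \<open>qp_form\<close>, one for each choice of an end of each arrow, restricted to the choices for
  which the three half-edges coincide.
\<close>

definition coincidence_form where "coincidence_form a b c f =
    kron3 a b c * f (ar a) (ar b) (ar c)
  - kron3 (dstar a) (dstar b) (dstar c) * f (ar c) (ar a) (ar b)
  - kron3 a b (dstar c) * f (ar c * ar a) (ar b) (e (hd c))
  + kron3 a (dstar b) (dstar c) * f (ar c * ar a) (e (hd c)) (ar b)
  + kron3 (dstar a) b (dstar c) * f (ar c) (ar a * ar b) (e (hd c))
  - kron3 a (dstar b) c * f (ar a) (e (hd b)) (ar b * ar c)
  - kron3 (dstar a) b c * f (e (hd a)) (ar a * ar b) (ar c)
  + kron3 (dstar a) (dstar b) c * f (e (hd a)) (ar a) (ar b * ar c)"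

text \<open>Expansion gives 48 products of two signs. In 24 of them the arrow common to both signs
  enters with two different ends; these cancel in pairs, since each arises from two orders of
  nesting. The other 24 form eight cyclic triples, one for each choice of an end of each arrow, and
  \<open>os_quad\<close> evaluates each triple.\<close>

lemma ord_ord_jacobi: assumes f: "tril f"
  shows "ord_nested ord_bracket a b c f + ord_nested ord_bracket b c a (\<lambda>p q v. f v p q)
      + ord_nested ord_bracket c a b (\<lambda>p q v. f q v p)
    = 4 * qp_form (ar a) (ar b) (ar c) f + coincidence_form a b c f"
proof -
  have anti: "os b a = - os a b" "os c a = - os a c" "os c b = - os b c"
    "os (dstar b) a = - os a (dstar b)" "os (dstar c) a = - os a (dstar c)" "os (dstar c) b = - os b (dstar c)"
    "os b (dstar a) = - os (dstar a) b" "os c (dstar a) = - os (dstar a) c" "os c (dstar b) = - os (dstar b) c"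
    "os (dstar b) (dstar a) = - os (dstar a) (dstar b)" "os (dstar c) (dstar a) = - os (dstar a) (dstar c)"
    "os (dstar c) (dstar b) = - os (dstar b) (dstar c)" by (rule os_anti)+
  \<comment> \<open>A nonzero sign or \<open>kron\<close> identifies two names of a vertex. The
    facts \<open>a\<close>, \<open>b\<close> and \<open>c\<close> select one of them, so that equal
    words become syntactically equal.\<close>
  have b: "os b (dstar c) * (w * f x y (e (tl b))) = os b (dstar c) * (w * f x y (e (hd c)))"
    "w * (os b (dstar c) * f x y (e (tl b))) = w * (os b (dstar c) * f x y (e (hd c)))" for w x y
    using os_eq_0_or[of b "dstar c"] by (auto simp: tl_dstar)
  have c: "os (dstar a) c * (w * f (e (tl c)) x y) = os (dstar a) c * (w * f (e (hd a)) x y)"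
    "w * (os (dstar a) c * f (e (tl c)) x y) = w * (os (dstar a) c * f (e (hd a)) x y)" for w x y
    using os_eq_0_or[of "dstar a" c] by (auto simp: tl_dstar)
  have a: "os a (dstar b) * (w * f x (e (tl a)) y) = os a (dstar b) * (w * f x (e (hd b)) y)"
    "w * (os a (dstar b) * f x (e (tl a)) y) = w * (os a (dstar b) * f x (e (hd b)) y)"
    "kron (hd b) (tl a) * f x (e (tl a)) y = kron (hd b) (tl a) * f x (e (hd b)) y" for w x y
    using os_eq_0_or[of a "dstar b"] by (auto simp: tl_dstar kron_def)
  \<comment> \<open>\<open>C1\<close> to \<open>C8\<close> are \<open>os_quad\<close> for the eight
    choices, solved for the \<open>kron\<close> product contributed by \<open>qp_form\<close>. In
    each, \<open>*\<close> brings that product into the form left by the simplifier; if the word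
    contains a product of arrows, it uses that this product vanishes unless they compose.\<close>
  have C1: "kron (tl a) (tl b) * (kron (tl a) (tl c) * f (ar a) (ar b) (ar c))
      = kron3 a b c * f (ar a) (ar b) (ar c) - os a b * os b c * f (ar a) (ar b) (ar c)
      + os b c * os a c * f (ar a) (ar b) (ar c) + os a c * os a b * f (ar a) (ar b) (ar c)"
  proof -
    have *: "kron (tl a) (tl b) * kron (tl b) (tl c) * f (ar a) (ar b) (ar c)
        = kron (tl a) (tl b) * (kron (tl a) (tl c) * f (ar a) (ar b) (ar c))"
      using tril_ar_ar[OF f, where b=a and c=b] by (auto simp: kron_def)
    show ?thesis
      using os_quad_apply[of "tl a" "tl a" "tl a" "tl a" "a" "b" "c" "\<lambda>s. f (ar a) (ar b) (ar c)"]
      unfolding *[symmetric] by (simp add: tl_dstar anti algebra_simps)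
  qed
  have C2: "kron (hd a) (hd c) * (kron (hd b) (hd c) * f (ar c) (ar a) (ar b))
      = kron3 (dstar a) (dstar b) (dstar c) * f (ar c) (ar a) (ar b)
      - os (dstar a) (dstar b) * os (dstar b) (dstar c) * f (ar c) (ar a) (ar b)
      + os (dstar b) (dstar c) * os (dstar a) (dstar c) * f (ar c) (ar a) (ar b)
      + os (dstar a) (dstar c) * os (dstar a) (dstar b) * f (ar c) (ar a) (ar b)"
  proof -
    have *: "kron (hd a) (hd b) * kron (hd b) (hd c) * f (ar c) (ar a) (ar b)
        = kron (hd a) (hd c) * (kron (hd b) (hd c) * f (ar c) (ar a) (ar b))"
      using tril_ar_ar[OF f, where b=a and c=b] by (auto simp: kron_def)
    show ?thesis
      using os_quad_apply[of "hd a" "hd a" "hd a" "hd a" "dstar a" "dstar b" "dstar c"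
          "\<lambda>s. f (ar c) (ar a) (ar b)"]
      unfolding *[symmetric] by (simp add: tl_dstar anti algebra_simps)
  qed
  have C3: "kron (hd c) (tl b) * (f (ar c * ar a) (ar b) (e (hd c)))
      = kron3 a b (dstar c) * f (ar c * ar a) (ar b) (e (hd c))
      - os a b * os b (dstar c) * f (ar c * ar a) (ar b) (e (hd c))
      + os b (dstar c) * os a (dstar c) * f (ar c * ar a) (ar b) (e (hd c))
      + os a (dstar c) * os a b * f (ar c * ar a) (ar b) (e (hd c))"
  proof -
    have *: "kron (tl a) (tl b) * kron (tl b) (hd c) * f (ar c * ar a) (ar b) (e (hd c))
        = kron (hd c) (tl b) * (f (ar c * ar a) (ar b) (e (hd c)))"
      using tril_ar_ar[OF f, where b=c and c=a] by (auto simp: kron_def)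
    show ?thesis
      using os_quad_apply[of "hd c" "hd c" "hd c" "hd c" "a" "b" "dstar c" "\<lambda>s. f (ar c * ar a) (ar b) (e s)"]
      unfolding *[symmetric] by (simp add: tl_dstar anti algebra_simps)
  qed
  have C4: "kron (hd b) (hd c) * (f (ar c * ar a) (e (hd c)) (ar b))
      = kron3 a (dstar b) (dstar c) * f (ar c * ar a) (e (hd c)) (ar b)
      - os a (dstar b) * os (dstar b) (dstar c) * f (ar c * ar a) (e (hd b)) (ar b)
      + os (dstar b) (dstar c) * os a (dstar c) * f (ar c * ar a) (e (tl a)) (ar b)
      + os a (dstar c) * os a (dstar b) * f (ar c * ar a) (e (hd b)) (ar b)"
  proof -
    have *: "kron (tl a) (hd b) * kron (hd b) (hd c) * f (ar c * ar a) (e (hd c)) (ar b)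
        = kron (hd b) (hd c) * (f (ar c * ar a) (e (hd c)) (ar b))"
      using tril_ar_ar[OF f, where b=c and c=a] by (auto simp: kron_def)
    show ?thesis
      using os_quad_apply[of "hd b" "tl a" "hd b" "hd c" "a" "dstar b" "dstar c"
          "\<lambda>s. f (ar c * ar a) (e s) (ar b)"]
      unfolding *[symmetric] by (simp add: tl_dstar anti algebra_simps)
  qed
  have C5: "kron (hd a) (hd c) * (f (ar c) (ar a * ar b) (e (hd c)))
      = kron3 (dstar a) b (dstar c) * f (ar c) (ar a * ar b) (e (hd c))
      - os (dstar a) b * os b (dstar c) * f (ar c) (ar a * ar b) (e (hd c))
      + os b (dstar c) * os (dstar a) (dstar c) * f (ar c) (ar a * ar b) (e (hd c))
      + os (dstar a) (dstar c) * os (dstar a) b * f (ar c) (ar a * ar b) (e (tl b))"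
  proof -
    have *: "kron (hd a) (tl b) * kron (tl b) (hd c) * f (ar c) (ar a * ar b) (e (hd c))
        = kron (hd a) (hd c) * (f (ar c) (ar a * ar b) (e (hd c)))"
      using tril_ar_ar[OF f, where b=a and c=b] by (auto simp: kron_def)
    show ?thesis
      using os_quad_apply[of "hd c" "hd c" "tl b" "hd c" "dstar a" "b" "dstar c"
          "\<lambda>s. f (ar c) (ar a * ar b) (e s)"]
      unfolding *[symmetric] by (simp add: tl_dstar anti algebra_simps)
  qed
  have C6: "kron (hd b) (tl a) * (f (ar a) (e (hd b)) (ar b * ar c))
      = kron3 a (dstar b) c * f (ar a) (e (hd b)) (ar b * ar c)
      - os a (dstar b) * os (dstar b) c * f (ar a) (e (hd b)) (ar b * ar c)
      + os (dstar b) c * os a c * f (ar a) (e (hd b)) (ar b * ar c)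
      + os a c * os a (dstar b) * f (ar a) (e (hd b)) (ar b * ar c)"
  proof -
    have *: "kron (tl a) (hd b) * kron (hd b) (tl c) * f (ar a) (e (hd b)) (ar b * ar c)
        = kron (hd b) (tl a) * (f (ar a) (e (hd b)) (ar b * ar c))"
      using tril_ar_ar[OF f, where b=b and c=c] by (auto simp: kron_def)
    show ?thesis
      using os_quad_apply[of "hd b" "hd b" "hd b" "hd b" "a" "dstar b" "c" "\<lambda>s. f (ar a) (e s) (ar b * ar c)"]
      unfolding *[symmetric] by (simp add: tl_dstar anti algebra_simps)
  qed
  have C7: "kron (hd a) (tl c) * (f (e (hd a)) (ar a * ar b) (ar c))
      = kron3 (dstar a) b c * f (e (hd a)) (ar a * ar b) (ar c)
      - os (dstar a) b * os b c * f (e (hd a)) (ar a * ar b) (ar c)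
      + os b c * os (dstar a) c * f (e (hd a)) (ar a * ar b) (ar c)
      + os (dstar a) c * os (dstar a) b * f (e (hd a)) (ar a * ar b) (ar c)"
  proof -
    have *: "kron (hd a) (tl b) * kron (tl b) (tl c) * f (e (hd a)) (ar a * ar b) (ar c)
        = kron (hd a) (tl c) * (f (e (hd a)) (ar a * ar b) (ar c))"
      using tril_ar_ar[OF f, where b=a and c=b] by (auto simp: kron_def)
    show ?thesis
      using os_quad_apply[of "hd a" "hd a" "hd a" "hd a" "dstar a" "b" "c" "\<lambda>s. f (e s) (ar a * ar b) (ar c)"]
      unfolding *[symmetric] by (simp add: tl_dstar anti algebra_simps)
  qed
  have C8: "kron (hd b) (hd a) * (f (e (hd a)) (ar a) (ar b * ar c))
      = kron3 (dstar a) (dstar b) c * f (e (hd a)) (ar a) (ar b * ar c)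
      - os (dstar a) (dstar b) * os (dstar b) c * f (e (tl c)) (ar a) (ar b * ar c)
      + os (dstar b) c * os (dstar a) c * f (e (hd a)) (ar a) (ar b * ar c)
      + os (dstar a) c * os (dstar a) (dstar b) * f (e (hd a)) (ar a) (ar b * ar c)"
  proof -
    have *: "kron (hd a) (hd b) * kron (hd b) (tl c) * f (e (hd a)) (ar a) (ar b * ar c)
        = kron (hd b) (hd a) * (f (e (hd a)) (ar a) (ar b * ar c))"
      using tril_ar_ar[OF f, where b=b and c=c] by (auto simp: kron_def)
    show ?thesis
      using os_quad_apply[of "tl c" "hd a" "hd a" "hd a" "dstar a" "dstar b" "c"
          "\<lambda>s. f (e s) (ar a) (ar b * ar c)"]
      unfolding *[symmetric] by (simp add: tl_dstar anti algebra_simps)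
  qed
  note kron_absorb = os_os_kron os_os_kron[of "dstar x" for x, unfolded tl_dstar]
    os_os_kron[of _ "dstar x" for x, unfolded tl_dstar] os_os_kron[of _ _ "dstar x" for x, unfolded tl_dstar]
    os_os_kron[of "dstar x" "dstar y" for x y, unfolded tl_dstar]
    os_os_kron[of "dstar x" _ "dstar y" for x y, unfolded tl_dstar]
    os_os_kron[of _ "dstar x" "dstar y" for x y, unfolded tl_dstar]
  show ?thesis
    unfolding ord_nested_def ord_bracket_def qp_form_def coincidence_form_def using f
    apply (simp add: scl_mult_left scl_mult_right e_e e_ar ar_e trilD mult.assoc ring_distribs
        sum.distrib sum_subtractf hd_dstar tl_dstar sum_kron kron_absorb)
    apply (simp add: anti)
    apply (simp add: a b c algebra_simps)
    apply (simp add: C1 C2 C3 C4 C5 C6 C7 C8)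
    done
qed

definition edge_bracket :: "'a darr \<Rightarrow> 'a darr \<Rightarrow> ('r \<Rightarrow> 'r \<Rightarrow> 'k) \<Rightarrow> 'k" where
  "edge_bracket b c \<beta> = (if c = dstar b then eps b * (2 * gam b * \<beta> (e (hd b)) (e (tl b))
     + \<beta> (ar c * ar b) (e (tl b)) + \<beta> (e (hd b)) (ar b * ar c)) else 0)"

definition edge_nested where
  "edge_nested I a b c f = (if c = dstar b then eps b * (I a c (\<lambda>p q. f p (q * ar b) (e (tl b)))
     + I a b (\<lambda>p q. f (ar c * p) q (e (tl b)))) else 0)"

lemma os_kron: "os x y * (kron (tl x) (tl y) * w) = os x y * w" "os x y * (kron (tl y) (tl x) * w) = os x y * w"
  using os_eq_0_or[of x y] by (auto simp: kron_def)

text \<open>The mixed terms in which the edge bracket contracts \<open>b\<close> with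
  \<open>c\<close>: the first has it as inner bracket, the others as outer bracket inside the
  remaining two nestings. Grouped by the contracted pair rather than by the nesting, the mixed terms
  vanish group by group.\<close>

lemma edge_ord_jacobi: assumes f: "tril f"
  shows "edge_nested ord_bracket a b c f
    + (- os c a * edge_bracket b c (\<lambda>p q. f (ar a) p q)
        + os c (dstar a) * edge_bracket b c (\<lambda>p q. f (e (tl c)) (ar a * p) q))
    + (- os (dstar a) (dstar b) * edge_bracket c b (\<lambda>p q. f q (ar a) p)
        + os a (dstar b) * edge_bracket c b (\<lambda>p q. f (q * ar a) (e (tl a)) p))
   = 0"
proof (cases "c = dstar b")
  case True
  note kron_absorb = os_kron os_kron[of "dstar x" for x, unfolded tl_dstar] os_kron[of _ "dstar x"
      for x, unfolded tl_dstar]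
    os_kron[of "dstar x" "dstar y" for x y, unfolded tl_dstar]
  show ?thesis
    using True f unfolding edge_nested_def edge_bracket_def ord_bracket_def
    apply (simp add: scl_mult_left scl_mult_right e_e e_ar ar_e trilD mult.assoc hd_dstar tl_dstar
        eps_dstar gam_dstar kron_absorb mult.left_commute[of "kron x y" for x y])
    apply (simp add: algebra_simps os_anti[of b a] os_anti[of "dstar b" a] os_anti[of b "dstar a"]
        os_anti[of "dstar b" "dstar a"])
    apply (simp add: kron_absorb)
    using os_eq_0_or[of "dstar a" "dstar b"] os_eq_0_or[of a "dstar b"]
    apply (elim disjE; simp add: kron_def tl_dstar)
    done
qed (auto simp: edge_nested_def edge_bracket_def)

text \<open>A nonzero nested term pairs two opposite arrows and then the third with one of them, so
  the arrows are x, x and \<open>dstar x\<close> in some order: cases 1 to 3. There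
  \<open>eps_sq\<close> removes the products of two \<open>eps\<close>, and the terms with
  \<open>gam\<close> cancel. For three equal arrows both sides vanish, because the first two
  summands of \<open>coincidence_form\<close> cancel.\<close>

lemma edge_edge_jacobi: assumes f: "tril f"
  shows "edge_nested edge_bracket a b c f + edge_nested edge_bracket b c a (\<lambda>p q v. f v p q)
      + edge_nested edge_bracket c a b (\<lambda>p q v. f q v p) = - coincidence_form a b c f"
proof -
  have s: "dstar x = dstar y \<longleftrightarrow> x = y" "x \<noteq> dstar x" "dstar x \<noteq> x" for x y :: "'a darr"
    by (cases x; cases y; auto)+
  note simps = edge_nested_def edge_bracket_def coincidence_form_def kron3_def kron_def s scl_mult_left
      scl_mult_right e_e e_ar ar_e trilD[OF f]
    hd_dstar tl_dstar eps_dstar gam_dstar mult.assoc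
  note simps' = mult.assoc[symmetric] eps_sq right_diff_distrib
  consider "b = a" "c = dstar a" | "c = a" "b = dstar a" | "b = c" "a = dstar c"  | "c = a" "b = a"
    | "\<not> (c = dstar b \<and> (a = b \<or> a = c))" "\<not> (a = dstar c \<and> (b = c \<or> b = a))"
      "\<not> (b = dstar a \<and> (c = a \<or> c = b))" "\<not> (a = b \<and> b = c)"
    by (metis dstar_dstar)
  then show ?thesis
  proof cases
    case 1 show ?thesis unfolding 1 by (simp add: simps) (simp add: simps')
  next
    case 2 show ?thesis unfolding 2 by (simp add: simps) (simp add: simps')
  next
    case 3 show ?thesis unfolding 3 by (simp add: simps) (simp add: simps')
  next
    case 4 show ?thesis unfolding 4 by (simp add: simps)
  next
    case 5
    have 0: "edge_nested edge_bracket a b c f = 0" if "\<not> (c = dstar b \<and> (a = b \<or> a = c))" for a b c f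
      using that by (cases "c = dstar b") (auto simp: edge_nested_def edge_bracket_def s)
    have "kron3 a b c = (0::'k)" "kron3 (dstar a) (dstar b) (dstar c) = (0::'k)" "kron3 a b (dstar c) = (0::'k)"
      "kron3 a (dstar b) (dstar c) = (0::'k)" "kron3 (dstar a) b (dstar c) = (0::'k)" "kron3 a (dstar b) c
          = (0::'k)"
      "kron3 (dstar a) b c = (0::'k)" "kron3 (dstar a) (dstar b) c = (0::'k)"
      using 5 dstar_dstar s(1) unfolding kron3_def by metis+
    then show ?thesis unfolding coincidence_form_def 0[OF 5(1)] 0[OF 5(2)] 0[OF 5(3)] by simp
  qed
qed

end

section \<open>Double brackets as functionals on bilinear forms\<close>

text \<open>The assumption \<open>br_rep\<close> makes a value of \<open>br\<close> an actual
  element of \<open>A \<otimes> A\<close> and not just a functional on forms. From it come linearity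
  in the form, the right to compare forms on \<open>A\<close> only, and the interchange of two
  brackets in \<open>br_commute\<close>. The factor 2 in \<open>br_ar\<close> keeps the arrow
  computations free of fractions.\<close>

locale bracket_algebra = arrow_algebra scl tl hd gam os eps e ar
  for scl :: "'k::field_char_0 \<Rightarrow> 'r::ring \<Rightarrow> 'r"
    and tl hd :: "'a darr \<Rightarrow> 'v::finite" and gam :: "'a darr \<Rightarrow> 'k"
    and os :: "'a darr \<Rightarrow> 'a darr \<Rightarrow> 'k" and eps :: "'a darr \<Rightarrow> 'k"
    and e :: "'v \<Rightarrow> 'r" and ar :: "'a darr \<Rightarrow> 'r" +
  fixes iv :: "'a darr \<Rightarrow> 'r" and A :: "'r set"
    and br :: "'r \<Rightarrow> 'r \<Rightarrow> ('r \<Rightarrow> 'r \<Rightarrow> 'k) \<Rightarrow> 'k"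
  assumes A_e: "e s \<in> A" and A_ar: "ar b \<in> A" and A_iv: "iv b \<in> A"
    and A_add: "x \<in> A \<Longrightarrow> y \<in> A \<Longrightarrow> x + y \<in> A"
    and A_mult: "x \<in> A \<Longrightarrow> y \<in> A \<Longrightarrow> x * y \<in> A"
    and A_scl: "x \<in> A \<Longrightarrow> scl k x \<in> A"
    and A_induct: "\<lbrakk>x \<in> A; \<And>s. P (e s); \<And>b. P (ar b); \<And>b. P (iv b);
        \<And>x y. x \<in> A \<Longrightarrow> y \<in> A \<Longrightarrow> P x \<Longrightarrow> P y \<Longrightarrow> P (x + y);
        \<And>x y. x \<in> A \<Longrightarrow> y \<in> A \<Longrightarrow> P x \<Longrightarrow> P y \<Longrightarrow> P (x * y);
        \<And>k x. x \<in> A \<Longrightarrow> P x \<Longrightarrow> P (scl k x)\<rbrakk> \<Longrightarrow> P x"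
    and iv_left: "(scl (gam b) (e (tl b)) + ar b * ar (dstar b)) * iv b = e (tl b)"
    and iv_right: "iv b * (scl (gam b) (e (tl b)) + ar b * ar (dstar b)) = e (tl b)"
    and e_iv: "e (tl b) * iv b = iv b" and iv_e: "iv b * e (tl b) = iv b"
    and br_rep: "\<exists>xs. (\<forall>(k,p,q)\<in>set xs. p \<in> A \<and> q \<in> A) \<and> (\<forall>\<beta>. br x y \<beta> = (\<Sum>(k,p,q)\<leftarrow>xs. k * \<beta> p q))"
    and br_lin2: "bil \<beta> \<Longrightarrow> lin (\<lambda>y. br x y \<beta>)"
    and br_anti: "br x y \<beta> = - br y x (\<lambda>p q. \<beta> q p)"
    and br_leib: "\<lbrakk>bil \<beta>; x \<in> A; y \<in> A; z \<in> A\<rbrakk>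
        \<Longrightarrow> br x (y * z) \<beta> = br x y (\<lambda>p q. \<beta> p (q * z)) + br x z (\<lambda>p q. \<beta> (y * p) q)"
    and br_e: "\<lbrakk>bil \<beta>; x \<in> A\<rbrakk> \<Longrightarrow> br x (e s) \<beta> = 0"
    and br_ar: "bil \<beta> \<Longrightarrow> 2 * br (ar b) (ar c) \<beta> = ord_bracket b c \<beta> + edge_bracket b c \<beta>"
begin

section \<open>Calculus of brackets as functionals\<close>

lemma linI: "(\<And>x y. f (x + y) = f x + f y) \<Longrightarrow> (\<And>c x. f (scl c x) = c * f x) \<Longrightarrow> lin f"
  by (simp add: linear_form_def)

lemma linD: "lin f \<Longrightarrow> f (x + y) = f x + f y" "lin f \<Longrightarrow> f (scl c x) = c * f x"
  by (simp_all add: linear_form_def)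

lemma bilD: assumes "bil \<beta>"
  shows "\<beta> (scl c x) y = c * \<beta> x y" "\<beta> x (scl c y) = c * \<beta> x y"
    "\<beta> (x + x') y = \<beta> x y + \<beta> x' y" "\<beta> x (y + y') = \<beta> x y + \<beta> x y'"
  using assms by (auto simp: bilinear_form_def linear_form_def)

lemma bil_swap: "bil \<beta> \<Longrightarrow> bil (\<lambda>p q. \<beta> q p)" by (simp add: bilinear_form_def)

lemma bil_mult:
  assumes "bil \<beta>"
  shows "bil (\<lambda>p q. \<beta> (x * p) q)" "bil (\<lambda>p q. \<beta> (p * x) q)" "bil (\<lambda>p q. \<beta> p (x * q))" "bil (\<lambda>p q. \<beta> p (q * x))"
  using assms by (auto simp: bilinear_form_def linear_form_def ring_distribs scl_mult_left scl_mult_right)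

lemma tril_mult:
  assumes "tril f"
  shows "tril (\<lambda>p q v. f (x * p) q v)" "tril (\<lambda>p q v. f (p * x) q v)" "tril (\<lambda>p q v. f p (x * q) v)"
    "tril (\<lambda>p q v. f p (q * x) v)" "tril (\<lambda>p q v. f p q (x * v))" "tril (\<lambda>p q v. f p q (v * x))"
  using assms by (auto simp: trilinear_form_def linear_form_def ring_distribs scl_mult_left scl_mult_right)

lemma tril_perm: "tril f \<Longrightarrow> tril (\<lambda>p q v. f v p q)" "tril f \<Longrightarrow> tril (\<lambda>p q v. f q v p)"
  by (auto simp: trilinear_form_def)

lemma tril_bil: "tril f \<Longrightarrow> bil (\<lambda>p q. f p q v)"
  by (auto simp: trilinear_form_def bilinear_form_def)

lemma br_cong: "(\<And>p q. p \<in> A \<Longrightarrow> q \<in> A \<Longrightarrow> \<beta> p q = \<beta>' p q) \<Longrightarrow> br x y \<beta> = br x y \<beta>'"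
proof -
  assume *: "\<And>p q. p \<in> A \<Longrightarrow> q \<in> A \<Longrightarrow> \<beta> p q = \<beta>' p q"
  obtain xs where xs: "\<forall>(k,p,q)\<in>set xs. p \<in> A \<and> q \<in> A" and
    b: "\<And>\<beta>. br x y \<beta> = (\<Sum>(k,p,q)\<leftarrow>xs. k * \<beta> p q)" using br_rep[of x y] by blast
  show ?thesis unfolding b by (rule arg_cong[where f=sum_list], rule map_cong) (use xs * in auto)
qed

lemma br_add: "br x y (\<lambda>p q. \<beta> p q + \<beta>' p q) = br x y \<beta> + br x y \<beta>'"
proof -
  obtain xs where b: "\<And>\<beta>. br x y \<beta> = (\<Sum>(k,p,q)\<leftarrow>xs. k * \<beta> p q)" using br_rep[of x y] by blast
  show ?thesis unfolding b by (simp add: split_def ring_distribs sum_list_addf)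
qed

lemma br_mult: "br x y (\<lambda>p q. k * \<beta> p q) = k * br x y \<beta>"
proof -
  obtain xs where b: "\<And>\<beta>. br x y \<beta> = (\<Sum>(k,p,q)\<leftarrow>xs. k * \<beta> p q)" using br_rep[of x y] by blast
  show ?thesis unfolding b by (simp add: split_def sum_list_const_mult[symmetric] mult.left_commute)
qed

lemma br_zero: "br x y (\<lambda>p q. 0) = 0" using br_mult[of x y 0] by simp
lemma br_commute: "br x y (\<lambda>p q. br x' y' (\<lambda>p' q'. F p q p' q'))
    = br x' y' (\<lambda>p' q'. br x y (\<lambda>p q. F p q p' q'))"
proof -
  obtain xs where b: "\<And>\<beta>. br x y \<beta> = (\<Sum>(k,p,q)\<leftarrow>xs. k * \<beta> p q)" using br_rep[of x y] by blast
  show ?thesis unfolding b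
  proof (induction xs)
    case (Cons z xs)
    then show ?case by (auto simp: br_add br_mult br_zero split: prod.splits)
  qed (simp add: br_zero)
qed

lemma br_lin1: "bil \<beta> \<Longrightarrow> lin (\<lambda>x. br x y \<beta>)"
  unfolding br_anti[of _ y \<beta>] using br_lin2[OF bil_swap[of \<beta>], of y] by (simp add: linear_form_def)

lemma br_leib1:
  assumes "bil \<beta>" "x \<in> A" "y \<in> A" "z \<in> A"
  shows "br (x * y) z \<beta> = br x z (\<lambda>p q. \<beta> (p * y) q) + br y z (\<lambda>p q. \<beta> p (x * q))"
  unfolding br_anti[of "x * y" z] br_anti[of x z] br_anti[of y z]
  using br_leib[OF bil_swap[OF assms(1)] assms(4,2,3)] by simp

lemma br_e1: "\<lbrakk>bil \<beta>; x \<in> A\<rbrakk> \<Longrightarrow> br (e s) x \<beta> = 0"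
  unfolding br_anti[of "e s"] by (simp add: br_e bil_swap)

section \<open>The triple bracket as a derivation\<close>

definition nested_bracket where "nested_bracket a b c g = br b c (\<lambda>u v. br a u (\<lambda>p q. g p q v))"
text \<open>The permutations of the arguments of \<open>f\<close> are the transposes of \<tau> and
  of its square.\<close>

definition triple_bracket where "triple_bracket a b c f = nested_bracket a b c f
    + nested_bracket b c a (\<lambda>p q v. f v p q) + nested_bracket c a b (\<lambda>p q v. f q v p)"

lemma nested_bracket_bil: "tril g \<Longrightarrow> bil (\<lambda>u v. br a u (\<lambda>p q. g p q v))"
proof -
  assume g: "tril g"
  have "lin (\<lambda>v. br a u (\<lambda>p q. g p q v))" for u
    using g by (intro linI) (simp_all add: trilinear_form_def linear_form_def br_add br_mult)
  then show ?thesis using br_lin2[OF tril_bil[OF g]] by (auto simp: bilinear_form_def)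
qed

lemma triple_bracket_cyclic: "triple_bracket a b c f
    = triple_bracket b c a (\<lambda>p q v. f v p q)" by (simp add: triple_bracket_def)

text \<open>In {{b, c d}} the factor \<open>c\<close> stands in front of the first component of {{b,
  d}}, so the outer bracket with \<open>a\<close> differentiates it as well. This produces the last
  term, the defect of the derivation property.\<close>

lemma nested_bracket_leib3:
  assumes g: "tril g" and A: "a \<in> A" "b \<in> A" "c \<in> A" "d \<in> A"
  shows "nested_bracket a b (c * d) g = nested_bracket a b c (\<lambda>p q v. g p q (v * d))
      + nested_bracket a b d (\<lambda>p q v. g (c * p) q v)
     + br b d (\<lambda>u v. br a c (\<lambda>p q. g p (q * u) v))"
proof -
  have "br b d (\<lambda>u v. br a (c * u) (\<lambda>p q. g p q v))
      = br b d (\<lambda>u v. br a c (\<lambda>p q. g p (q * u) v) + br a u (\<lambda>p q. g (c * p) q v))"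
    by (rule br_cong) (simp add: br_leib A tril_bil g)
  then show ?thesis unfolding nested_bracket_def by (simp add: br_leib[OF nested_bracket_bil[OF g] A(2-4)]
      br_add)
qed

lemma nested_bracket_leib2:
  assumes g: "tril g" and A: "a \<in> A" "b \<in> A" "c \<in> A" "d \<in> A"
  shows "nested_bracket b (c * d) a g = nested_bracket b d a (\<lambda>p q v. g p q (c * v))
      + nested_bracket b c a (\<lambda>p q v. g p (q * d) v)
     + br c a (\<lambda>u v. br b d (\<lambda>p q. g (u * p) q v))"
proof -
  have "br c a (\<lambda>u v. br b (u * d) (\<lambda>p q. g p q v))
      = br c a (\<lambda>u v. br b u (\<lambda>p q. g p (q * d) v) + br b d (\<lambda>p q. g (u * p) q v))"
    by (rule br_cong) (simp add: br_leib A tril_bil g)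
  then show ?thesis unfolding nested_bracket_def by (simp add: br_leib1[OF nested_bracket_bil[OF g] A(3,4,1)]
      br_add)
qed

lemma nested_bracket_leib1:
  assumes g: "tril g" and A: "a \<in> A" "b \<in> A" "c \<in> A" "d \<in> A"
  shows "nested_bracket (c * d) a b g = nested_bracket c a b (\<lambda>p q v. g (p * d) q v)
      + nested_bracket d a b (\<lambda>p q v. g p (c * q) v)"
  unfolding nested_bracket_def br_add[symmetric]
  by (rule br_cong) (simp add: br_leib1 A tril_bil g)

text \<open>Two of the three nestings have a defect, in both cases a product of the bracket of
  \<open>a\<close>, \<open>c\<close> with that of \<open>b\<close>, \<open>d\<close>. Antisymmetry
  gives the two defects opposite signs and \<open>br_commute\<close> identifies them.\<close>

lemma triple_bracket_leib:
  assumes f: "tril f" and A: "a \<in> A" "b \<in> A" "c \<in> A" "d \<in> A"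
  shows "triple_bracket a b (c * d) f = triple_bracket a b c (\<lambda>p q v. f p q (v * d))
      + triple_bracket a b d (\<lambda>p q v. f (c * p) q v)"
proof -
  have "br b d (\<lambda>u v. br a c (\<lambda>p q. f p (q * u) v)) + br c a (\<lambda>u v. br b d (\<lambda>p q. f v (u * p) q)) = 0"
    unfolding br_anti[of c a] br_commute[of a c b d] by simp
  then show ?thesis
    unfolding triple_bracket_def by (simp add: nested_bracket_leib3[OF f A] nested_bracket_leib2[OF
        tril_perm(1)[OF f] A] nested_bracket_leib1[OF tril_perm(2)[OF f] A])
qed

lemma triple_bracket_lin: "tril f \<Longrightarrow> lin (\<lambda>c. triple_bracket a b c f)"
proof -
  assume f: "tril f"
  have "lin (\<lambda>c. nested_bracket a b c f)" unfolding nested_bracket_def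
      by (rule br_lin2[OF nested_bracket_bil[OF f]])
  moreover have "lin (\<lambda>c. nested_bracket b c a (\<lambda>p q v. f v p q))" unfolding nested_bracket_def
      by (rule br_lin1[OF nested_bracket_bil[OF tril_perm(1)[OF f]]])
  moreover have "lin (\<lambda>c. nested_bracket c a b (\<lambda>p q v. f q v p))" unfolding nested_bracket_def
    using br_lin1[OF tril_bil[OF tril_perm(2)[OF f]]] by (simp add: linear_form_def br_add br_mult)
  ultimately show ?thesis unfolding triple_bracket_def by (simp add: linear_form_def ring_distribs)
qed

lemma triple_bracket_e:
  assumes f: "tril f" and A: "a \<in> A" "b \<in> A"
  shows "triple_bracket a b (e s) f = 0"
proof -
  have "nested_bracket (e s) a b (\<lambda>p q v. f q v p) = br a b (\<lambda>u v. 0)" unfolding nested_bracket_def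
    by (rule br_cong) (simp add: br_e1 tril_bil[OF tril_perm(2)[OF f]])
  moreover have "nested_bracket a b (e s) f = 0" unfolding nested_bracket_def
      by (rule br_e[OF nested_bracket_bil[OF f] A(2)])
  moreover have "nested_bracket b (e s) a (\<lambda>p q v. f v p q) = 0" unfolding nested_bracket_def
    by (rule br_e1[OF nested_bracket_bil[OF tril_perm(1)[OF f]] A(1)])
  ultimately show ?thesis by (simp add: triple_bracket_def br_zero)
qed

lemma qp_form_cyclic: "qp_form a b c f = qp_form b c a (\<lambda>p q v. f v p q)"
  unfolding qp_form_def by (intro arg_cong[where f="\<lambda>x. 1 / 4 * x"] sum.cong refl) (simp add: algebra_simps)

lemma qp_form_leib:
  "qp_form a b (c * d) f = qp_form a b c (\<lambda>p q v. f p q (v * d)) + qp_form a b d (\<lambda>p q v. f (c * p) q v)"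
  unfolding qp_form_def distrib_left[symmetric] sum.distrib[symmetric]
  by (intro arg_cong[where f="\<lambda>x. 1 / 4 * x"] sum.cong refl) (simp add: algebra_simps)

lemma qp_form_lin: assumes f: "tril f" shows "lin (\<lambda>c. qp_form a b c f)"
proof (rule linI)
  have f': "f (x + x') y z = f x y z + f x' y z" "f x y (z + z') = f x y z + f x y z'" for x x' y z z'
    using f by (auto simp: trilinear_form_def linear_form_def)
  show "qp_form a b (x + y) f = qp_form a b x f + qp_form a b y f" for x y
    unfolding qp_form_def by (simp add: ring_distribs f' sum.distrib sum_subtractf)
  show "qp_form a b (scl k x) f = k * qp_form a b x f" for x k
    unfolding qp_form_def mult.left_commute[of k] sum_distrib_left[of k]
    by (simp add: scl_mult_left scl_mult_right trilD[OF f] algebra_simps)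
qed

lemma qp_form_e: assumes f: "tril f" shows "qp_form a b (e s) f = 0"
  unfolding qp_form_def by (simp add: scl_mult_left scl_mult_right e_e trilD[OF f] sum.distrib sum_subtractf
      sum_kron mult.assoc)

text \<open>Here \<open>la\<close> and \<open>ra\<close> are the transposes of left and right
  multiplication, so \<Delta> is a derivation into a bimodule seen through a space \<open>F\<close>
  of forms. For a local inverse, differentiating \<open>l * iv b = e (tl b)\<close> shows that l
  annihilates the derivative of \<open>iv b\<close> from the left; multiplying by
  \<open>iv b\<close> cancels l. The lemma serves both the quasi-Poisson identity and the moment
  map.\<close>

lemma derivation_eq_0:
  fixes \<Delta> :: "'r \<Rightarrow> 'f \<Rightarrow> 'k"
  assumes cl: "\<And>x f. f \<in> F \<Longrightarrow> la x f \<in> F" "\<And>x f. f \<in> F \<Longrightarrow> ra x f \<in> F"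
    and la: "\<And>x y f. la x (la y f) = la (y * x) f"
    and lin: "\<And>f. f \<in> F \<Longrightarrow> lin (\<lambda>x. \<Delta> x f)"
    and leib: "\<And>x y f. \<lbrakk>x \<in> A; y \<in> A; f \<in> F\<rbrakk> \<Longrightarrow> \<Delta> (x * y) f = \<Delta> x (ra y f) + \<Delta> y (la x f)"
    and e: "\<And>s f. f \<in> F \<Longrightarrow> \<Delta> (e s) f = 0" and ar: "\<And>b f. f \<in> F \<Longrightarrow> \<Delta> (ar b) f = 0"
    and x: "x \<in> A" and f: "f \<in> F"
  shows "\<Delta> x f = 0"
  using x f
proof (induction arbitrary: f rule: A_induct[consumes 1])
  case (3 b)
  define l where "l = scl (gam b) (e (tl b)) + ar b * ar (dstar b)"
  have l: "l \<in> A" by (simp add: l_def A_add A_scl A_e A_mult A_ar)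
  have "\<Delta> l g = 0" if "g \<in> F" for g
    using that by (simp add: l_def linD[OF lin] leib A_ar e ar cl)
  then have *: "\<Delta> (iv b) (la l g) = 0" if "g \<in> F" for g
    using leib[OF l A_iv[of b] that] iv_left[of b] that by (simp add: l_def e cl)
  have "\<Delta> (iv b) f = \<Delta> (e (tl b) * iv b) f" by (simp add: e_iv)
  also have "\<dots> = \<Delta> (iv b) (la (e (tl b)) f)" using 3 by (simp add: leib A_e A_iv e cl)
  also have "\<dots> = \<Delta> (iv b) (la l (la (iv b) f))" using iv_right[of b] by (simp add: la l_def)
  also have "\<dots> = 0" using 3 by (simp add: * cl)
  finally show ?case .
qed (simp_all add: e ar linD[OF lin] leib cl)

section \<open>The quasi-Poisson identity\<close>

lemma ord_nested_add: "ord_nested (\<lambda>a b \<beta>. I a b \<beta> + J a b \<beta>) a b c f = ord_nested I a b c f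
    + ord_nested J a b c f"
  unfolding ord_nested_def by (simp add: algebra_simps)
lemma edge_nested_add: "edge_nested (\<lambda>a b \<beta>. I a b \<beta> + J a b \<beta>) a b c f = edge_nested I a b c f
    + edge_nested J a b c f"
  unfolding edge_nested_def by (simp add: algebra_simps)

lemma nested_bracket_ar: assumes g: "tril g"
  shows "4 * nested_bracket (ar a) (ar b) (ar c) g = ord_nested (\<lambda>a b \<beta>. ord_bracket a b \<beta>
      + edge_bracket a b \<beta>) a b c g + edge_nested (\<lambda>a b \<beta>. ord_bracket a b \<beta> + edge_bracket a b \<beta>) a b c g"
proof -
  have 1: "br (ar a) (e s) (\<lambda>p q. g p q v) = 0" for s v by (rule br_e[OF tril_bil[OF g] A_ar])
  have 2: "br (ar a) (ar x * ar y) (\<lambda>p q. g p q v) = br (ar a) (ar x) (\<lambda>p q. g p (q * ar y) v)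
      + br (ar a) (ar y) (\<lambda>p q. g (ar x * p) q v)" for x y v by (rule br_leib[OF tril_bil[OF g]]) (rule A_ar)+
  have 3: "ord_bracket a x (\<lambda>p q. g p q v) + edge_bracket a x (\<lambda>p q. g p q v)
      = 2 * br (ar a) (ar x) (\<lambda>p q. g p q v)"
     "ord_bracket a x (\<lambda>p q. g p (q * y) v) + edge_bracket a x (\<lambda>p q. g p (q * y) v)
         = 2 * br (ar a) (ar x) (\<lambda>p q. g p (q * y) v)"
     "ord_bracket a x (\<lambda>p q. g (y * p) q v) + edge_bracket a x (\<lambda>p q. g (y * p) q v)
         = 2 * br (ar a) (ar x) (\<lambda>p q. g (y * p) q v)" for x y v
    using br_ar[OF tril_bil[OF g]] br_ar[OF tril_bil[OF tril_mult(4)[OF g]]] br_ar[OF tril_bil[OF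
        tril_mult(1)[OF g]]] by simp_all
  have "4 * nested_bracket (ar a) (ar b) (ar c) g = 2 * (2 * nested_bracket (ar a) (ar b) (ar c) g)" by simp
  also have "\<dots> = ord_nested (\<lambda>a b \<beta>. ord_bracket a b \<beta> + edge_bracket a b \<beta>) a b c g
      + edge_nested (\<lambda>a b \<beta>. ord_bracket a b \<beta> + edge_bracket a b \<beta>) a b c g"
    unfolding nested_bracket_def br_ar[OF nested_bracket_bil[OF g]]
        by (simp add: ord_nested_def edge_nested_def 3 ord_bracket_def[of b c] edge_bracket_def[of b c] 1 2
        algebra_simps)
  finally show ?thesis .
qed

lemma triple_bracket_ar: assumes f: "tril f"
  shows "triple_bracket (ar a) (ar b) (ar c) f = qp_form (ar a) (ar b) (ar c) f"
proof -
  note f1 = tril_perm(1)[OF f] and f2 = tril_perm(2)[OF f]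
  have *: "(ord_nested ord_bracket a b c f + ord_nested ord_bracket b c a (\<lambda>p q v. f v p q)
      + ord_nested ord_bracket c a b (\<lambda>p q v. f q v p))
      + (edge_nested edge_bracket a b c f + edge_nested edge_bracket b c a (\<lambda>p q v. f v p q)
          + edge_nested edge_bracket c a b (\<lambda>p q v. f q v p)) = 4 * qp_form (ar a) (ar b) (ar c) f"
    unfolding ord_ord_jacobi[OF f] edge_edge_jacobi[OF f] by simp
  have "4 * triple_bracket (ar a) (ar b) (ar c) f = 4 * qp_form (ar a) (ar b) (ar c) f
     + (edge_nested ord_bracket a b c f + ord_nested edge_bracket a b c f
         + edge_nested ord_bracket b c a (\<lambda>p q v. f v p q) + ord_nested edge_bracket b c a (\<lambda>p q v. f v p q)
        + edge_nested ord_bracket c a b (\<lambda>p q v. f q v p) + ord_nested edge_bracket c a b (\<lambda>p q v. f q v p))"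
    unfolding triple_bracket_def ring_distribs nested_bracket_ar[OF f] nested_bracket_ar[OF f1]
        nested_bracket_ar[OF f2] ord_nested_add edge_nested_add using * by (simp add: algebra_simps)
  \<comment> \<open>The six mixed sums, regrouped by the pair that the edge bracket contracts, are
    the three cyclic instances of \<open>edge_ord_jacobi\<close>.\<close>
  also have "edge_nested ord_bracket a b c f + ord_nested edge_bracket a b c f
      + edge_nested ord_bracket b c a (\<lambda>p q v. f v p q) + ord_nested edge_bracket b c a (\<lambda>p q v. f v p q)
        + edge_nested ord_bracket c a b (\<lambda>p q v. f q v p) + ord_nested edge_bracket c a b (\<lambda>p q v. f q v p) = 0"
    unfolding ord_nested_def
    using arg_cong2[where f="(+)", OF arg_cong2[where f="(+)", OF edge_ord_jacobi[OF f, of a b c]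
        edge_ord_jacobi[OF f1, of b c a]] edge_ord_jacobi[OF f2, of c a b]]
    by (simp add: algebra_simps)
  finally show ?thesis by simp
qed

text \<open>Both sides are cyclically invariant, so the derivation property in the last argument is
  enough: each argument is rotated into the last place, where an arrow is replaced by an arbitrary
  element.\<close>

theorem triple_bracket_eq_qp_form:
  assumes f: "tril f" and A: "a \<in> A" "b \<in> A" "c \<in> A"
  shows "triple_bracket a b c f = qp_form a b c f"
proof -
  have step: "triple_bracket a b c f = qp_form a b c f"
    if *: "\<And>b' f. tril f \<Longrightarrow> triple_bracket a b (ar b') f = qp_form a b (ar b') f" and A: "a \<in> A" "b \<in> A" "c
        \<in> A" and f: "tril f" for a b c f
  proof -
    have "triple_bracket a b c f - qp_form a b c f = 0"
    proof (rule derivation_eq_0[where F="Collect tril" and la="\<lambda>x f p q v. f (x * p) q v"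
          and ra="\<lambda>x f p q v. f p q (v * x)" and \<Delta>="\<lambda>c f. triple_bracket a b c f - qp_form a b c f"])
      show "lin (\<lambda>x. triple_bracket a b x f - qp_form a b x f)" if "f \<in> Collect tril" for f
        using triple_bracket_lin[of f a b] qp_form_lin[of f a b] that
            by (simp add: linear_form_def ring_distribs)
      show "triple_bracket a b (x * y) f - qp_form a b (x * y) f = triple_bracket a b x (\<lambda>p q v. f p q (v * y))
          - qp_form a b x (\<lambda>p q v. f p q (v * y))
          + (triple_bracket a b y (\<lambda>p q v. f (x * p) q v) - qp_form a b y (\<lambda>p q v. f (x * p) q v))"
        if "x \<in> A" "y \<in> A" "f \<in> Collect tril" for x y f
        using that A by (simp add: triple_bracket_leib qp_form_leib)
    qed (use A f * in \<open>simp_all add: tril_mult mult.assoc triple_bracket_e qp_form_e\<close>)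
    then show ?thesis by simp
  qed
  have 1: "triple_bracket (ar a) (ar b) c f = qp_form (ar a) (ar b) c f" if "c \<in> A" "tril f" for a b c f
    by (rule step) (use that in \<open>simp_all add: triple_bracket_ar A_ar\<close>)
  have 2: "triple_bracket (ar a) b c f = qp_form (ar a) b c f" if "b \<in> A" "c \<in> A" "tril f" for a b c f
  proof -
    have "triple_bracket c (ar a) b (\<lambda>p q v. f q v p) = qp_form c (ar a) b (\<lambda>p q v. f q v p)"
    proof (rule step)
      show "triple_bracket c (ar a) (ar b') g = qp_form c (ar a) (ar b') g" if "tril g" for b' g
        unfolding triple_bracket_cyclic[of c "ar a" "ar b'" g] qp_form_cyclic[of c "ar a" "ar b'" g]
        by (rule 1[OF \<open>c \<in> A\<close> tril_perm(1)[OF that]])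
    qed (rule that A_ar tril_perm(2)[OF that(3)])+
    then show ?thesis unfolding triple_bracket_cyclic[of c "ar a" b] qp_form_cyclic[of c "ar a" b] .
  qed
  have "triple_bracket b c a (\<lambda>p q v. f v p q) = qp_form b c a (\<lambda>p q v. f v p q)"
  proof (rule step)
    show "triple_bracket b c (ar x) g = qp_form b c (ar x) g" if "tril g" for x g
      unfolding triple_bracket_cyclic[of "ar x" b c "\<lambda>p q v. g q v p", symmetric] qp_form_cyclic[of "ar x" b c
          "\<lambda>p q v. g q v p", symmetric]
      by (rule 2[OF A(2,3) tril_perm(2)[OF that]])
  qed (rule A tril_perm(1)[OF f])+
  then show ?thesis unfolding triple_bracket_cyclic[of a b c f] qp_form_cyclic[of a b c f] .
qed

section \<open>Brackets with ordered products of factors\<close>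

definition loc_factor where "loc_factor b = scl (gam b) (e (tl b)) + ar b * ar (dstar b)"
definition mom_factor where "mom_factor b = (if eps b = 1 then loc_factor b else iv b)"

lemma A_loc_factor: "loc_factor b \<in> A" by (simp add: loc_factor_def A_add A_scl A_e A_mult A_ar)
lemma A_mom_factor: "mom_factor b \<in> A" by (simp add: mom_factor_def A_loc_factor A_iv)

lemma e_loc_factor: "e (tl b) * loc_factor b = loc_factor b" and loc_factor_e: "loc_factor b * e (tl b)
    = loc_factor b"
  by (simp_all add: loc_factor_def ring_distribs scl_mult_left scl_mult_right mult.assoc e_e e_ar ar_e tl_dstar
      hd_dstar kron_def scl_1
      mult.assoc[of "e s" "ar c" for s c, symmetric])

lemma e_mom_factor: "e (tl b) * mom_factor b = mom_factor b" and mom_factor_e: "mom_factor b * e (tl b)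
    = mom_factor b"
  by (simp_all add: mom_factor_def e_loc_factor loc_factor_e e_iv iv_e)

text \<open>At each end of \<open>x\<close> the ordering part contributes a difference of two terms
  and the edge part their sum; \<open>gam b\<close> enters only through \<open>loc_factor b\<close>.
  This shape survives inversion of the factor.\<close>

lemma br_loc_factor:
  assumes "bil \<beta>"
  shows "2 * br (loc_factor b) (ar x) \<beta> =
     - (eps b * kron b x - os b x) * \<beta> (e (tl b)) (loc_factor b * ar x) - (eps b * kron b x
         + os b x) * \<beta> (loc_factor b) (e (tl b) * ar x)
     + (eps b * kron b (dstar x) - os b (dstar x)) * \<beta> (ar x * e (tl b)) (loc_factor b)
         + (eps b * kron b (dstar x) + os b (dstar x)) * \<beta> (ar x * loc_factor b) (e (tl b))"
proof -
  have s: "dstar x \<noteq> x" "x \<noteq> dstar x" for x :: "'a darr" by (cases x; simp)+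
  note simps = s ring_distribs scl_mult_left scl_mult_right e_e e_ar ar_e bilD[OF assms] mult.assoc hd_dstar
      tl_dstar eps_dstar gam_dstar kron_def scl_1
  have "2 * br (loc_factor b) (ar x) \<beta> = (ord_bracket (dstar b) x (\<lambda>p q. \<beta> p (ar b * q))
      + edge_bracket (dstar b) x (\<lambda>p q. \<beta> p (ar b * q)))
     + (ord_bracket b x (\<lambda>p q. \<beta> (p * ar (dstar b)) q) + edge_bracket b x (\<lambda>p q. \<beta> (p * ar (dstar b)) q))"
    unfolding br_ar[OF bil_mult(3)[OF assms], symmetric] br_ar[OF bil_mult(2)[OF assms], symmetric]
    by (simp add: loc_factor_def linD[OF br_lin1[OF assms]] br_leib1[OF assms] A_ar br_e1[OF assms])
  also have "\<dots> = (ord_bracket (dstar b) x (\<lambda>p q. \<beta> p (ar b * q))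
      + ord_bracket b x (\<lambda>p q. \<beta> (p * ar (dstar b)) q))
     + (edge_bracket (dstar b) x (\<lambda>p q. \<beta> p (ar b * q))
         + edge_bracket b x (\<lambda>p q. \<beta> (p * ar (dstar b)) q))" by simp
  also have "ord_bracket (dstar b) x (\<lambda>p q. \<beta> p (ar b * q)) + ord_bracket b x (\<lambda>p q. \<beta> (p * ar (dstar b)) q) =
    os b x * (\<beta> (e (tl b)) (loc_factor b * ar x) - \<beta> (loc_factor b) (e (tl b) * ar x))
    + os b (dstar x) * (\<beta> (ar x * loc_factor b) (e (tl b)) - \<beta> (ar x * e (tl b)) (loc_factor b))"
    using os_eq_0_or[of b x] os_eq_0_or[of b "dstar x"] unfolding ord_bracket_def loc_factor_def
    by (elim disjE) (simp_all add: simps algebra_simps)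
  also have "edge_bracket (dstar b) x (\<lambda>p q. \<beta> p (ar b * q)) + edge_bracket b x (\<lambda>p q. \<beta> (p * ar (dstar b)) q) =
    eps b * kron b (dstar x) * (\<beta> (ar x * loc_factor b) (e (tl b)) + \<beta> (ar x * e (tl b)) (loc_factor b))
    - eps b * kron b x * (\<beta> (e (tl b)) (loc_factor b * ar x) + \<beta> (loc_factor b) (e (tl b) * ar x))"
  proof -
    consider "x = b" | "x = dstar b" | "x \<noteq> b" "x \<noteq> dstar b" by blast
    then show ?thesis
    proof cases
      case 1 show ?thesis unfolding 1 edge_bracket_def loc_factor_def kron_def by (simp add: simps)
    next
      case 2 show ?thesis unfolding 2 edge_bracket_def loc_factor_def kron_def by (simp add: simps)
    next
      case 3 then show ?thesis by (auto simp: edge_bracket_def kron_def)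
    qed
  qed
  finally show ?thesis by (simp add: algebra_simps)
qed

text \<open>Inverting a factor changes the sign and exchanges the two terms at each end. This
  preserves the coefficients of \<open>os\<close> and reverses those of \<open>eps\<close>, so
  factors and inverse factors obey one formula without \<open>eps\<close>. That is the reason for
  the exponent \<epsilon>(b) in the moment map.\<close>

lemma br_mom_factor:
  assumes "bil \<beta>"
  shows "2 * br (mom_factor b) (ar x) \<beta> =
     - (kron b x - os b x) * \<beta> (e (tl b)) (mom_factor b * ar x) - (kron b x
         + os b x) * \<beta> (mom_factor b) (e (tl b) * ar x)
     + (kron b (dstar x) - os b (dstar x)) * \<beta> (ar x * e (tl b)) (mom_factor b) + (kron b (dstar x)
         + os b (dstar x)) * \<beta> (ar x * mom_factor b) (e (tl b))"
proof (cases "eps b = 1")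
  case True
  then show ?thesis using br_loc_factor[OF assms, of b x] by (simp add: mom_factor_def)
next
  case False
  then have eps: "eps b = -1" using eps_sq[of b] by (simp add: square_eq_1_iff)
  have li: "loc_factor b * iv b = e (tl b)" and il: "iv b * loc_factor b = e (tl b)"
    using iv_left iv_right by (simp_all add: loc_factor_def)
  have li': "loc_factor b * (iv b * y) = e (tl b) * y" and il': "iv b * (loc_factor b * y) = e (tl b) * y"
    and ei: "e (tl b) * (iv b * y) = iv b * y" and ie: "iv b * (e (tl b) * y) = iv b * y" for y
    by (simp_all add: mult.assoc[symmetric] li il e_iv iv_e)
  let ?\<beta> = "\<lambda>p q. \<beta> (p * iv b) q"
  have \<beta>: "bil ?\<beta>" by (rule bil_mult(2)[OF assms])
  \<comment> \<open>The derivation rule for an inverse: \<open>e (tl b)\<close> is replaced by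
    \<open>loc_factor b * iv b\<close>, and the Leibniz rule for \<open>iv b * loc_factor b\<close>
    moves the bracket onto \<open>loc_factor b\<close>, because brackets with idempotents
    vanish.\<close>
  have "br (iv b) (ar x) \<beta> = br (iv b * e (tl b)) (ar x) \<beta>" by (simp add: iv_e)
  also have "\<dots> = br (iv b) (ar x) (\<lambda>p q. ?\<beta> (p * loc_factor b) q)"
    using br_leib1[OF assms A_iv A_e A_ar] br_e1[OF bil_mult(3)[OF assms] A_ar] by (simp add: mult.assoc li)
  also have "\<dots> = - br (loc_factor b) (ar x) (\<lambda>p q. ?\<beta> p (iv b * q))"
    using br_leib1[OF \<beta> A_iv A_loc_factor A_ar, of b b x] br_e1[OF \<beta> A_ar] by (simp add: il eq_neg_iff_add_eq_0)
  finally have "2 * br (iv b) (ar x) \<beta> = - (2 * br (loc_factor b) (ar x) (\<lambda>p q. ?\<beta> p (iv b * q)))" by simp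
  then show ?thesis
    unfolding br_loc_factor[OF bil_mult(3)[OF \<beta>]]
    by (simp add: mom_factor_def eps mult.assoc li' il' li il ei ie e_iv iv_e) (simp add: algebra_simps)
qed

definition mom_prod where "mom_prod s bs = foldr (\<lambda>b acc. mom_factor b * acc) bs (e s)"

lemma A_mom_prod: "mom_prod s bs \<in> A"
  by (induction bs) (simp_all add: mom_prod_def A_e A_mult A_mom_factor)

lemma mom_prod_e: "set bs \<subseteq> {b. tl b = s} \<Longrightarrow> mom_prod s bs * e s = mom_prod s bs"
  by (induction bs) (auto simp: mom_prod_def e_e kron_def scl_1 mult.assoc)

lemma e_mom_prod: "set bs \<subseteq> {b. tl b = s} \<Longrightarrow> e s * mom_prod s bs = mom_prod s bs"
  using e_mom_factor by (cases bs) (auto simp: mom_prod_def e_e kron_def scl_1 mult.assoc[symmetric])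

text \<open>The part of twice the bracket of \<open>mom_prod s bs\<close> with an arrow that comes from the end \<open>c\<close> of that arrow.\<close>

fun telescope :: "'v \<Rightarrow> 'a darr \<Rightarrow> ('r \<Rightarrow> 'r \<Rightarrow> 'k) \<Rightarrow> 'a darr list \<Rightarrow> 'k" where
  "telescope s c H [] = 0"
| "telescope s c H (b # bs) = (kron b c - os b c) * H (mom_prod s bs) (mom_factor b) + (kron b c
    + os b c) * H (mom_factor b * mom_prod s bs) (e s)
     + telescope s c (\<lambda>p q. H p (mom_factor b * q)) bs"

lemma telescope_outside: "set bs \<subseteq> {b. tl b = s} \<Longrightarrow> tl c \<noteq> s \<Longrightarrow> telescope s c H bs = 0"
  by (induction bs arbitrary: H) (auto simp: os_tl kron_def)

text \<open>With \<open>os b c = -1\<close> throughout, each factor contributes the difference of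
  the values of \<open>H\<close> at two consecutive cuts of the product. The inner cuts
  cancel.\<close>

lemma telescope_below: "set bs \<subseteq> {b. tl b = s} \<Longrightarrow> \<forall>b\<in>set bs. os c b = 1 \<Longrightarrow> c \<notin> set bs
   \<Longrightarrow> telescope s c H bs = H (e s) (mom_prod s bs) - H (mom_prod s bs) (e s)"
proof (induction bs arbitrary: H)
  case (Cons b bs)
  then show ?case using os_anti[of b c] mom_factor_e[of b] by (auto simp: kron_def mom_prod_def)
qed (simp add: mom_prod_def)

text \<open>Before \<open>c\<close> the differences have the opposite sign from those after
  \<open>c\<close>. At \<open>c\<close> itself both coefficients are 1, which joins the two
  telescoping sums into the sum of the two outer cuts.\<close>

lemma telescope_inside: "set bs \<subseteq> {b. tl b = s} \<Longrightarrow> sorted_wrt (\<lambda>b c. os b c = 1) bs \<Longrightarrow> distinct bs \<Longrightarrow> c \<in> set bs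
   \<Longrightarrow> telescope s c H bs = H (e s) (mom_prod s bs) + H (mom_prod s bs) (e s)"
proof (induction bs arbitrary: H)
  case (Cons b bs)
  have os: "os b b = 0" using os_anti[of b b] by simp
  show ?case
  proof (cases "b = c")
    case True
    then have "telescope s c (\<lambda>p q. H p (mom_factor b * q)) bs = H (e s) (mom_factor b * mom_prod s bs)
        - H (mom_prod s bs) (mom_factor b * e s)"
      using Cons.prems by (intro telescope_below) auto
    then show ?thesis using True mom_factor_e[of b] Cons.prems os by (auto simp: kron_def mom_prod_def)
  next
    case False
    then show ?thesis using Cons mom_factor_e[of b] by (auto simp: kron_def mom_prod_def)
  qed
qed simp

lemma br_mom_prod:
  assumes "bil \<beta>" "set bs \<subseteq> {b. tl b = s}"
  shows "2 * br (mom_prod s bs) (ar x) \<beta> = - telescope s x (\<lambda>p q. \<beta> p (q * ar x)) bs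
      + telescope s (dstar x) (\<lambda>p q. \<beta> (ar x * p) q) bs"
  using assms
proof (induction bs arbitrary: \<beta>)
  case Nil
  then show ?case by (simp add: mom_prod_def br_e1 A_ar)
next
  case (Cons b bs)
  have "2 * br (mom_prod s (b # bs)) (ar x) \<beta> = 2 * br (mom_factor b) (ar x) (\<lambda>p q. \<beta> (p * mom_prod s bs) q)
      + 2 * br (mom_prod s bs) (ar x) (\<lambda>p q. \<beta> p (mom_factor b * q))"
    using br_leib1[OF Cons.prems(1) A_mom_factor[of b] A_mom_prod[of s bs] A_ar[of x]]
        by (simp add: mom_prod_def)
  then show ?case unfolding br_mom_factor[OF bil_mult(2)[OF Cons.prems(1)]]
      using Cons.IH[OF bil_mult(3)[OF Cons.prems(1)], of "mom_factor b"] Cons.prems(2)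
    e_mom_prod[of bs s] mom_prod_e[of bs s]
    by (simp add: mult.assoc) (simp add: left_diff_distrib)
qed

text \<open>Both sides are derivations in \<open>y\<close>, which reduces the claim to arrows. There
  \<open>telescope_inside\<close> evaluates each end attached to \<open>s\<close>, and an end
  attached elsewhere contributes nothing.\<close>

theorem moment_map:
  assumes bs: "set bs = {b. tl b = s}" "sorted_wrt (\<lambda>b c. os b c = 1) bs" "distinct bs"
    and \<beta>: "bil \<beta>" and y: "y \<in> A"
  shows "2 * br (mom_prod s bs) y \<beta> = \<beta> (y * e s) (mom_prod s bs) - \<beta> (e s) (mom_prod s bs * y)
    + (\<beta> (y * mom_prod s bs) (e s) - \<beta> (mom_prod s bs) (e s * y))" (is "_ = ?r y \<beta>")
proof -
  let ?P = "mom_prod s bs"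
  have sub: "set bs \<subseteq> {b. tl b = s}" using bs by simp
  note P = mom_prod_e[OF sub] e_mom_prod[OF sub]
  have telescope: "telescope s c H bs = (if tl c = s then H (e s) ?P + H ?P (e s) else 0)" for c H
    using telescope_inside[OF sub bs(2,3)] telescope_outside[OF sub] bs(1) by auto
  have Pe: "?P * e s' = scl (kron s s') ?P" and eP: "e s' * ?P = scl (kron s' s) ?P" for s'
    using arg_cong[OF e_e[of s s'], of "\<lambda>x. ?P * x"] arg_cong[OF e_e[of s' s], of "\<lambda>x. x * ?P"]
    by (simp_all add: mult.assoc[symmetric] scl_mult_right P)
        (simp_all add: mult.assoc scl_mult_left P kron_def scl_0 scl_1 split: if_splits)
  have "2 * br ?P y \<beta> - ?r y \<beta> = 0"
  proof (rule derivation_eq_0[where F="Collect bil" and la="\<lambda>x f p q. f (x * p) q"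
        and ra="\<lambda>x f p q. f p (q * x)" and \<Delta>="\<lambda>y \<beta>. 2 * br ?P y \<beta> - ?r y \<beta>"])
    show "lin (\<lambda>x. 2 * br ?P x f - ?r x f)" if "f \<in> Collect bil" for f
      using that br_lin2[of f ?P] by (simp add: linear_form_def bilD ring_distribs scl_mult_left scl_mult_right)
    show "2 * br ?P (x * y) f - ?r (x * y) f =
        (2 * br ?P x (\<lambda>p q. f p (q * y)) - ?r x (\<lambda>p q. f p (q * y))) + (2 * br ?P y (\<lambda>p q. f (x * p) q)
            - ?r y (\<lambda>p q. f (x * p) q))"
      if "x \<in> A" "y \<in> A" "f \<in> Collect bil" for x y f
      using that by (simp add: br_leib[OF _ A_mom_prod] mult.assoc)
    show "2 * br ?P (e s') f - ?r (e s') f = 0" if "f \<in> Collect bil" for s' f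
      using that by (simp add: br_e A_mom_prod e_e bilD Pe eP) (simp add: kron_def algebra_simps)
    show "2 * br ?P (ar x) f - ?r (ar x) f = 0" if f: "f \<in> Collect bil" for x f
    proof -
      have f': "bil f" using f by simp
      have "?P * (e s * ar x) = scl (kron s (tl x)) (?P * ar x)" "ar x * e s * ?P
          = scl (kron (hd x) s) (ar x * ?P)"
        by (simp_all add: e_ar ar_e scl_mult_left scl_mult_right)
      then have "?P * ar x = scl (kron s (tl x)) (?P * ar x)" "ar x * ?P = scl (kron (hd x) s) (ar x * ?P)"
        using P by (simp_all add: mult.assoc[symmetric]) (simp_all add: mult.assoc P)
      then have "f p (?P * ar x) = kron s (tl x) * f p (?P * ar x)" "f (ar x * ?P) p
          = kron (hd x) s * f (ar x * ?P) p" for p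
        by (metis bilD[OF f'])+
      then show ?thesis using br_mom_prod[OF f' sub, of x]
        by (auto simp: telescope tl_dstar e_ar ar_e bilD[OF f'] kron_def)
    qed
  qed (use y \<beta> in \<open>simp_all add: bil_mult mult.assoc\<close>)
  then show ?thesis by simp
qed

end

section \<open>Finitely supported functions on words\<close>

definition ev :: "('x \<Rightarrow> 'k::field) \<Rightarrow> ('x \<Rightarrow> 'k) \<Rightarrow> 'k" where
  "ev f \<phi> = (\<Sum>w\<in>{w. f w \<noteq> 0}. f w * \<phi> w)"

abbreviation fin_supp :: "('x \<Rightarrow> 'k::zero) \<Rightarrow> bool" where "fin_supp f \<equiv> finite {w. f w \<noteq> 0}"

lemma ev_superset: "finite S \<Longrightarrow> {w. f w \<noteq> 0} \<subseteq> S \<Longrightarrow> ev f \<phi> = (\<Sum>w\<in>S. f w * \<phi> w)"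
  unfolding ev_def by (rule sum.mono_neutral_left) auto

lemma fin_supp_vadd: "fin_supp f \<Longrightarrow> fin_supp g \<Longrightarrow> fin_supp (vadd f (g :: 'x \<Rightarrow> 'k::field))"
  by (rule finite_subset[of _ "{w. f w \<noteq> 0} \<union> {w. g w \<noteq> 0}"]) (auto simp: vadd_def)
lemma fin_supp_vsub: "fin_supp f \<Longrightarrow> fin_supp g \<Longrightarrow> fin_supp (vsub f (g :: 'x \<Rightarrow> 'k::field))"
  by (rule finite_subset[of _ "{w. f w \<noteq> 0} \<union> {w. g w \<noteq> 0}"]) (auto simp: vsub_def)
lemma fin_supp_vneg: "fin_supp f \<Longrightarrow> fin_supp (vneg (f :: 'x \<Rightarrow> 'k::field))" by (simp add: vneg_def)
lemma fin_supp_vscal: "fin_supp f \<Longrightarrow> fin_supp (vscal c (f :: 'x \<Rightarrow> 'k::field))"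
  by (rule finite_subset[of _ "{w. f w \<noteq> 0}"]) (auto simp: vscal_def)
lemma fin_supp_vzero: "fin_supp (vzero :: 'x \<Rightarrow> 'k::field)" by (simp add: vzero_def)
lemma fin_supp_monom: "fin_supp (monom w :: 'g list \<Rightarrow> 'k::field)" by (simp add: monom_def)
lemma fin_supp_sum: "finite I \<Longrightarrow> (\<And>i. i \<in> I \<Longrightarrow> fin_supp (g i)) \<Longrightarrow> fin_supp (\<lambda>w. \<Sum>i\<in>I. (g i w :: 'k::field))"
  by (rule finite_subset[of _ "\<Union>i\<in>I. {w. g i w \<noteq> 0}"]) (auto intro: ccontr sum.neutral)
lemma fin_supp_tens: "fin_supp f \<Longrightarrow> fin_supp g \<Longrightarrow> fin_supp (tens f (g :: 'g list \<Rightarrow> 'k::field))"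
  by (rule finite_subset[of _ "{w. f w \<noteq> 0} \<times> {w. g w \<noteq> 0}"]) (auto simp: tens_def)
lemma fin_supp_tens3: "fin_supp f \<Longrightarrow> fin_supp g \<Longrightarrow> fin_supp h \<Longrightarrow> fin_supp (tens3 f g (h :: 'g list \<Rightarrow> 'k::field))"
  by (rule finite_subset[of _ "{w. f w \<noteq> 0} \<times> {w. g w \<noteq> 0} \<times> {w. h w \<noteq> 0}"]) (auto simp: tens3_def)

lemma ev_vadd: assumes "fin_supp f" "fin_supp g" shows "ev (vadd f g) \<phi> = ev f \<phi> + ev g \<phi>"
proof -
  let ?S = "{w. f w \<noteq> 0} \<union> {w. g w \<noteq> 0}"
  have "finite ?S" using assms by simp
  then show ?thesis
    by (subst (1 2 3) ev_superset[of ?S]) (auto simp: vadd_def sum.distrib ring_distribs)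
qed
lemma ev_vscal: assumes "fin_supp f" shows "ev (vscal c f) \<phi> = c * ev f \<phi>"
  using assms by (subst (1 2) ev_superset[of "{w. f w \<noteq> 0}"]) (auto simp: vscal_def sum_distrib_left mult.assoc)
lemma vneg_vscal: "vneg f = vscal (-1) (f :: 'x \<Rightarrow> 'k::field)" by (auto simp: vneg_def vscal_def)
lemma vsub_vadd: "vsub f g = vadd f (vneg (g :: 'x \<Rightarrow> 'k::field))" by (auto simp: vneg_def vsub_def vadd_def)
lemma ev_vneg: "fin_supp f \<Longrightarrow> ev (vneg f) \<phi> = - ev f \<phi>" by (simp add: vneg_vscal ev_vscal)
lemma ev_vsub: "fin_supp f \<Longrightarrow> fin_supp g \<Longrightarrow> ev (vsub f g) \<phi> = ev f \<phi> - ev g \<phi>"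
  by (simp add: vsub_vadd ev_vadd ev_vneg fin_supp_vneg)
lemma ev_vzero: "ev vzero \<phi> = 0" by (simp add: ev_def vzero_def)
lemma ev_monom: "ev (monom w) \<phi> = (\<phi> w :: 'k::field)" by (simp add: ev_def monom_def)
lemma ev_add: "ev f (\<lambda>w. \<phi> w + \<psi> w) = ev f \<phi> + ev f \<psi>" by (simp add: ev_def ring_distribs sum.distrib)
lemma ev_mult: "ev f (\<lambda>w. c * \<phi> w) = c * ev f \<phi>" by (simp add: ev_def sum_distrib_left mult.left_commute)
lemma ev_zero: "ev f (\<lambda>w. 0) = 0" by (simp add: ev_def)
lemma ev_sum: assumes "finite I" "\<And>i. i \<in> I \<Longrightarrow> fin_supp (g i)"
  shows "ev (\<lambda>w. \<Sum>i\<in>I. g i w) \<phi> = (\<Sum>i\<in>I. ev (g i) \<phi>)"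
proof -
  have "finite (\<Union>i\<in>I. {w. g i w \<noteq> 0})" (is "finite ?S") using assms by simp
  then have "ev (\<lambda>w. \<Sum>i\<in>I. g i w) \<phi> = (\<Sum>w\<in>?S. (\<Sum>i\<in>I. g i w) * \<phi> w)"
    by (rule ev_superset) (auto intro: ccontr sum.neutral)
  also have "\<dots> = (\<Sum>i\<in>I. \<Sum>w\<in>?S. g i w * \<phi> w)"
    by (simp add: sum_distrib_right sum.swap[of _ I])
  also have "\<dots> = (\<Sum>i\<in>I. ev (g i) \<phi>)"
    using \<open>finite ?S\<close> by (intro sum.cong refl ev_superset[symmetric]) auto
  finally show ?thesis .
qed
lemma ev_commute: "ev f (\<lambda>u. ev g (\<lambda>v. F u v)) = ev g (\<lambda>v. ev f (\<lambda>u. F u v))"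
  unfolding ev_def by (simp add: sum_distrib_left sum.swap[of _ "{w. g w \<noteq> 0}"] mult.left_commute)
lemma ev_sum_list: "ev f (\<lambda>w. \<Sum>x\<leftarrow>xs. F x w) = (\<Sum>x\<leftarrow>xs. ev f (F x))"
  by (induction xs) (simp_all add: ev_zero ev_add)

lemma ev_tens: "fin_supp f \<Longrightarrow> fin_supp g \<Longrightarrow> ev (tens f g) \<phi> = ev f (\<lambda>u. ev g (\<lambda>v. \<phi> (u, v)))"
  by (subst ev_superset[of "{w. f w \<noteq> 0} \<times> {w. g w \<noteq> 0}"])
    (auto simp: tens_def ev_def sum_distrib_left sum.cartesian_product mult.assoc intro!: sum.cong)
lemma ev_tens3: "fin_supp f \<Longrightarrow> fin_supp g \<Longrightarrow> fin_supp h \<Longrightarrow> ev (tens3 f g h) \<phi>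
    = ev f (\<lambda>u. ev g (\<lambda>v. ev h (\<lambda>w. \<phi> (u, v, w))))"
  by (subst ev_superset[of "{w. f w \<noteq> 0} \<times> {w. g w \<noteq> 0} \<times> {w. h w \<noteq> 0}"])
    (auto simp: tens3_def ev_def sum_distrib_left sum.cartesian_product mult.assoc intro!: sum.cong)

section \<open>The concatenation product\<close>

definition splits :: "'g list \<Rightarrow> ('g list \<times> 'g list) set" where "splits w = {(u, v). u @ v = w}"

lemma splits_eq: "splits w = (\<lambda>i. (take i w, drop i w)) ` {..length w}"
proof (intro set_eqI iffI)
  fix p assume "p \<in> splits w"
  then show "p \<in> (\<lambda>i. (take i w, drop i w)) ` {..length w}"
    by (intro image_eqI[of _ _ "length (fst p)"]) (auto simp: splits_def)
qed (auto simp: splits_def)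
lemma in_splits: "(u, v) \<in> splits w \<longleftrightarrow> u @ v = w" by (simp add: splits_def)
lemma finite_splits: "finite (splits w)" by (simp add: splits_eq)

lemma sum_splits: "(\<Sum>i\<le>length w. F (take i w) (drop i w)) = (\<Sum>(u,v)\<in>splits w. F u v)"
  unfolding splits_eq
  by (subst sum.reindex) (auto simp: inj_on_def, metis length_take min.absorb2)

lemma fmul_splits: "fmul f g w = (\<Sum>(u,v)\<in>splits w. f u * g v)"
  unfolding fmul_def by (rule sum_splits)

lemma fmul_assoc: "fmul (fmul f g) h = fmul f (fmul g (h :: 'g list \<Rightarrow> 'k::field))"
proof
  fix w
  have "fmul (fmul f g) h w = (\<Sum>(p,q)\<in>Sigma (splits w) (\<lambda>p. splits (fst p)). f (fst q) * g (snd q) * h (snd p))"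
    unfolding fmul_splits split_def sum_distrib_right by (subst sum.Sigma) (auto simp: finite_splits split_def)
  also have "\<dots> = (\<Sum>(p,q)\<in>Sigma (splits w) (\<lambda>p. splits (snd p)). f (fst p) * (g (fst q) * h (snd q)))"
    \<comment> \<open>Both sums run over the cuts of \<open>w\<close> into three pieces; the witness
      regroups the two cuts.\<close>
    by (rule sum.reindex_bij_witness[of _ "\<lambda>(p,q). ((fst p @ fst q, snd q), (fst p, fst q))"
          "\<lambda>(p,q). ((fst q, snd q @ snd p), (snd q, snd p))"])
      (auto simp: splits_def mult.assoc)
  also have "\<dots> = fmul f (fmul g h) w"
    unfolding fmul_splits split_def sum_distrib_left by (subst sum.Sigma) (auto simp: finite_splits split_def)
  finally show "fmul (fmul f g) h w = fmul f (fmul g h) w" .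
qed

lemma fmul_vadd: "fmul f (vadd g h) = vadd (fmul f g) (fmul f (h :: 'g list \<Rightarrow> 'k::field))"
  "fmul (vadd g h) f = vadd (fmul g f) (fmul h f)"
  by (auto simp: fmul_def vadd_def ring_distribs sum.distrib)
lemma fmul_vscal: "fmul f (vscal c g) = vscal c (fmul f (g :: 'g list \<Rightarrow> 'k::field))"
  "fmul (vscal c g) f = vscal c (fmul g f)"
  by (auto simp: fmul_def vscal_def sum_distrib_left mult_ac)
lemma fmul_monom: "fmul (monom u) (monom v) = (monom (u @ v) :: 'g list \<Rightarrow> 'k::field)"
proof
  fix w
  have "fmul (monom u) (monom v) w = (\<Sum>p\<in>splits w. if p = (u, v) then 1 else (0::'k))"
    unfolding fmul_splits by (intro sum.cong) (auto simp: monom_def split: if_splits)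
  then show "fmul (monom u) (monom v) w = (monom (u @ v) w :: 'k)"
    by (auto simp: sum.delta finite_splits monom_def in_splits)
qed
lemma fmul_fone: "fmul fone f = (f :: 'g list \<Rightarrow> 'k::field)" "fmul f fone = f"
proof -
  have "fmul fone f w = (\<Sum>p\<in>splits w. if p = ([], w) then f w else 0)" for w
    unfolding fmul_splits by (intro sum.cong) (auto simp: monom_def fone_def splits_def split: if_splits)
  moreover have "fmul f fone w = (\<Sum>p\<in>splits w. if p = (w, []) then f w else 0)" for w
    unfolding fmul_splits by (intro sum.cong) (auto simp: monom_def fone_def splits_def split: if_splits)
  ultimately show "fmul fone f = f" "fmul f fone = f"
    by (auto simp: sum.delta finite_splits in_splits)
qed

lemma fmul_eq_0: "fmul f g w \<noteq> 0 \<Longrightarrow> \<exists>u v. u @ v = w \<and> f u \<noteq> 0 \<and> g v \<noteq> 0"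
  unfolding fmul_splits
  by (erule sum.not_neutral_contains_not_neutral, clarsimp simp: in_splits)
      (metis mult_zero_left mult_zero_right)
lemma fin_supp_fmul: "fin_supp f \<Longrightarrow> fin_supp g \<Longrightarrow> fin_supp (fmul f (g :: 'g list \<Rightarrow> 'k::field))"
  by (rule finite_subset[of _ "(\<lambda>(u,v). u @ v) ` ({w. f w \<noteq> 0} \<times> {w. g w \<noteq> 0})"]) (force dest!: fmul_eq_0)+

lemma ev_fmul: assumes "fin_supp f" "fin_supp g" shows "ev (fmul f g) \<phi> = ev f (\<lambda>u. ev g (\<lambda>v. \<phi> (u @ v)))"
proof -
  let ?S = "{w. f w \<noteq> 0} \<times> {w. g w \<noteq> 0}"
  let ?T = "(\<lambda>(u,v). u @ v) ` ?S"
  have fin: "finite ?S" using assms by simp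
  have "ev (fmul f g) \<phi> = (\<Sum>w\<in>?T. fmul f g w * \<phi> w)"
    using fin by (intro ev_superset) (force dest!: fmul_eq_0)+
  also have "\<dots> = (\<Sum>w\<in>?T. \<Sum>p\<in>{p\<in>?S. (\<lambda>(u,v). u @ v) p = w}. f (fst p) * g (snd p) * \<phi> (fst p @ snd p))"
    unfolding fmul_splits sum_distrib_right
    by (intro sum.cong refl sum.mono_neutral_cong_right) (auto simp: splits_def finite_splits[unfolded
        splits_def])
  also have "\<dots> = (\<Sum>p\<in>?S. f (fst p) * g (snd p) * \<phi> (fst p @ snd p))"
    by (rule sum.group) (use fin in auto)
  also have "\<dots> = ev f (\<lambda>u. ev g (\<lambda>v. \<phi> (u @ v)))"
    by (simp add: ev_def sum_distrib_left sum.cartesian_product split_def mult.assoc)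
  finally show ?thesis .
qed

text \<open>Bundling finite support into a type turns noncommutative polynomials into a vector space
  in the sense of the library, which supplies linear projections onto subspaces.\<close>

typedef (overloaded) ('g, 'k::field) falg = "{f :: 'g list \<Rightarrow> 'k. fin1 f}" morphisms coef Falg
  by (rule exI[of _ vzero]) (simp add: fin1_def fin_supp_vzero)

setup_lifting type_definition_falg

instantiation falg :: (type, field) ring_1
begin
lift_definition zero_falg :: "('a,'b) falg" is vzero by (simp add: fin1_def fin_supp_vzero)
lift_definition one_falg :: "('a,'b) falg" is fone by (simp add: fin1_def fone_def fin_supp_monom)
lift_definition plus_falg :: "('a,'b) falg \<Rightarrow> ('a,'b) falg \<Rightarrow> ('a,'b) falg" is vadd
    by (simp add: fin1_def fin_supp_vadd)
lift_definition minus_falg :: "('a,'b) falg \<Rightarrow> ('a,'b) falg \<Rightarrow> ('a,'b) falg" is vsub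
    by (simp add: fin1_def fin_supp_vsub)
lift_definition uminus_falg :: "('a,'b) falg \<Rightarrow> ('a,'b) falg" is vneg by (simp add: fin1_def fin_supp_vneg)
lift_definition times_falg :: "('a,'b) falg \<Rightarrow> ('a,'b) falg \<Rightarrow> ('a,'b) falg" is fmul
    by (simp add: fin1_def fin_supp_fmul)
instance
proof
  fix a b c :: "('a, 'b) falg"
  show "a * b * c = a * (b * c)" by transfer (rule fmul_assoc)
  show "1 * a = a" "a * 1 = a" by (transfer, rule fmul_fone)+
  show "(a + b) * c = a * c + b * c" "a * (b + c) = a * b + a * c" by (transfer, rule fmul_vadd)+
  show "a + b + c = a + (b + c)" "a + b = b + a" "0 + a = a" "- a + a = 0" "a - b = a + - b"
    by (transfer, auto simp: vadd_def vzero_def vneg_def vsub_def)+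
  show "(0::('a, 'b) falg) \<noteq> 1" by transfer (auto simp: vzero_def fone_def monom_def fun_eq_iff)
qed
end

lift_definition fscale :: "'k \<Rightarrow> ('g,'k::field) falg \<Rightarrow> ('g,'k) falg" is vscal
    by (simp add: fin1_def fin_supp_vscal)
lift_definition word :: "'g list \<Rightarrow> ('g,'k::field) falg" is monom by (simp add: fin1_def fin_supp_monom)

lemma fscale_mult: "fscale c x * y = fscale c (x * y)" "x * fscale c y = fscale c (x * y)"
  by (transfer, rule fmul_vscal)+

global_interpretation fvs: vector_space "fscale :: 'k::field \<Rightarrow> ('g,'k) falg \<Rightarrow> ('g,'k) falg"
  by unfold_locales (transfer, auto simp: vscal_def vadd_def ring_distribs mult_ac)+

global_interpretation fvp: vector_space_pair "fscale :: 'k::field \<Rightarrow> ('g,'k) falg \<Rightarrow> ('g,'k) falg"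
    "fscale :: 'k \<Rightarrow> ('g,'k) falg \<Rightarrow> ('g,'k) falg" ..

text \<open>
  The quotient by an ideal that depends on parameters is not a type. It is embedded, by its left regular
  representation followed by a linear retraction with the ideal as kernel, into a ring that is a type.
\<close>

typedef (overloaded) ('g, 'k::field) endo =
    "{F :: ('g,'k) falg \<Rightarrow> ('g,'k) falg. (\<forall>x y. F (x + y) = F x + F y) \<and> (\<forall>c x. F (fscale c x)
        = fscale c (F x))}"
  morphisms app Endo
  by (rule exI[of _ "\<lambda>x. x"]) simp

setup_lifting type_definition_endo

instantiation endo :: (type, field) ring
begin
lift_definition zero_endo :: "('a,'b) endo" is "\<lambda>x. 0" by simp
text \<open>In this and the following operations \<open>ord_bracket\<close> is a bound variable
  standing for the second endomorphism, not the bracket of arrows.\<close>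

lift_definition plus_endo :: "('a,'b) endo \<Rightarrow> ('a,'b) endo \<Rightarrow> ('a,'b) endo" is "\<lambda>F ord_bracket x. F x
    + ord_bracket x"
  by (simp add: algebra_simps fvs.scale_right_distrib)
lift_definition minus_endo :: "('a,'b) endo \<Rightarrow> ('a,'b) endo \<Rightarrow> ('a,'b) endo" is "\<lambda>F ord_bracket x. F x
    - ord_bracket x"
  by (simp add: algebra_simps fvs.scale_right_diff_distrib)
lift_definition uminus_endo :: "('a,'b) endo \<Rightarrow> ('a,'b) endo" is "\<lambda>F x. - F x"
  by (simp add: algebra_simps)
lift_definition times_endo :: "('a,'b) endo \<Rightarrow> ('a,'b) endo \<Rightarrow> ('a,'b) endo" is
    "\<lambda>F ord_bracket x. F (ord_bracket x)"
  by simp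
instance
  by standard (transfer, auto simp: algebra_simps)+
end

lift_definition escale :: "'k \<Rightarrow> ('g,'k::field) endo \<Rightarrow> ('g,'k) endo" is "\<lambda>c F x. fscale c (F x)"
  by (simp add: fvs.scale_right_distrib mult.commute)

lemma app_simps: "app (x + y) v = app x v + app y v" "app (escale c x) v = fscale c (app x v)"
  "app (x * y) v = app x (app y v)" "app 0 v = 0" "app (x - y) v = app x v - app y v"
  "app x (v + w) = app x v + app x w" "app x (fscale c v) = fscale c (app x v)"
  using app[of x]
  by (simp_all add: plus_endo.rep_eq escale.rep_eq times_endo.rep_eq zero_endo.rep_eq minus_endo.rep_eq)

lemma escale_mult: "escale c x * y = escale c (x * y)" "x * escale c y = escale c (x * y)"
  by (transfer, simp)+

lemma escale_1: "escale 1 x = x" and escale_0: "escale 0 x = 0"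
  by (transfer, simp)+

lemma coef_simps: "coef (x + y) = vadd (coef x) (coef y)" "coef (fscale c x) = vscal c (coef x)"
  "coef (x - y) = vsub (coef x) (coef y)" "coef (x * y) = fmul (coef x) (coef y)" "coef 0 = vzero" "coef 1
      = fone"
  "coef (word w) = monom w"
  by (transfer, simp)+

lemma fin1_coef: "fin1 (coef x)" using coef by auto

lemma Falg_simps:
  "fin1 f \<Longrightarrow> fin1 g \<Longrightarrow> Falg (vadd f g) = Falg f + Falg g"
  "fin1 f \<Longrightarrow> fin1 g \<Longrightarrow> Falg (vsub f g) = Falg f - Falg g"
  "fin1 f \<Longrightarrow> fin1 g \<Longrightarrow> Falg (fmul f g) = Falg f * Falg g"
  "fin1 f \<Longrightarrow> Falg (vscal c f) = fscale c (Falg f)" "Falg (monom w) = word w"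
  by (simp_all add: coef_inject[symmetric] Falg_inverse coef_simps fin1_def fin_supp_vadd fin_supp_vsub
      fin_supp_fmul fin_supp_vscal fin_supp_monom)

lemma fin_supp_induct [consumes 1, case_names zero step]:
  fixes d :: "'x \<Rightarrow> 'k::field"
  assumes "fin_supp d" "P vzero" "\<And>d c x. fin_supp d \<Longrightarrow> P d \<Longrightarrow> P (vadd d (vscal c (\<lambda>y. if y = x then 1 else 0)))"
  shows "P d"
proof -
  have "P d" if "finite S" "{x. d x \<noteq> 0} \<subseteq> S" for S d
    using that
  proof (induction S arbitrary: d rule: finite_induct)
    case empty
    then have "d = vzero" by (auto simp: vzero_def)
    then show ?case using assms(2) by simp
  next
    case (insert x S)
    let ?d = "d(x := 0)"
    have sub: "{y. ?d y \<noteq> 0} \<subseteq> S" using insert.prems by auto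
    have "P (vadd ?d (vscal (d x) (\<lambda>y. if y = x then 1 else 0)))"
      by (rule assms(3)[OF _ insert.IH[OF sub]]) (rule finite_subset[OF sub insert.hyps(1)])
    also have "vadd ?d (vscal (d x) (\<lambda>y. if y = x then 1 else 0)) = d"
      by (auto simp: vadd_def vscal_def)
    finally show ?case .
  qed
  then show ?thesis using assms(1) by blast
qed

lemma single_pair: "(\<lambda>y. if y = (p, q) then 1 else (0::'k::field)) = tens (monom p) (monom q)"
  by (auto simp: tens_def monom_def)
lemma single_triple: "(\<lambda>y. if y = (p, q, r) then 1 else (0::'k::field)) = tens3 (monom p) (monom q) (monom r)"
  by (auto simp: tens3_def monom_def)

lemma fideal2_vscal:
  assumes J: "\<And>c x. x \<in> J \<Longrightarrow> vscal c x \<in> J" and d: "d \<in> fideal2 J"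
  shows "vscal c d \<in> fideal2 J"
  using d
proof (induction rule: fideal2.induct)
  case f2_zero then show ?case by (simp add: vscal_def vzero_def fideal2.f2_zero[unfolded vzero_def])
next
  case (f2_l x y)
  have "vscal c (tens x y) = tens (vscal c x) y" by (auto simp: vscal_def tens_def mult.assoc)
  then show ?case using f2_l by (simp add: fideal2.f2_l J)
next
  case (f2_r x y)
  have "vscal c (tens x y) = tens x (vscal c y)" by (auto simp: vscal_def tens_def)
  then show ?case using f2_r by (simp add: fideal2.f2_r J)
next
  case (f2_add p q)
  have "vscal c (vadd p q) = vadd (vscal c p) (vscal c q)" by (auto simp: vscal_def vadd_def ring_distribs)
  then show ?case using f2_add by (simp add: fideal2.f2_add)
qed

lemma fideal3_vscal:
  assumes J: "\<And>c x. x \<in> J \<Longrightarrow> vscal c x \<in> J" and d: "d \<in> fideal3 J"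
  shows "vscal c d \<in> fideal3 J"
  using d
proof (induction rule: fideal3.induct)
  case f3_zero then show ?case by (simp add: vscal_def vzero_def fideal3.f3_zero[unfolded vzero_def])
next
  case (f3_1 x y z)
  have "vscal c (tens3 x y z) = tens3 (vscal c x) y z" by (auto simp: vscal_def tens3_def mult.assoc)
  then show ?case using f3_1 by (simp add: fideal3.f3_1 J)
next
  case (f3_2 x y z)
  have "vscal c (tens3 x y z) = tens3 x (vscal c y) z" by (auto simp: vscal_def tens3_def mult_ac)
  then show ?case using f3_2 by (simp add: fideal3.f3_2 J)
next
  case (f3_3 x y z)
  have "vscal c (tens3 x y z) = tens3 x y (vscal c z)" by (auto simp: vscal_def tens3_def mult_ac)
  then show ?case using f3_3 by (simp add: fideal3.f3_3 J)
next
  case (f3_add p q)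
  have "vscal c (vadd p q) = vadd (vscal c p) (vscal c q)" by (auto simp: vscal_def vadd_def ring_distribs)
  then show ?case using f3_add by (simp add: fideal3.f3_add)
qed

section \<open>The quotient by an ideal and its separation by multilinear forms\<close>

locale word_ideal =
  fixes J :: "('g list \<Rightarrow> 'k::field) set"
  assumes J_fin: "f \<in> J \<Longrightarrow> fin1 f" and J_zero: "vzero \<in> J"
    and J_vadd: "f \<in> J \<Longrightarrow> g \<in> J \<Longrightarrow> vadd f g \<in> J" and J_vscal: "f \<in> J \<Longrightarrow> vscal c f \<in> J"
    and J_left: "fin1 x \<Longrightarrow> f \<in> J \<Longrightarrow> fmul x f \<in> J" and J_right: "fin1 x \<Longrightarrow> f \<in> J \<Longrightarrow> fmul f x \<in> J"
begin

text \<open>The identity on the subspace \<open>J\<close> extends to a linear projection g onto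
  \<open>J\<close>; the retraction is the identity minus g.\<close>

lemma ex_retraction: "\<exists>p. (\<forall>x y. p (x + y) = p x + p y) \<and> (\<forall>c x. p (fscale c x) = fscale c (p x))
   \<and> (\<forall>x. coef (x - p x) \<in> J) \<and> (\<forall>x. coef x \<in> J \<longrightarrow> p x = 0)"
proof -
  have sub: "fvs.subspace {x. coef x \<in> J}"
    by (rule fvs.subspaceI) (auto simp: coef_simps J_zero J_vadd J_vscal)
  obtain g where g: "range g \<subseteq> {x. coef x \<in> J}" "Vector_Spaces.linear fscale fscale g" "\<forall>v. coef v \<in> J \<longrightarrow> g v
      = v"
    using fvp.linear_exists_left_inverse_on[OF fvs.linear_id sub] by auto
  interpret g: Vector_Spaces.linear fscale fscale g by (rule g(2))
  show ?thesis
    by (rule exI[of _ "\<lambda>x. x - g x"]) (use g in \<open>auto simp: g.add g.scale fvs.scale_right_diff_distrib\<close>)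
qed

definition retr where "retr = (SOME p. (\<forall>x y. p (x + y) = p x + p y) \<and> (\<forall>c x. p (fscale c x) = fscale c (p x))
   \<and> (\<forall>x. coef (x - p x) \<in> J) \<and> (\<forall>x. coef x \<in> J \<longrightarrow> p x = 0))"

lemma retr: "retr (x + y) = retr x + retr y" "retr (fscale c x) = fscale c (retr x)"
  "coef (x - retr x) \<in> J" "coef x \<in> J \<Longrightarrow> retr x = 0"
  using someI_ex[OF ex_retraction] unfolding retr_def[symmetric] by blast+

lemma retr_diff: "retr (x - y) = retr x - retr y"
  using retr(1)[of "x - y" y] by simp

text \<open>Since \<open>J\<close> absorbs multiplication from the left, retracting before the
  product changes nothing. This is what makes \<open>rho\<close> multiplicative.\<close>

lemma retr_mult: "retr (x * retr y) = retr (x * y)"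
proof -
  have "coef (x * (y - retr y)) \<in> J" unfolding coef_simps(4) by (rule J_left[OF fin1_coef retr(3)])
  then have "retr (x * y - x * retr y) = 0" by (simp add: retr(4) right_diff_distrib)
  then show ?thesis by (simp add: retr_diff)
qed

definition rho :: "('g list \<Rightarrow> 'k) \<Rightarrow> ('g, 'k) endo" where "rho f = Endo (\<lambda>v. retr (Falg f * v))"

lemma app_rho: "app (rho f) v = retr (Falg f * v)"
  unfolding rho_def by (subst Endo_inverse) (auto simp: retr ring_distribs fscale_mult)

lemma endo_eqI: "(\<And>v. app x v = app y v) \<Longrightarrow> x = y" by (simp add: app_inject[symmetric] fun_eq_iff)

lemma rho_simps:
  "fin1 f \<Longrightarrow> fin1 g \<Longrightarrow> rho (vadd f g) = rho f + rho g"
  "fin1 f \<Longrightarrow> fin1 g \<Longrightarrow> rho (vsub f g) = rho f - rho g"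
  "fin1 f \<Longrightarrow> fin1 g \<Longrightarrow> rho (fmul f g) = rho f * rho g"
  "fin1 f \<Longrightarrow> rho (vscal c f) = escale c (rho f)"
  by (rule endo_eqI, simp add: app_rho app_simps Falg_simps retr retr_diff ring_distribs fscale_mult retr_mult
      mult.assoc)+

text \<open>Evaluation at 1 recovers the retraction of \<open>f\<close>, which differs from
  \<open>f\<close> by an element of \<open>J\<close>, so \<open>rho\<close> is faithful on the
  quotient. The converse uses that \<open>J\<close> absorbs multiplication from the right.\<close>

lemma rho_eq_0: "fin1 f \<Longrightarrow> rho f = 0 \<longleftrightarrow> f \<in> J"
proof
  assume f: "fin1 f"
  assume "rho f = 0"
  then have "retr (Falg f) = 0" using app_rho[of f 1] by (simp add: app_simps)
  then show "f \<in> J" using retr(3)[of "Falg f"] f by (simp add: Falg_inverse)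
next
  assume f: "fin1 f" "f \<in> J"
  show "rho f = 0"
    by (rule endo_eqI) (simp add: app_rho app_simps retr(4) coef_simps Falg_inverse f J_right fin1_coef)
qed

lemma rho_vzero: "rho vzero = 0" using rho_eq_0[of vzero] J_zero J_fin by blast

lemma fin1_fone: "fin1 (fone :: 'g list \<Rightarrow> 'k)" by (simp add: fone_def fin1_def fin_supp_monom)

lemma rho_fone: "fin1 f \<Longrightarrow> rho fone * rho f = rho f" "fin1 f \<Longrightarrow> rho f * rho fone = rho f"
  by (simp_all add: rho_simps(3)[symmetric] fmul_fone fin1_fone)

lemma single_monom: "(\<lambda>y. if y = x then 1 else 0) = monom x" by (simp add: monom_def)

lemma ev_rho: assumes f: "fin1 f" and L: "linear_form escale L" shows "ev f (\<lambda>w. L (rho (monom w))) = L (rho f)"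
  using f unfolding fin1_def
proof (induction rule: fin_supp_induct)
  case zero
  have "L 0 = 0" using L unfolding linear_form_def by (metis add_cancel_left_left add.right_neutral)
  then show ?case by (simp add: ev_vzero rho_vzero)
next
  case (step d c x)
  then show ?case using L unfolding single_monom
    by (simp add: ev_vadd ev_vscal fin_supp_vscal rho_simps fin1_def ev_monom fin_supp_monom)
      (simp add: linear_form_def)
qed

lemma rho_sum: "finite I \<Longrightarrow> (\<And>i. i \<in> I \<Longrightarrow> fin1 (g i)) \<Longrightarrow> rho (\<lambda>w. \<Sum>i\<in>I. g i w) = (\<Sum>i\<in>I. rho (g i))"
proof (induction I rule: finite_induct)
  case empty then show ?case using rho_vzero by (simp add: vzero_def)
next
  case (insert i I)
  have "(\<lambda>w. \<Sum>i\<in>insert i I. g i w) = vadd (g i) (\<lambda>w. \<Sum>i\<in>I. g i w)" using insert by (auto simp: vadd_def)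
  then show ?case using insert by (simp add: rho_simps fin1_def fin_supp_sum)
qed

lemma fideal2_sum: "finite S \<Longrightarrow> (\<And>i. i \<in> S \<Longrightarrow> g i \<in> fideal2 J) \<Longrightarrow> (\<lambda>z. \<Sum>i\<in>S. g i z) \<in> fideal2 J"
proof (induction S rule: finite_induct)
  case empty then show ?case using fideal2.f2_zero by (simp add: vzero_def)
next
  case (insert i I)
  have "(\<lambda>w. \<Sum>i\<in>insert i I. g i w) = vadd (g i) (\<lambda>w. \<Sum>i\<in>I. g i w)" using insert by (auto simp: vadd_def)
  then show ?case using insert by (simp add: fideal2.f2_add)
qed
lemma fideal3_sum: "finite S \<Longrightarrow> (\<And>i. i \<in> S \<Longrightarrow> g i \<in> fideal3 J) \<Longrightarrow> (\<lambda>z. \<Sum>i\<in>S. g i z) \<in> fideal3 J"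
proof (induction S rule: finite_induct)
  case empty then show ?case using fideal3.f3_zero by (simp add: vzero_def)
next
  case (insert i I)
  have "(\<lambda>w. \<Sum>i\<in>insert i I. g i w) = vadd (g i) (\<lambda>w. \<Sum>i\<in>I. g i w)" using insert by (auto simp: vadd_def)
  then show ?case using insert by (simp add: fideal3.f3_add)
qed

abbreviation "mn w \<equiv> monom w :: 'g list \<Rightarrow> 'k"
definition "retr_word w = coef (retr (word w))"

lemma monom_retr_word: "vsub (mn w) (retr_word w) \<in> J" "fin1 (retr_word w)" "fin1 (mn w)"
  using retr(3)[of "word w"] by (simp_all add: retr_word_def coef_simps fin1_coef)
      (simp add: fin1_def fin_supp_monom)

lemma app_rho_1: "coef (app (rho (mn w)) 1) = retr_word w"
  by (simp add: app_rho Falg_simps retr_word_def)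

lemma lin_coef: "linear_form escale (\<lambda>x. coef (app x 1) w * c)" "linear_form escale (\<lambda>x. c * coef (app x 1) w)"
  by (simp_all add: linear_form_def app_simps coef_simps vadd_def vscal_def ring_distribs mult_ac)

text \<open>The coefficients of the retraction at two fixed words form a bilinear form, so the
  hypothesis kills the image of \<open>d\<close> under retraction in both factors. A basis tensor
  differs from its retracted version by an element of \<open>fideal2 J\<close>, as is seen by
  retracting one factor at a time; summing over the support gives the claim.\<close>

lemma separation2:
  assumes d: "fin_supp d" and z: "\<And>\<beta>. bilinear_form escale \<beta> \<Longrightarrow> ev d (\<lambda>(p,q). \<beta> (rho (mn p)) (rho (mn q))) = 0"
  shows "d \<in> fideal2 J"
proof -
  let ?S = "{z. d z \<noteq> 0}"
  have 0: "ev d (\<lambda>(p,q). tens (retr_word p) (retr_word q) z) = 0" for z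
  proof -
    obtain w1 w2 where zz: "z = (w1, w2)" by (cases z)
    have "bilinear_form escale (\<lambda>x y. coef (app x 1) w1 * coef (app y 1) w2)"
      by (simp add: bilinear_form_def lin_coef)
    from z[OF this] show ?thesis by (simp add: app_rho_1 zz tens_def split_def)
  qed
  have "tens (mn p) (mn q) = vadd (vadd (tens (vsub (mn p) (retr_word p)) (mn q)) (tens (retr_word p) (vsub
      (mn q) (retr_word q)))) (tens (retr_word p) (retr_word q))" for p q
    by (auto simp: tens_def vadd_def vsub_def ring_distribs)
  then have "vsub (tens (mn p) (mn q)) (tens (retr_word p) (retr_word q))
      = vadd (tens (vsub (mn p) (retr_word p)) (mn q)) (tens (retr_word p) (vsub (mn q) (retr_word q)))" for p q
    by (auto simp: vadd_def vsub_def)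
  then have 1: "vsub (tens (mn p) (mn q)) (tens (retr_word p) (retr_word q)) \<in> fideal2 J" for p q
    by (simp add: fideal2.intros monom_retr_word)
  have "d z = (\<Sum>pq\<in>?S. vscal (d pq) (vsub (tens (mn (fst pq)) (mn (snd pq))) (tens (retr_word (fst pq))
      (retr_word (snd pq)))) z)" for z
  proof -
    have "d z = ev d (\<lambda>(p,q). tens (mn p) (mn q) z)"
    proof -
      have "ev d (\<lambda>(p,q). tens (mn p) (mn q) z) = (\<Sum>pq\<in>?S. if z = pq then d pq else 0)"
        unfolding ev_def by (intro sum.cong) (auto simp: tens_def monom_def split: prod.splits)
      then show ?thesis using d by simp
    qed
    then have "d z = ev d (\<lambda>(p,q). tens (mn p) (mn q) z)
        - ev d (\<lambda>(p,q). tens (retr_word p) (retr_word q) z)" by (simp add: 0)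
    also have "\<dots> = (\<Sum>pq\<in>?S. vscal (d pq) (vsub (tens (mn (fst pq)) (mn (snd pq))) (tens (retr_word (fst pq))
        (retr_word (snd pq)))) z)"
      unfolding ev_def sum_subtractf[symmetric] by (simp add: split_def vscal_def vsub_def ring_distribs)
    finally show ?thesis .
  qed
  then have "d = (\<lambda>z. \<Sum>pq\<in>?S. vscal (d pq) (vsub (tens (mn (fst pq)) (mn (snd pq))) (tens (retr_word (fst pq))
      (retr_word (snd pq)))) z)"
    by (rule ext)
  also have "\<dots> \<in> fideal2 J" by (intro fideal2_sum d fideal2_vscal 1 J_vscal)
  finally show ?thesis .
qed

lemma separation3:
  assumes d: "fin_supp d" and z: "\<And>\<beta>. trilinear_form escale \<beta>
      \<Longrightarrow> ev d (\<lambda>(p,q,r). \<beta> (rho (mn p)) (rho (mn q)) (rho (mn r))) = 0"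
  shows "d \<in> fideal3 J"
proof -
  let ?S = "{z. d z \<noteq> 0}"
  let ?r = "\<lambda>(p,q,r). tens3 (retr_word p) (retr_word q) (retr_word r)" and ?m
      = "\<lambda>(p,q,r). tens3 (mn p) (mn q) (mn r)"
  have 0: "ev d (\<lambda>w. ?r w z) = 0" for z
  proof -
    obtain w1 w2 w3 where zz: "z = (w1, w2, w3)" by (cases z)
    have "trilinear_form escale (\<lambda>x y v. coef (app x 1) w1 * coef (app y 1) w2 * coef (app v 1) w3)"
      by (simp add: trilinear_form_def linear_form_def app_simps coef_simps vadd_def vscal_def ring_distribs
          mult_ac)
    from z[OF this] show ?thesis by (simp add: app_rho_1 zz tens3_def split_def)
  qed
  have "tens3 (mn p) (mn q) (mn r) = vadd (vadd (tens3 (vsub (mn p) (retr_word p)) (mn q) (mn r)) (vadd (tens3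
      (retr_word p) (vsub (mn q) (retr_word q)) (mn r))
      (tens3 (retr_word p) (retr_word q) (vsub (mn r) (retr_word r))))) (tens3 (retr_word p) (retr_word q)
          (retr_word r))" for p q r
    by (auto simp: tens3_def vadd_def vsub_def ring_distribs)
  then have "vsub (tens3 (mn p) (mn q) (mn r)) (tens3 (retr_word p) (retr_word q) (retr_word r))
      = vadd (tens3 (vsub (mn p) (retr_word p)) (mn q) (mn r)) (vadd (tens3 (retr_word p) (vsub (mn q)
          (retr_word q)) (mn r)) (tens3 (retr_word p) (retr_word q) (vsub (mn r) (retr_word r))))" for p q r
    by (auto simp: vadd_def vsub_def)
  then have 1: "vsub (?m w) (?r w) \<in> fideal3 J" for w
    by (cases w) (simp add: fideal3.intros monom_retr_word)
  have "d z = (\<Sum>w\<in>?S. vscal (d w) (vsub (?m w) (?r w)) z)" for z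
  proof -
    have "d z = ev d (\<lambda>w. ?m w z)"
    proof -
      have "ev d (\<lambda>w. ?m w z) = (\<Sum>w\<in>?S. if z = w then d w else 0)"
        unfolding ev_def by (intro sum.cong) (auto simp: tens3_def monom_def split: prod.splits)
      then show ?thesis using d by simp
    qed
    then have "d z = ev d (\<lambda>w. ?m w z) - ev d (\<lambda>w. ?r w z)" by (simp add: 0)
    also have "\<dots> = (\<Sum>w\<in>?S. vscal (d w) (vsub (?m w) (?r w)) z)"
      unfolding ev_def sum_subtractf[symmetric] by (simp add: split_def vscal_def vsub_def ring_distribs)
    finally show ?thesis .
  qed
  then have "d = (\<lambda>z. \<Sum>w\<in>?S. vscal (d w) (vsub (?m w) (?r w)) z)" by (rule ext)
  also have "\<dots> \<in> fideal3 J" by (intro fideal3_sum d fideal3_vscal 1 J_vscal)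
  finally show ?thesis .
qed

end

section \<open>The localised path algebra of an ordered quiver\<close>

fun deps :: "'a darr \<Rightarrow> 'k::field" where
  "deps (Pos a) = 1" | "deps (Star a) = -1"

definition list_fun :: "('k \<times> 'x) list \<Rightarrow> 'x \<Rightarrow> 'k::field" where
  "list_fun xs p = (\<Sum>(k,x)\<leftarrow>xs. if x = p then k else 0)"

lemma list_fun_simps: "list_fun [] = vzero" "list_fun ((k,x) # xs) = vadd (vscal k (\<lambda>y. if y
    = x then 1 else 0)) (list_fun xs)"
  by (auto simp: list_fun_def vzero_def vadd_def vscal_def)

lemma fin_supp_list_fun: "fin_supp (list_fun xs)"
  by (induction xs) (auto simp: list_fun_simps fin_supp_vzero fin_supp_vadd fin_supp_vscal)

lemma ev_list_fun: "ev (list_fun xs) \<phi> = (\<Sum>(k,x)\<leftarrow>xs. k * \<phi> x)"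
proof (induction xs)
  case (Cons a xs)
  obtain k x where a: "a = (k, x)" by (cases a)
  have "ev (\<lambda>y. if y = x then 1 else 0) \<phi> = \<phi> x" by (simp add: ev_def)
  then show ?case using Cons by (simp add: a list_fun_simps ev_vadd ev_vscal fin_supp_list_fun fin_supp_vscal)
qed (simp add: list_fun_simps ev_vzero)

lemma sum_list_concat_map: "(\<Sum>x\<leftarrow>concat (map f xs). F x) = (\<Sum>y\<leftarrow>xs. \<Sum>x\<leftarrow>f y. F x)"
  by (induction xs) simp_all

lemma fin1_simps:
  "fin1 f \<Longrightarrow> fin1 g \<Longrightarrow> fin1 (vadd f (g :: 'g list \<Rightarrow> 'k::field))" "fin1 f \<Longrightarrow> fin1 g \<Longrightarrow> fin1 (vsub f g)"
  "fin1 f \<Longrightarrow> fin1 g \<Longrightarrow> fin1 (fmul f g)" "fin1 f \<Longrightarrow> fin1 (vscal c f)" "fin1 (vzero :: 'g list \<Rightarrow> 'k)"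
  "fin1 (fone :: 'g list \<Rightarrow> 'k)" "fin1 (monom w :: 'g list \<Rightarrow> 'k)"
  by (simp_all add: fin1_def fone_def fin_supp_vadd fin_supp_vsub fin_supp_fmul fin_supp_vscal fin_supp_vzero
      fin_supp_monom)

lemma fin1_gens: "fin1 (fe s :: ('v,'a) gen list \<Rightarrow> 'k::field)" "fin1 (far b :: ('v,'a) gen list \<Rightarrow> 'k)"
    "fin1 (fiv b :: ('v,'a) gen list \<Rightarrow> 'k)"
  by (simp_all add: fe_def far_def fiv_def fin1_simps)

lemma fin1_locfac: "fin1 (locfac t h g b :: ('v,'a) gen list \<Rightarrow> 'k::field)"
  by (simp add: locfac_def fin1_simps fin1_gens)

lemma fin1_sum: "finite I \<Longrightarrow> (\<And>i. i \<in> I \<Longrightarrow> fin1 (g i)) \<Longrightarrow> fin1 (\<lambda>w. \<Sum>i\<in>I. (g i w :: 'k::field))"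
  unfolding fin1_def by (rule fin_supp_sum)

lemma fin1_rels: "r \<in> rels t h g \<Longrightarrow> fin1 (r :: ('v::finite,'a) gen list \<Rightarrow> 'k::field)"
  unfolding rels_def by (auto simp: fin1_simps fin1_gens fin1_locfac fin1_sum)

lemma Jid_word_ideal: "word_ideal (Jid t h (g :: 'a \<Rightarrow> 'k::field) :: (('v::finite,'a) gen list \<Rightarrow> 'k) set)"
proof
  show "fin1 f" if "f \<in> Jid t h g" for f :: "('v,'a) gen list \<Rightarrow> 'k"
    using that unfolding Jid_def by (induction rule: fideal.induct) (auto simp: fin1_simps fin1_rels)
  show "vzero \<in> Jid t h g" by (simp add: Jid_def fideal.fi_zero)
  show "vadd f f' \<in> Jid t h g" if "f \<in> Jid t h g" "f' \<in> Jid t h g" for f f' :: "('v,'a) gen list \<Rightarrow> 'k"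
    using that by (simp add: Jid_def fideal.fi_add)
  show left: "fmul x f \<in> Jid t h g" if "fin1 x" "f \<in> Jid t h g" for x f :: "('v,'a) gen list \<Rightarrow> 'k"
    using that(2) unfolding Jid_def
  proof (induction rule: fideal.induct)
    case (fi_gen r x' y)
    then have "fmul (fmul (fmul x x') r) y \<in> fideal (rels t h g)" using that(1)
        by (intro fideal.fi_gen) (simp_all add: fin1_simps)
    then show ?case by (simp add: fmul_assoc)
  qed (auto simp: fmul_vadd fideal.fi_add fideal.fi_zero, simp add: fmul_def vzero_def fideal.fi_zero[unfolded
      vzero_def])
  show "fmul f x \<in> Jid t h g" if "fin1 x" "f \<in> Jid t h g" for x f :: "('v,'a) gen list \<Rightarrow> 'k"
    using that(2) unfolding Jid_def
  proof (induction rule: fideal.induct)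
    case (fi_gen r x' y)
    then have "fmul (fmul x' r) (fmul y x) \<in> fideal (rels t h g)" using that(1)
        by (intro fideal.fi_gen) (simp_all add: fin1_simps)
    then show ?case by (simp add: fmul_assoc)
  qed (auto simp: fmul_vadd fideal.fi_add fideal.fi_zero, simp add: fmul_def vzero_def fideal.fi_zero[unfolded
      vzero_def])
  show "vscal c f \<in> Jid t h g" if "f \<in> Jid t h g" for c and f :: "('v,'a) gen list \<Rightarrow> 'k"
  proof -
    \<comment> \<open>The rules of \<open>fideal\<close> mention no scalars; they enter through
      multiplication by a multiple of the unit.\<close>
    have "fmul (vscal c fone) f = vscal c f" by (simp add: fmul_vscal fmul_fone)
    then show ?thesis using left[of "vscal c fone" f] that by (simp add: fin1_simps)
  qed
qed

locale ordered_quiver =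
  fixes t h :: "'a::finite \<Rightarrow> 'v::finite" and g :: "'a \<Rightarrow> 'k::field_char_0"
    and lt :: "'v \<Rightarrow> 'a darr \<Rightarrow> 'a darr \<Rightarrow> bool"
  assumes order: "\<forall>s. strict_linear_order_on {b. dtl t h b = s} {(x, y). lt s x y}"
begin

abbreviation "src \<equiv> dtl t h"
abbreviation "tgt \<equiv> dhd t h"
abbreviation J :: "(('v,'a) gen list \<Rightarrow> 'k) set" where "J \<equiv> Jid t h g"

lemma lt_trans: "lt s x y \<Longrightarrow> lt s y z \<Longrightarrow> lt s x z" and lt_irrefl: "\<not> lt s x x"
  and lt_total: "src x = s \<Longrightarrow> src y = s \<Longrightarrow> x \<noteq> y \<Longrightarrow> lt s x y \<or> lt s y x"
  using order[rule_format, of s] unfolding strict_linear_order_on_def trans_def irrefl_def total_on_def by auto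

definition os :: "'a darr \<Rightarrow> 'a darr \<Rightarrow> 'k" where "os b c = osgn lt t h (src b) b c"

lemma os_eq: "os b c = (if b \<noteq> c \<and> src b = src c then (if lt (src b) b c then 1 else -1) else 0)"
  by (auto simp: os_def osgn_def)

lemma src_dstar: "src (dstar b) = tgt b" by (cases b) simp_all
lemma tgt_dstar: "tgt (dstar b) = src b" by (cases b) simp_all

sublocale word_ideal J by (rule Jid_word_ideal)

definition "ee s = rho (fe s)"
definition "aa b = rho (far b)"
definition "ii b = rho (fiv b)"

lemma rho_rel: "r \<in> rels t h g \<Longrightarrow> rho r = 0"
proof -
  assume r: "r \<in> rels t h g"
  have "fmul (fmul fone r) fone \<in> J" unfolding Jid_def by (intro fideal.fi_gen r) (simp_all add: fin1_simps)
  then show ?thesis using rho_eq_0[OF fin1_rels[OF r]] by (simp add: fmul_fone)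
qed

lemmas fin = fin1_simps fin1_gens fin1_locfac
lemmas rho_gens = rho_simps rho_vzero ee_def[symmetric] aa_def[symmetric] ii_def[symmetric]

lemma ee_ee: "ee s * ee s' = escale (kron s s') (ee s)"
proof -
  have "rho (vsub (fmul (fe s) (fe s')) (if s = s' then fe s else vzero)) = 0"
    by (rule rho_rel) (auto simp: rels_def)
  then show ?thesis by (auto simp: rho_gens fin kron_def escale_1 escale_0 split: if_splits)
qed

lemma aa_unit: "ee (src b) * aa b * ee (tgt b) = aa b"
proof -
  have "rho (vsub (far b) (fmul (fmul (fe (src b)) (far b)) (fe (tgt b)))) = 0"
    by (rule rho_rel) (auto simp: rels_def)
  then show ?thesis by (auto simp: rho_gens fin)
qed

lemma ii_unit: "ee (src b) * ii b * ee (src b) = ii b"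
proof -
  have "rho (vsub (fiv b) (fmul (fmul (fe (src b)) (fiv b)) (fe (src b)))) = 0"
    by (rule rho_rel) (auto simp: rels_def)
  then show ?thesis by (auto simp: rho_gens fin)
qed

lemma rho_locfac: "rho (locfac t h g b) = escale (dgam g b) (ee (src b)) + aa b * aa (dstar b)"
  by (simp add: locfac_def rho_gens fin)

lemma ii_left: "(escale (dgam g b) (ee (src b)) + aa b * aa (dstar b)) * ii b = ee (src b)"
proof -
  have "rho (vsub (fmul (locfac t h g b) (fiv b)) (fe (src b))) = 0"
    by (rule rho_rel) (auto simp: rels_def)
  then show ?thesis by (auto simp: rho_gens fin rho_locfac)
qed

lemma ii_right: "ii b * (escale (dgam g b) (ee (src b)) + aa b * aa (dstar b)) = ee (src b)"
proof -
  have "rho (vsub (fmul (fiv b) (locfac t h g b)) (fe (src b))) = 0"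
    by (rule rho_rel) (auto simp: rels_def)
  then show ?thesis by (auto simp: rho_gens fin rho_locfac)
qed

lemma ee_sum: "(\<Sum>s\<in>UNIV. ee s) = rho fone"
proof -
  have "rho (vsub (\<lambda>w. \<Sum>s\<in>UNIV. fe s w) fone) = 0"
    by (rule rho_rel) (auto simp: rels_def)
  then show ?thesis by (auto simp: rho_gens fin fin1_sum rho_sum)
qed

lemma ee_aa: "ee s * aa b = escale (kron s (src b)) (aa b)" and aa_ee: "aa b * ee s
    = escale (kron (tgt b) s) (aa b)"
proof -
  have "ee s * (ee (src b) * aa b * ee (tgt b)) = escale (kron s (src b)) (ee s * aa b * ee (tgt b))"
    by (simp add: mult.assoc[symmetric] ee_ee escale_mult)
  then show "ee s * aa b = escale (kron s (src b)) (aa b)"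
    using aa_unit[of b] by (auto simp: kron_def escale_1 escale_0)
  have "(ee (src b) * aa b * ee (tgt b)) * ee s = escale (kron (tgt b) s) (ee (src b) * aa b * ee (tgt b))"
    by (simp add: mult.assoc ee_ee escale_mult)
  then show "aa b * ee s = escale (kron (tgt b) s) (aa b)" unfolding aa_unit .
qed

lemma ee_ii: "ee (src b) * ii b = ii b" and ii_ee: "ii b * ee (src b) = ii b"
proof -
  have 1: "ee (src b) * ee (src b) = ee (src b)" by (simp add: ee_ee kron_def escale_1)
  show "ee (src b) * ii b = ii b"
    by (subst (1 2) ii_unit[symmetric]) (simp add: mult.assoc[symmetric] 1)
  show "ii b * ee (src b) = ii b"
    by (subst (1 2) ii_unit[symmetric]) (simp add: mult.assoc 1)
qed

lemma os_total:
  assumes "src b = s" "src c = s"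
  shows "os b c = (if b = c then 0 else if lt s b c then 1 else -1)" "os c b = (if b
      = c then 0 else if lt s b c then -1 else 1)"
proof -
  have "lt s c b \<longleftrightarrow> \<not> lt s b c" if "b \<noteq> c"
    using lt_total[OF assms that] lt_trans[of s b c b] lt_irrefl[of s b] by blast
  then show "os b c = (if b = c then 0 else if lt s b c then 1 else -1)" "os c b = (if b
      = c then 0 else if lt s b c then -1 else 1)"
    using assms by (simp_all add: os_eq)
qed

text \<open>For three distinct arrows at one vertex, transitivity forbids equal signs all around the
  cycle, and three signs that are not all equal have -1 as the sum of their pairwise products. If
  exactly two arrows coincide, the one surviving product is -1; if all coincide, everything is 0. If
  the vertices differ, each product contains a zero factor.\<close>

lemma os_quadratic: "os b c * os c d + os c d * os d b + os d b * os b c = kron3 b c d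
    - kron (src b) (src c) * kron (src c) (src d)"
proof (cases "src c = src b \<and> src d = src b")
  case True
  define L where "L = lt (src b)"
  have L: "L b c \<Longrightarrow> L c d \<Longrightarrow> L b d" "b \<noteq> c \<Longrightarrow> c \<noteq> d \<Longrightarrow> b \<noteq> d \<Longrightarrow> L b d \<Longrightarrow> L b c \<or> L c d"
    "b \<noteq> c \<Longrightarrow> L c b \<longleftrightarrow> \<not> L b c"
    using lt_trans[of "src b"] lt_total[of b "src b" c] lt_total[of c "src b" d] True lt_irrefl[of "src b"]
        unfolding L_def by metis+
  have o: "os b c = (if b = c then 0 else if L b c then 1 else -1)" "os c d = (if c
      = d then 0 else if L c d then 1 else -1)"
    "os d b = (if b = d then 0 else if L b d then -1 else 1)"
    unfolding L_def using True by (intro os_total; simp)+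
  have "kron (src b) (src c) * kron (src c) (src d) = (1::'k)" using True by (simp add: kron_def)
  then show ?thesis unfolding o kron3_def
    by (cases "b = c"; cases "c = d"; cases "b = d"; cases "L b c"; cases "L c d"; cases "L b d"; use L in simp)
next
  case False
  have 0: "os x y = 0" if "src x \<noteq> src y" for x y using that by (simp add: os_eq)
  from False consider "src b \<noteq> src c" "src c \<noteq> src d" | "src b \<noteq> src c" "src d \<noteq> src b" | "src c \<noteq> src d"
      "src d \<noteq> src b"
    by metis
  then have "os b c * os c d = 0" "os c d * os d b = 0" "os d b * os b c = 0"
      "kron (src b) (src c) * kron (src c) (src d) = (0::'k)"
    by (cases; simp add: 0 kron_def; fail)+
  moreover have "kron3 b c d = (0::'k)" using False by (auto simp: kron3_def)
  ultimately show ?thesis by (simp only: diff_0_right add_0_right)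
qed

sublocale arrow_algebra escale src tgt "dgam g" os deps ee aa
proof
  show "os b c * os c d + os c d * os d b + os d b * os b c = kron3 b c d
      - kron (src b) (src c) * kron (src c) (src d)" for b c d
    by (rule os_quadratic)
  show "os b c = - os c b" for b c
    using lt_total[of b "src b" c] lt_trans[of "src b" b c b] lt_irrefl[of "src b" b] by (auto simp: os_eq)
  show "deps (dstar b) = - deps b" "deps b * deps b = 1" "dgam g (dstar b) = dgam g b" for b
    by (cases b; simp)+
qed (simp_all add: escale_1 escale_0 escale_mult src_dstar ee_ee ee_aa aa_ee os_eq)

end

context ordered_quiver begin

section \<open>Noncommutative differentials of words\<close>

abbreviation "rw w \<equiv> rho (monom w)"

lemma rw_append: "rw (u @ v) = rw u * rw v"
  by (simp add: rho_simps(3)[symmetric] fin1_simps fmul_monom)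
lemma rw_Cons: "v \<noteq> [] \<Longrightarrow> rw (x # v) = rw [x] * rw v"
  using rw_append[of "[x]" v] by simp
lemma rw_single: "rw [E s] = ee s" "rw [Ar b] = aa b" "rw [Iv b] = ii b"
  by (simp_all add: ee_def aa_def ii_def fe_def far_def fiv_def)
lemma rw_Nil: "rw [] = rho fone" by (simp add: fone_def)

text \<open>
  The noncommutative differential of a word, as a list of entries \<open>k \<cdot> l (db) r\<close>. On \<open>Iv b\<close> it is forced by
  differentiating \<open>(\<gamma>\<^sub>b e + b b\<^sup>*) (Iv b) = e\<close>.
\<close>

fun gdiff :: "('v,'a) gen \<Rightarrow> ('k \<times> ('v,'a) gen list \<times> 'a darr \<times> ('v,'a) gen list) list" where
  "gdiff (E s) = []"
| "gdiff (Ar b) = [(1, [], b, [])]"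
| "gdiff (Iv b) = [(-1, [Iv b], b, [Ar (dstar b), Iv b]), (-1, [Iv b, Ar b], dstar b, [Iv b])]"

fun wdiff :: "('v,'a) gen list \<Rightarrow> ('k \<times> ('v,'a) gen list \<times> 'a darr \<times> ('v,'a) gen list) list" where
  "wdiff [] = []"
| "wdiff (x # w) = map (\<lambda>(k,l,b,r). (k, l, b, r @ w)) (gdiff x) @ map (\<lambda>(k,l,b,r). (k, x # l, b, r)) (wdiff w)"

lemma wdiff_append: "wdiff (u @ v) = map (\<lambda>(k,l,b,r). (k, l, b, r @ v)) (wdiff u) @ map (\<lambda>(k,l,b,r).
    (k, u @ l, b, r)) (wdiff v)"
  by (induction u) (auto simp: split_def)

text \<open>A 1-form, a sum of terms l (db) r, is tested against one form \<open>\<psi> b\<close>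
  for each arrow b. The coefficients l and r are already read in the quotient, while
  \<open>f\<close> is still in the free algebra; \<open>diff_pairing_J\<close> removes this
  asymmetry.\<close>

definition diff_pairing :: "('a darr \<Rightarrow> (('v,'a) gen,'k) endo \<Rightarrow> (('v,'a) gen,'k) endo \<Rightarrow> 'k) \<Rightarrow> (('v,'a) gen list
    \<Rightarrow> 'k) \<Rightarrow> 'k" where
  "diff_pairing \<psi> f = ev f (\<lambda>w. \<Sum>(k,l,b,r)\<leftarrow>wdiff w. k * \<psi> b (rw l) (rw r))"

lemma diff_pairing_simps:
  "fin1 f \<Longrightarrow> fin1 f' \<Longrightarrow> diff_pairing \<psi> (vadd f f') = diff_pairing \<psi> f + diff_pairing \<psi> f'"
  "fin1 f \<Longrightarrow> fin1 f' \<Longrightarrow> diff_pairing \<psi> (vsub f f') = diff_pairing \<psi> f - diff_pairing \<psi> f'"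
  "fin1 f \<Longrightarrow> diff_pairing \<psi> (vscal c f) = c * diff_pairing \<psi> f" "diff_pairing \<psi> vzero = 0"
  by (simp_all add: diff_pairing_def fin1_def ev_vadd ev_vsub ev_vscal ev_vzero)

lemma diff_pairing_sum: "finite I \<Longrightarrow> (\<And>i. i \<in> I \<Longrightarrow> fin1 (F i)) \<Longrightarrow> diff_pairing \<psi> (\<lambda>w. \<Sum>i\<in>I. F i w)
    = (\<Sum>i\<in>I. diff_pairing \<psi> (F i))"
  by (simp add: diff_pairing_def fin1_def ev_sum)

lemma diff_pairing_add: "diff_pairing (\<lambda>b l r. \<psi> b l r + \<psi>' b l r) f = diff_pairing \<psi> f + diff_pairing \<psi>' f"
  unfolding diff_pairing_def ev_add[symmetric] by (simp add: split_def ring_distribs sum_list_addf)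
lemma diff_pairing_mult: "diff_pairing (\<lambda>b l r. c * \<psi> b l r) f = c * diff_pairing \<psi> f"
  unfolding diff_pairing_def ev_mult[symmetric] by (simp add: split_def mult.left_commute sum_list_const_mult)
lemma diff_pairing_zero: "diff_pairing (\<lambda>b l r. 0) f = 0" using diff_pairing_mult[of 0 "\<lambda>b l r. 0"] by simp
lemma diff_pairing_uminus: "diff_pairing (\<lambda>b l r. - \<psi> b l r) f =
    - diff_pairing \<psi> f" using diff_pairing_mult[of "-1" \<psi>] by simp

lemma diff_pairing_lin: "(\<And>b l r. lin (\<lambda>x. \<Psi> x b l r)) \<Longrightarrow> lin (\<lambda>x. diff_pairing (\<Psi> x) f)"
proof -
  assume "\<And>b l r. lin (\<lambda>x. \<Psi> x b l r)"
  then have "\<Psi> (x + y) = (\<lambda>b l r. \<Psi> x b l r + \<Psi> y b l r)" "\<Psi> (escale c x) = (\<lambda>b l r. c * \<Psi> x b l r)" for x y c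
    by (auto simp: linear_form_def fun_eq_iff)
  then show ?thesis by (simp add: linear_form_def diff_pairing_add diff_pairing_mult)
qed

lemma diff_pairing_ev: "diff_pairing (\<lambda>b l r. ev f (\<lambda>w. \<Psi> w b l r)) f' = ev f (\<lambda>w. diff_pairing (\<Psi> w) f')"
proof -
  have "diff_pairing (\<lambda>b l r. \<Sum>w\<in>S. c w * \<Psi> w b l r) f'
      = (\<Sum>w\<in>S. c w * diff_pairing (\<Psi> w) f')" if "finite S" for S c
    using that by (induction S rule: finite_induct) (simp_all add: diff_pairing_zero diff_pairing_add
        diff_pairing_mult)
  moreover have "diff_pairing (\<lambda>b l r. \<Sum>w\<in>S. c w * \<Psi> w b l r) f'
      = (\<Sum>w\<in>S. c w * diff_pairing (\<Psi> w) f')" if "infinite S" for S c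
    using that by (simp add: diff_pairing_zero)
  ultimately show ?thesis unfolding ev_def by blast
qed

lemma diff_pairing_sum_list: "diff_pairing (\<lambda>b l r. \<Sum>x\<leftarrow>xs. \<Psi> x b l r) f = (\<Sum>x\<leftarrow>xs. diff_pairing (\<Psi> x) f)"
  by (induction xs) (simp_all add: diff_pairing_zero diff_pairing_add)

lemma diff_pairing_commute: "diff_pairing (\<lambda>b l r. diff_pairing (\<lambda>b' l' r'. F b l r b' l' r') f') f
    = diff_pairing (\<lambda>b' l' r'. diff_pairing (\<lambda>b l r. F b l r b' l' r') f) f'"
proof -
  have "diff_pairing (\<lambda>b' l' r'. diff_pairing (\<lambda>b l r. F b l r b' l' r') f) f'
      = ev f (\<lambda>w. \<Sum>(k,l,b,r)\<leftarrow>wdiff w. k * diff_pairing (\<lambda>b' l' r'. F b (rw l) (rw r) b' l' r') f')"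
    unfolding diff_pairing_def[of _ f] diff_pairing_ev
        by (simp add: split_def diff_pairing_sum_list diff_pairing_mult)
  then show ?thesis by (simp add: diff_pairing_def[of _ f])
qed

text \<open>A pairing compatible with \<open>db = e (db) e\<close>, so that it is defined on differentials over \<open>B\<close>.\<close>

definition balanced where
  "balanced \<psi> \<longleftrightarrow> (\<forall>b. bil (\<psi> b)) \<and> (\<forall>b l r. \<psi> b (l * ee (src b)) (ee (tgt b) * r) = \<psi> b l r)"

lemma balanced_mult: "balanced \<psi> \<Longrightarrow> balanced (\<lambda>b l r. \<psi> b l (r * y))" "balanced \<psi>
    \<Longrightarrow> balanced (\<lambda>b l r. \<psi> b (x * l) r)"
  by (auto simp: balanced_def bilinear_form_def linear_form_def mult.assoc[symmetric] ring_distribs escale_mult)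
    (auto simp: mult.assoc)

lemma balanced_mult2: "balanced \<psi> \<Longrightarrow> balanced (\<lambda>b l r. \<psi> b (x * l) (r * y))"
  using balanced_mult(1)[OF balanced_mult(2)] .

lemma balanced_mult3: "balanced \<psi> \<Longrightarrow> balanced (\<lambda>b l r. \<psi> b (x * (y * l)) r)"
  using balanced_mult(2)[of \<psi> "x * y"] by (simp add: mult.assoc)

lemma balancedD: assumes "balanced \<psi>"
  shows "\<psi> b l 0 = 0" "\<psi> b 0 r = 0" "\<psi> b l (r + r') = \<psi> b l r + \<psi> b l r'" "\<psi> b (l + l') r = \<psi> b l r + \<psi> b l' r"
    "\<psi> b (escale c l) r = c * \<psi> b l r" "\<psi> b l (escale c r) = c * \<psi> b l r"
proof -
  have bil: "bil (\<psi> b)" using assms by (simp add: balanced_def)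
  then show "\<psi> b l (r + r') = \<psi> b l r + \<psi> b l r'" "\<psi> b (l + l') r = \<psi> b l r + \<psi> b l' r"
    "\<psi> b (escale c l) r = c * \<psi> b l r" "\<psi> b l (escale c r) = c * \<psi> b l r" for c
    by (auto simp: bilinear_form_def linear_form_def)
  from this(3)[of 0] this(4)[of 0] show "\<psi> b l 0 = 0" "\<psi> b 0 r = 0"
    using bil unfolding bilinear_form_def linear_form_def by (metis escale_0 mult_zero_left)+
qed

lemma diff_pairing_fmul: assumes "balanced \<psi>" "fin1 f" "fin1 f'"
  shows "diff_pairing \<psi> (fmul f f') = diff_pairing (\<lambda>b l r. \<psi> b l (r * rho f')) f
      + diff_pairing (\<lambda>b l r. \<psi> b (rho f * l) r) f'"
proof -
  have lin: "lin (\<lambda>x. \<psi> b l (r * x))" "lin (\<lambda>x. \<psi> b (x * l) r)" for b l r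
    by (simp_all add: linear_form_def ring_distribs escale_mult balancedD[OF assms(1)])
  have "diff_pairing \<psi> (fmul f f') = ev f (\<lambda>u. ev f' (\<lambda>v. (\<Sum>(k,l,b,r)\<leftarrow>wdiff u. k * \<psi> b (rw l) (rw r * rw v))))
      + ev f (\<lambda>u. ev f' (\<lambda>v. (\<Sum>(k,l,b,r)\<leftarrow>wdiff v. k * \<psi> b (rw u * rw l) (rw r))))"
    unfolding diff_pairing_def using assms
    by (simp add: fin1_def ev_fmul wdiff_append ev_add[symmetric] split_def rw_append o_def)
  also have "ev f (\<lambda>u. ev f' (\<lambda>v. (\<Sum>(k,l,b,r)\<leftarrow>wdiff u. k * \<psi> b (rw l) (rw r * rw v))))
      = diff_pairing (\<lambda>b l r. \<psi> b l (r * rho f')) f"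
    unfolding diff_pairing_def by (simp add: split_def ev_sum_list ev_mult ev_rho[OF assms(3) lin(1)])
  also have "ev f (\<lambda>u. ev f' (\<lambda>v. (\<Sum>(k,l,b,r)\<leftarrow>wdiff v. k * \<psi> b (rw u * rw l) (rw r))))
      = diff_pairing (\<lambda>b l r. \<psi> b (rho f * l) r) f'"
    unfolding diff_pairing_def ev_commute[of f f']
        by (simp add: split_def ev_sum_list ev_mult ev_rho[OF assms(2) lin(2)])
  finally show ?thesis .
qed

lemma unit: "fin1 f \<Longrightarrow> rw [] * rho f = rho f" "fin1 f \<Longrightarrow> rho f * rw [] = rho f"
  by (simp_all add: rw_Nil rho_fone)

lemma diff_pairing_fe: "diff_pairing \<psi> (fe s) = 0" and diff_pairing_fone: "diff_pairing \<psi> fone = 0"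
  by (simp_all add: diff_pairing_def fe_def fone_def ev_monom)
lemma diff_pairing_far: "balanced \<psi> \<Longrightarrow> diff_pairing \<psi> (far b) = \<psi> b (ee (src b)) (ee (tgt b))"
proof -
  assume "balanced \<psi>"
  then have "\<psi> b (rw []) (rw []) = \<psi> b (rw [] * ee (src b)) (ee (tgt b) * rw [])" by (simp add: balanced_def)
  then show ?thesis by (simp add: diff_pairing_def far_def ev_monom ee_def unit fin)
qed
lemma diff_pairing_fiv: "diff_pairing \<psi> (fiv b) = - \<psi> b (ii b) (aa (dstar b) * ii b)
    - \<psi> (dstar b) (ii b * aa b) (ii b)"
  by (simp add: diff_pairing_def fiv_def ev_monom rw_Cons rw_single)

text \<open>Balancedness disposes of the relation for \<open>far b\<close>; the entries of
  \<open>gdiff (Iv b)\<close> dispose of both inverse relations, the factor \<open>locfac\<close>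
  and its inverse cancelling in the quotient.\<close>

lemma diff_pairing_rels: assumes "balanced \<psi>" "r \<in> rels t h g" shows "diff_pairing \<psi> r = 0"
proof -
  note gd = balancedD[OF assms(1)]
  have eea: "ee (src b) * aa b = aa b" "aa b * ee (tgt b) = aa b" "ee (tgt b) * aa (dstar b) = aa (dstar b)"
     "aa (dstar b) * ee (src b) = aa (dstar b)" for b
    by (simp_all add: ee_aa aa_ee kron_def escale_1 src_dstar tgt_dstar)
  have eei: "ee (src b) * (ii b * x) = ii b * x" "ee (src b) * ii b = ii b" "ii b * ee (src b) = ii b"
    "aa (dstar b) * (ee (src b) * x) = aa (dstar b) * x" for b x
    by (simp_all add: mult.assoc[symmetric] ee_ii ii_ee eea)
  have balanced: "\<psi> b (l * ee (src b)) (ee (tgt b) * r)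
      = \<psi> b l r" for b l r using assms(1) by (simp add: balanced_def)
  have good': "\<psi> b (ee (src b)) (ee (tgt b) * r) = \<psi> b (ee (src b)) r" "\<psi> b (l * ee (src b)) (ee (tgt b))
      = \<psi> b l (ee (tgt b))" for b l r
    using balanced[of b "ee (src b)" r] balanced[of b l "ee (tgt b)"] by (simp_all add: ee_ee kron_def escale_1)
  note simps = diff_pairing_simps diff_pairing_fmul diff_pairing_sum fin fin1_sum balanced_mult balanced_mult2
      balanced_mult3 assms(1) diff_pairing_fe diff_pairing_fone diff_pairing_far diff_pairing_fiv gd rho_gens
      rho_locfac
  from assms(2) consider (1) s s' where "r = vsub (fmul (fe s) (fe s')) (if s = s' then fe s else vzero)"
    | (2) "r = vsub (\<lambda>w. \<Sum>s\<in>UNIV. fe s w) fone"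
    | (3) b where "r = vsub (far b) (fmul (fmul (fe (src b)) (far b)) (fe (tgt b)))"
    | (4) b where "r = vsub (fiv b) (fmul (fmul (fe (src b)) (fiv b)) (fe (src b)))"
    | (5) b where "r = vsub (fmul (locfac t h g b) (fiv b)) (fe (src b))"
    | (6) b where "r = vsub (fmul (fiv b) (locfac t h g b)) (fe (src b))"
    unfolding rels_def by blast
  then show ?thesis
  proof cases
    case 1 then show ?thesis by (simp add: simps)
  next
    case 2 then show ?thesis by (simp add: simps)
  next
    case 3 then show ?thesis by (simp add: simps ee_ee kron_def escale_1)
  next
    case 4 then show ?thesis by (simp add: simps eei mult.assoc)
  next
    case (5 b)
    have "(escale (dgam g b) (ee (src b)) + aa b * aa (dstar b)) * (ii b * x) = ee (src b) * x" for x
      by (simp add: mult.assoc[symmetric] ii_left)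
    then show ?thesis using 5 by (simp add: simps locfac_def mult.assoc ii_left balanced good' eea)
  next
    case (6 b)
    then show ?thesis by (simp add: simps locfac_def mult.assoc ii_right balanced good' eea eei src_dstar
        tgt_dstar)
  qed
qed

text \<open>In the differential of x r y, the terms that differentiate x or y retain the factor
  \<open>rho r = 0\<close>. The remaining one differentiates r against another balanced
  pairing.\<close>

lemma diff_pairing_J: assumes "balanced \<psi>" "f \<in> J" shows "diff_pairing \<psi> f = 0"
  using assms(2) unfolding Jid_def
proof (induction rule: fideal.induct)
  case (fi_gen r x y)
  then have r: "fin1 r" by (simp add: fin1_rels)
  have "diff_pairing \<psi> (fmul (fmul x r) y) = diff_pairing (\<lambda>b l r. \<psi> b (rho x * l) (r * rho y)) r"
    using fi_gen r rho_rel[OF fi_gen(1)]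
    by (simp add: diff_pairing_fmul assms(1) balanced_mult fin1_simps rho_simps balancedD[OF assms(1)]
        diff_pairing_zero)
  also have "\<dots> = 0" by (rule diff_pairing_rels[OF balanced_mult2[OF assms(1)] fi_gen(1)])
  finally show ?case .
next
  case (fi_add p q)
  then have "fin1 p" "fin1 q" using J_fin by (simp_all add: Jid_def)
  then show ?case using fi_add by (simp add: diff_pairing_simps)
qed (simp add: diff_pairing_simps)

lemma diff_pairing_cong: assumes "balanced \<psi>" "fin1 f" "fin1 f'" "rho f = rho f'" shows "diff_pairing \<psi> f
    = diff_pairing \<psi> f'"
proof -
  have "vsub f f' \<in> J" using assms by (simp add: rho_eq_0[symmetric] fin1_simps rho_simps)
  then show ?thesis using diff_pairing_J[OF assms(1), of "vsub f f'"] assms by (simp add: diff_pairing_simps)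
qed

text \<open>Half of \<open>ord_bracket + edge_bracket\<close> as an explicit list of words, since
  the required bracket must take finitely supported values on words.\<close>

definition arrow_list :: "'a darr \<Rightarrow> 'a darr \<Rightarrow> ('k \<times> ('v,'a) gen list \<times> ('v,'a) gen list) list" where
  "arrow_list b c = [(- (1/2) * os b c, [Ar b], [Ar c]), (- (1/2) * os (dstar b) (dstar c), [Ar c], [Ar b]),
      ((1/2) * os b (dstar c), [Ar c, Ar b], [E (src b)]), ((1/2) * os (dstar b) c, [E (tgt b)], [Ar b, Ar c])]
    @ (if c = dstar b then [(deps b * dgam g b, [E (tgt b)], [E (src b)]), ((1/2) * deps b, [Ar c, Ar b], [E
        (src b)]),
      ((1/2) * deps b, [E (tgt b)], [Ar b, Ar c])] else [])"

definition arrow_form where "arrow_form b c \<beta> = (\<Sum>(k,p,q)\<leftarrow>arrow_list b c. k * \<beta> (rw p) (rw q))"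

lemma arrow_form_eq: "2 * arrow_form b c \<beta> = ord_bracket b c \<beta> + edge_bracket b c \<beta>"
  by (simp add: arrow_form_def arrow_list_def rw_Cons rw_single ord_bracket_def edge_bracket_def algebra_simps)

lemma arrow_form_eqI: "ord_bracket b c \<beta> + edge_bracket b c \<beta> = ord_bracket b' c' \<beta>' + edge_bracket b' c' \<beta>'
    \<Longrightarrow> arrow_form b c \<beta> = arrow_form b' c' \<beta>'"
  unfolding arrow_form_eq[symmetric] by simp

lemma ee_absorb: "ee (src b) * aa b = aa b" "aa b * ee (tgt b) = aa b" "ee s * ee s = ee s"
  "ee (src b) * (aa b * x) = aa b * x"
  by (simp_all add: ee_aa aa_ee ee_ee kron_def escale_1 mult.assoc[symmetric])

text \<open>With \<open>arrow_form_left\<close>, this places the bracket of \<open>b\<close> and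
  \<open>c\<close> in e(src c) A e(tgt b) \<otimes> e(src b) A e(tgt c). Where the word itself does
  not show this, its sign forces the vertices to agree. Balancedness in both arguments rests on
  it.\<close>

lemma arrow_form_right: "arrow_form b c (\<lambda>p q. \<beta> (ee (src c) * p) (q * ee (tgt c))) = arrow_form b c \<beta>"
proof -
  let ?\<beta> = "\<lambda>p q. \<beta> (ee (src c) * p) (q * ee (tgt c))"
  have "os b c * ?\<beta> (aa b) (aa c) = os b c * \<beta> (aa b) (aa c)"
    using os_eq_0_or[of b c] by (auto simp: ee_absorb) (metis ee_absorb(1))
  moreover have "os (dstar b) (dstar c) * ?\<beta> (aa c) (aa b) = os (dstar b) (dstar c) * \<beta> (aa c) (aa b)"
    using os_eq_0_or[of "dstar b" "dstar c"] by (auto simp: ee_absorb src_dstar) (metis ee_absorb(2))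
  moreover have "os b (dstar c) * ?\<beta> (aa c * aa b) (ee (src b)) = os b (dstar c) * \<beta> (aa c * aa b) (ee (src b))"
    using os_eq_0_or[of b "dstar c"] by (auto simp: ee_absorb src_dstar)
  moreover have "os (dstar b) c * ?\<beta> (ee (tgt b)) (aa b * aa c) = os (dstar b) c * \<beta> (ee (tgt b)) (aa b * aa c)"
    using os_eq_0_or[of "dstar b" c] by (auto simp: ee_absorb src_dstar mult.assoc)
  ultimately have "ord_bracket b c ?\<beta> = ord_bracket b c \<beta>" by (simp only: ord_bracket_def mult_minus_left)
  moreover have "edge_bracket b c ?\<beta> = edge_bracket b c \<beta>"
    unfolding edge_bracket_def by (rule if_cong[OF refl _ refl]) (simp add: ee_absorb ee_absorb(1,2,4)[of
        "dstar b", unfolded src_dstar tgt_dstar] src_dstar tgt_dstar mult.assoc)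
  ultimately show ?thesis by (intro arrow_form_eqI) simp
qed

lemma arrow_form_left: "arrow_form b c (\<lambda>p q. \<beta> (p * ee (tgt b)) (ee (src b) * q)) = arrow_form b c \<beta>"
proof -
  let ?\<beta> = "\<lambda>p q. \<beta> (p * ee (tgt b)) (ee (src b) * q)"
  have "os b c * ?\<beta> (aa b) (aa c) = os b c * \<beta> (aa b) (aa c)"
    using os_eq_0_or[of b c] by (auto simp: ee_absorb)
  moreover have "os (dstar b) (dstar c) * ?\<beta> (aa c) (aa b) = os (dstar b) (dstar c) * \<beta> (aa c) (aa b)"
    using os_eq_0_or[of "dstar b" "dstar c"] by (auto simp: ee_absorb src_dstar)
  moreover have "os b (dstar c) * ?\<beta> (aa c * aa b) (ee (src b)) = os b (dstar c) * \<beta> (aa c * aa b) (ee (src b))"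
    using os_eq_0_or[of b "dstar c"] by (auto simp: ee_absorb src_dstar mult.assoc)
  moreover have "os (dstar b) c * ?\<beta> (ee (tgt b)) (aa b * aa c) = os (dstar b) c * \<beta> (ee (tgt b)) (aa b * aa c)"
    using os_eq_0_or[of "dstar b" c] by (auto simp: ee_absorb src_dstar)
  ultimately have "ord_bracket b c ?\<beta> = ord_bracket b c \<beta>" by (simp only: ord_bracket_def mult_minus_left)
  moreover have "edge_bracket b c ?\<beta> = edge_bracket b c \<beta>"
    unfolding edge_bracket_def by (rule if_cong[OF refl _ refl]) (simp add: ee_absorb ee_absorb(1,2,4)[of
        "dstar b", unfolded src_dstar tgt_dstar] src_dstar tgt_dstar mult.assoc)
  ultimately show ?thesis by (intro arrow_form_eqI) simp
qed

lemma arrow_form_anti: "arrow_form b c \<beta> = - arrow_form c b (\<lambda>p q. \<beta> q p)"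
proof -
  have "ord_bracket b c \<beta> = - ord_bracket c b (\<lambda>p q. \<beta> q p)"
    unfolding ord_bracket_def os_anti[of c] os_anti[of "dstar c"]
    using os_eq_0_or[of b "dstar c"] os_eq_0_or[of "dstar b" c]
    by (elim disjE) (simp_all add: src_dstar tgt_dstar)
  moreover have "edge_bracket b c \<beta> = - edge_bracket c b (\<lambda>p q. \<beta> q p)"
    by (auto simp: edge_bracket_def src_dstar tgt_dstar eps_dstar gam_dstar algebra_simps)
  ultimately have "2 * arrow_form b c \<beta> = 2 * (- arrow_form c b (\<lambda>p q. \<beta> q p))"
    unfolding arrow_form_eq mult_minus_right by simp
  then show ?thesis by simp
qed

lemma arrow_form_lin: "(\<And>p q. lin (\<lambda>x. B x p q)) \<Longrightarrow> lin (\<lambda>x. arrow_form b c (B x))"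
proof -
  have "lin (\<lambda>x. \<Sum>(k,p,q)\<leftarrow>xs. k * B x (rw p) (rw q))" if "\<And>p q. lin (\<lambda>x. B x p q)" for xs
    using that by (induction xs) (auto simp: linear_form_def algebra_simps)
  then show "(\<And>p q. lin (\<lambda>x. B x p q)) \<Longrightarrow> lin (\<lambda>x. arrow_form b c (B x))" unfolding arrow_form_def .
qed

text \<open>The Leibniz rule in the second argument uses the outer bimodule structure, so l' and r'
  stand outside. Antisymmetry then forces the inner structure for the first argument, which puts r
  and l next to the tensor sign.\<close>

definition form_bracket where
  "form_bracket f f' \<beta> = diff_pairing (\<lambda>b l r. diff_pairing (\<lambda>c l' r'. arrow_form b c (\<lambda>p q. \<beta> (l' * p * r)
      (l * q * r'))) f') f"

lemma linear_form_mult: assumes "lin f" shows "lin (\<lambda>x. f (x * y))" "lin (\<lambda>x. f (y * x))"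
  using assms by (auto simp: linear_form_def ring_distribs escale_mult)

lemma bilinear_form_lin: "bil \<beta> \<Longrightarrow> lin (\<lambda>x. \<beta> x y)" "bil \<beta> \<Longrightarrow> lin (\<beta> x)"
  by (auto simp: bilinear_form_def)

lemma balanced_inner: assumes "bil \<beta>" shows
    "balanced (\<lambda>c l' r'. arrow_form b c (\<lambda>p q. \<beta> (l' * p * r) (l * q * r')))"
proof -
  have "lin (\<lambda>x. \<beta> (x * p * r) y)" "lin (\<lambda>x. \<beta> y (l * p * x))" for p y
    by (rule linear_form_mult[where f="\<lambda>x. \<beta> (x * r) y"] linear_form_mult[where f="\<lambda>x. \<beta> x y"]
        linear_form_mult bilinear_form_lin assms)+
  moreover have "arrow_form b c (\<lambda>p q. \<beta> (l' * ee (src c) * p * r) (l * q * (ee (tgt c) * r')))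
      = arrow_form b c (\<lambda>p q. \<beta> (l' * p * r) (l * q * r'))" for c l' r'
    using arrow_form_right[of b c "\<lambda>p q. \<beta> (l' * p * r) (l * q * r')"] by (simp add: mult.assoc)
  ultimately show ?thesis by (auto simp: balanced_def bilinear_form_def intro: arrow_form_lin)
qed

lemma balanced_outer: assumes "bil \<beta>" shows
    "balanced (\<lambda>b l r. diff_pairing (\<lambda>c l' r'. arrow_form b c (\<lambda>p q. \<beta> (l' * p * r) (l * q * r'))) f)"
proof -
  have "lin (\<lambda>x. \<beta> y (x * q * r))" "lin (\<lambda>x. \<beta> (l * q * x) y)" for l r q y
    by (rule linear_form_mult[where f="\<lambda>x. \<beta> y (x * r)"] linear_form_mult[where f="\<lambda>x. \<beta> y x"]
        linear_form_mult[where f="\<lambda>x. \<beta> x y"] bilinear_form_lin assms)+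
  then have "lin (\<lambda>x. diff_pairing (\<lambda>c l' r'. arrow_form b c (\<lambda>p q. \<beta> (l' * p * r) (x * q * r'))) f)"
      "lin (\<lambda>x. diff_pairing (\<lambda>c l' r'. arrow_form b c (\<lambda>p q. \<beta> (l' * p * x) (l * q * r'))) f)" for b l r
    by (intro diff_pairing_lin[where \<Psi>="\<lambda>x c l' r'. arrow_form b c (\<lambda>p q. \<beta> (l' * p * r) (x * q * r'))"]
      diff_pairing_lin[where \<Psi>="\<lambda>x c l' r'. arrow_form b c (\<lambda>p q. \<beta> (l' * p * x)
          (l * q * r'))"] arrow_form_lin; simp)+
  moreover have "arrow_form b c (\<lambda>p q. \<beta> (l' * p * (ee (tgt b) * r)) (l * ee (src b) * q * r'))
      = arrow_form b c (\<lambda>p q. \<beta> (l' * p * r) (l * q * r'))" for b c l r l' r'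
    using arrow_form_left[of b c "\<lambda>p q. \<beta> (l' * p * r) (l * q * r')"] by (simp add: mult.assoc)
  ultimately show ?thesis by (simp add: balanced_def bilinear_form_def)
qed

lemma form_bracket_cong: assumes "bil \<beta>" "fin1 f" "fin1 f'" "rho f = rho f'"
  shows "form_bracket f k \<beta> = form_bracket f' k \<beta>" "form_bracket k f \<beta> = form_bracket k f' \<beta>"
  unfolding form_bracket_def using diff_pairing_cong[OF balanced_outer[OF assms(1)] assms(2-4)]
      diff_pairing_cong[OF balanced_inner[OF assms(1)] assms(2-4)]
  by simp_all

lemma form_bracket_anti: "form_bracket f f' \<beta> = - form_bracket f' f (\<lambda>p q. \<beta> q p)"
proof -
  have "form_bracket f f' \<beta> = diff_pairing (\<lambda>b l r. diff_pairing (\<lambda>c l' r'.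
      - arrow_form c b (\<lambda>p q. \<beta> (l' * q * r) (l * p * r'))) f') f"
    unfolding form_bracket_def by (subst arrow_form_anti) simp
  also have "\<dots> = - form_bracket f' f (\<lambda>p q. \<beta> q p)"
    unfolding form_bracket_def diff_pairing_uminus by (subst diff_pairing_commute) simp
  finally show ?thesis .
qed

lemma form_bracket_fmul: assumes "bil \<beta>" "fin1 f'" "fin1 f''"
  shows "form_bracket f (fmul f' f'') \<beta> = form_bracket f f' (\<lambda>p q. \<beta> p (q * rho f''))
      + form_bracket f f'' (\<lambda>p q. \<beta> (rho f' * p) q)"
  unfolding form_bracket_def diff_pairing_add[symmetric]
      using diff_pairing_fmul[OF balanced_inner[OF assms(1)] assms(2,3)] by (simp add: mult.assoc)

lemma form_bracket_fe: "form_bracket f (fe s) \<beta> = 0"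
    by (simp add: form_bracket_def diff_pairing_fe diff_pairing_zero)

lemma form_bracket_far: assumes "bil \<beta>" shows "form_bracket (far b) (far c) \<beta> = arrow_form b c \<beta>"
proof -
  have "form_bracket (far b) (far c) \<beta> = arrow_form b c (\<lambda>p q. \<beta> (ee (src c) * p * ee (tgt b)) (ee
      (src b) * q * ee (tgt c)))"
    unfolding form_bracket_def by (subst diff_pairing_far[OF balanced_outer[OF assms]], subst
        diff_pairing_far[OF balanced_inner[OF assms]]) simp
  also have "\<dots> = arrow_form b c \<beta>"
    using arrow_form_left[of b c "\<lambda>p q. \<beta> (ee (src c) * p) (q * ee (tgt c))"] arrow_form_right[of b c \<beta>]
        by (simp add: mult.assoc)
  finally show ?thesis .
qed

definition bracket_list where
  "bracket_list u v = concat (map (\<lambda>(k,l,b,r). concat (map (\<lambda>(k',l',c,r').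
     map (\<lambda>(k'',p,q). (k * k' * k'', (l' @ p @ r, l @ q @ r'))) (arrow_list b c)) (wdiff v))) (wdiff u))"

definition br :: "('v,'a) gen list \<Rightarrow> ('v,'a) gen list \<Rightarrow> ('v,'a) gen list \<times> ('v,'a) gen list \<Rightarrow> 'k" where
  "br u v = list_fun (bracket_list u v)"

lemma ev_br: "ev (br u v) (\<lambda>(p,q). \<beta> (rw p) (rw q)) =
   (\<Sum>(k,l,b,r)\<leftarrow>wdiff u. k * (\<Sum>(k',l',c,r')\<leftarrow>wdiff v. k' * arrow_form b c (\<lambda>p q. \<beta> (rw l' * p * rw r)
       (rw l * q * rw r'))))"
  by (simp add: br_def ev_list_fun bracket_list_def arrow_form_def split_def sum_list_concat_map o_def
      sum_list_const_mult[symmetric] rw_append mult.assoc)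

lemma fin_supp_brx: "fin1 f \<Longrightarrow> fin1 f' \<Longrightarrow> fin_supp (brx br f f')"
  unfolding brx_def fin1_def
  by (intro fin_supp_sum) (simp_all add: fin_supp_vscal[unfolded vscal_def] br_def fin_supp_list_fun mult.assoc)

lemma ev_brx: assumes "fin1 f" "fin1 f'"
  shows "ev (brx br f f') \<phi> = ev f (\<lambda>u. ev f' (\<lambda>v. ev (br u v) \<phi>))"
proof -
  have brx: "brx br f f' = (\<lambda>p. \<Sum>u\<in>{u. f u \<noteq> 0}. \<Sum>v\<in>{v. f' v \<noteq> 0}. vscal (f u * f' v) (br u v) p)"
    by (simp add: brx_def vscal_def)
  have "fin_supp (br u v)" for u v by (simp add: br_def fin_supp_list_fun)
  then show ?thesis using assms unfolding brx fin1_def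
    by (simp add: ev_sum fin_supp_sum fin_supp_vscal ev_vscal)
        (simp add: ev_def[of f] ev_def[of f'] sum_distrib_left mult.assoc)
qed

lemma ev_brx_form_bracket: assumes "fin1 f" "fin1 f'"
  shows "ev (brx br f f') (\<lambda>(p,q). \<beta> (rw p) (rw q)) = form_bracket f f' \<beta>"
  unfolding ev_brx[OF assms] ev_br form_bracket_def diff_pairing_def
  by (simp add: split_def ev_sum_list ev_mult)

section \<open>The bracket on the quotient\<close>

definition quot_alg where "quot_alg = rho ` {f. fin1 f}"
text \<open>On \<open>rho f\<close> this is the retraction of \<open>f\<close>: a choice of
  representatives that is linear on all endomorphisms, which makes \<open>quot_bracket\<close>
  linear in each argument.\<close>

definition lift where "lift x = coef (app x (1 :: (('v,'a) gen,'k) falg))"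
definition quot_bracket where "quot_bracket x y \<beta> = form_bracket (lift x) (lift y) \<beta>"

lemma fin1_lift: "fin1 (lift x)" by (simp add: lift_def fin1_coef)

lemma rho_lift: "fin1 f \<Longrightarrow> rho (lift (rho f)) = rho f"
proof -
  assume f: "fin1 f"
  have "vsub f (lift (rho f)) \<in> J"
    using retr(3)[of "Falg f"] f by (simp add: lift_def app_rho coef_simps Falg_inverse)
  then show ?thesis using f by (simp add: rho_eq_0[symmetric] rho_simps fin1_simps fin1_lift)
qed

lemma quot_bracket_rho: "bil \<beta> \<Longrightarrow> fin1 f \<Longrightarrow> fin1 f' \<Longrightarrow> quot_bracket (rho f) (rho f') \<beta> = form_bracket f f' \<beta>"
  unfolding quot_bracket_def using form_bracket_cong[of \<beta> "lift (rho f)" f] form_bracket_cong[of \<beta>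
      "lift (rho f')" f']
  by (simp add: fin1_lift rho_lift)

lemma lift_simps: "lift (x + y) = vadd (lift x) (lift y)" "lift (escale c x) = vscal c (lift x)"
  by (simp_all add: lift_def app_simps coef_simps)

lemma quot_alg_induct:
  assumes x: "x \<in> quot_alg" and P: "\<And>s. P (ee s)" "\<And>b. P (aa b)" "\<And>b. P (ii b)"
    and add: "\<And>x y. x \<in> quot_alg \<Longrightarrow> y \<in> quot_alg \<Longrightarrow> P x \<Longrightarrow> P y \<Longrightarrow> P (x + y)"
    and mult: "\<And>x y. x \<in> quot_alg \<Longrightarrow> y \<in> quot_alg \<Longrightarrow> P x \<Longrightarrow> P y \<Longrightarrow> P (x * y)"
    and scl: "\<And>k x. x \<in> quot_alg \<Longrightarrow> P x \<Longrightarrow> P (escale k x)"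
  shows "P x"
proof -
  have mem: "fin1 f \<Longrightarrow> rho f \<in> quot_alg" for f by (simp add: quot_alg_def)
  have P0: "P 0" using scl[of "ee undefined" 0] P(1) mem[of "fe undefined"] by (simp add: escale_0 ee_def fin)
  \<comment> \<open>The empty word acts as the unit of the quotient, for which the induction has no
    case of its own. It is reached as the sum of the idempotents.\<close>
  have "P (\<Sum>s\<in>S. ee s) \<and> (\<Sum>s\<in>S. ee s) \<in> quot_alg" if "finite S" for S
    using that
  proof (induction S rule: finite_induct)
    case empty show ?case using P0 mem[of vzero] by (simp add: rho_vzero fin)
  next
    case (insert s S)
    have "ee s \<in> quot_alg" unfolding ee_def by (rule mem) (simp add: fin)
    moreover from insert obtain f where f: "(\<Sum>s\<in>S. ee s) = rho f" "fin1 f" by (auto simp: quot_alg_def)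
    moreover have "rho (vadd (fe s) f) \<in> quot_alg" by (rule mem) (simp add: fin f)
    ultimately show ?case using insert add[of "ee s" "rho f"] P(1)[of s] by (simp add: rho_gens fin mem)
  qed
  from this[of UNIV] have "P (rw [])" by (simp add: ee_sum rw_Nil)
  then have Pw: "P (rw w)" for w
  proof (induction w)
    case (Cons x w)
    have "P (rw [x])" by (cases x) (simp_all add: rw_single P)
    then have "P (rw [x] * rw w)" using Cons by (intro mult mem) (simp_all add: fin)
    then show ?case using rw_append[of "[x]" w] by simp
  qed
  obtain f where f: "fin1 f" "x = rho f" using x by (auto simp: quot_alg_def)
  have "P (rho f)" using f(1) unfolding fin1_def
  proof (induction rule: fin_supp_induct)
    case (step d c w)
    have w: "fin1 (mn w)" "fin1 (vscal c (mn w))" by (simp_all add: fin)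
    have "escale c (rw w) \<in> quot_alg" using mem[OF w(2)] by (simp add: rho_simps(4)[OF w(1)])
    then have "P (rho d + escale c (rw w))"
      using step by (intro add scl Pw mem w) (simp_all add: fin1_def)
    then show ?case using step by (simp add: single_monom rho_simps fin fin1_def fin_supp_vscal fin_supp_monom)
  qed (simp add: rho_vzero P0)
  then show ?thesis using f by simp
qed

sublocale bracket_algebra escale src tgt "dgam g" os deps ee aa ii quot_alg quot_bracket
proof
  have mem: "fin1 f \<Longrightarrow> rho f \<in> quot_alg" for f by (simp add: quot_alg_def)
  show "ee s \<in> quot_alg" "aa b \<in> quot_alg" "ii b \<in> quot_alg" for s b
    unfolding ee_def aa_def ii_def by (rule mem, simp add: fin)+
  show "x + y \<in> quot_alg" "x * y \<in> quot_alg" if "x \<in> quot_alg" "y \<in> quot_alg" for x y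
    using that by (auto simp: quot_alg_def rho_simps[symmetric] fin)
  show "escale k x \<in> quot_alg" if "x \<in> quot_alg" for x k
    using that by (auto simp: quot_alg_def rho_simps[symmetric] fin)
  show "\<exists>xs. (\<forall>(k,p,q)\<in>set xs. p \<in> quot_alg \<and> q \<in> quot_alg) \<and> (\<forall>\<beta>. quot_bracket x y \<beta>
      = (\<Sum>(k,p,q)\<leftarrow>xs. k * \<beta> p q))" for x y
  proof -
    \<comment> \<open>The support of the bracket of two representatives is the finite tensor
      demanded by \<open>br_rep\<close>.\<close>
    let ?d = "brx br (lift x) (lift y)"
    obtain zs where zs: "set zs = {z. ?d z \<noteq> 0}" "distinct zs"
      using finite_distinct_list[OF fin_supp_brx[OF fin1_lift fin1_lift, of x y]] by blast
    have "quot_bracket x y \<beta> = (\<Sum>(k,p,q)\<leftarrow>map (\<lambda>(p,q). (?d (p,q), rw p, rw q)) zs. k * \<beta> p q)" for \<beta>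
      unfolding quot_bracket_def ev_brx_form_bracket[OF fin1_lift fin1_lift, symmetric]
      using zs by (simp add: ev_def split_def o_def sum_list_distinct_conv_sum_set)
    then show ?thesis by (intro exI[of _ "map (\<lambda>(p,q). (?d (p,q), rw p, rw q)) zs"]) (auto simp: mem fin)
  qed
  show "lin (\<lambda>y. quot_bracket x y \<beta>)" for x \<beta>
    by (simp add: linear_form_def quot_bracket_def lift_simps form_bracket_def diff_pairing_simps fin1_lift
        diff_pairing_add diff_pairing_mult)
  show "quot_bracket x y \<beta> = - quot_bracket y x (\<lambda>p q. \<beta> q p)" for x y \<beta>
    unfolding quot_bracket_def by (rule form_bracket_anti)
  show "quot_bracket x (y * z) \<beta> = quot_bracket x y (\<lambda>p q. \<beta> p (q * z)) + quot_bracket x z (\<lambda>p q. \<beta> (y * p) q)"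
    if \<beta>: "bil \<beta>" and A: "x \<in> quot_alg" "y \<in> quot_alg" "z \<in> quot_alg" for x y z \<beta>
  proof -
    obtain f f' f'' where f: "x = rho f" "y = rho f'" "z = rho f''" "fin1 f" "fin1 f'" "fin1 f''"
      using A by (auto simp: quot_alg_def)
    have "bil (\<lambda>p q. \<beta> p (q * z))" "bil (\<lambda>p q. \<beta> (y * p) q)"
      using \<beta> by (auto simp: bilinear_form_def linear_form_def ring_distribs escale_mult)
    then show ?thesis using f \<beta> form_bracket_fmul[OF \<beta> f(5,6), of f] quot_bracket_rho[OF \<beta>, of f "fmul f' f''"]
      by (simp add: quot_bracket_rho rho_simps fin)
  qed
  show "quot_bracket x (ee s) \<beta> = 0" if "bil \<beta>" "x \<in> quot_alg" for x s \<beta>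
    using that by (auto simp: quot_alg_def ee_def quot_bracket_rho fin form_bracket_fe)
  show "2 * quot_bracket (aa b) (aa c) \<beta> = ord_bracket b c \<beta> + edge_bracket b c \<beta>" if "bil \<beta>" for b c \<beta>
    using that by (simp add: aa_def quot_bracket_rho fin form_bracket_far arrow_form_eq)
qed (fact quot_alg_induct ii_left ii_right ee_ii ii_ee)+

end

section \<open>The quasi-Poisson property\<close>

lemma lmul2_simps: "lmul2 x vzero = (vzero :: _ \<Rightarrow> 'k::field)" "lmul2 x (vadd d d')
    = vadd (lmul2 x d) (lmul2 x (d' :: _ \<Rightarrow> 'k))"
  "lmul2 x (vscal c d) = vscal c (lmul2 x (d :: _ \<Rightarrow> 'k))" "lmul2 x (tens f g) = tens (fmul x f) (g :: _ \<Rightarrow> 'k)"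
  by (auto simp: lmul2_def vzero_def vadd_def vscal_def tens_def fmul_def ring_distribs sum.distrib
      sum_distrib_left sum_distrib_right mult_ac)

lemma rmul2_simps: "rmul2 vzero x = (vzero :: _ \<Rightarrow> 'k::field)" "rmul2 (vadd d d') x
    = vadd (rmul2 d x) (rmul2 (d' :: _ \<Rightarrow> 'k) x)"
  "rmul2 (vscal c d) x = vscal c (rmul2 (d :: _ \<Rightarrow> 'k) x)" "rmul2 (tens f g) x = tens f (fmul g (x :: _ \<Rightarrow> 'k))"
  by (auto simp: rmul2_def vzero_def vadd_def vscal_def tens_def fmul_def ring_distribs sum.distrib
      sum_distrib_left sum_distrib_right mult_ac)

lemma fin_supp_lmul2: "fin1 x \<Longrightarrow> fin_supp d \<Longrightarrow> fin_supp (lmul2 x (d :: _ \<Rightarrow> 'k::field))"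
proof -
  assume x: "fin1 x"
  assume "fin_supp d" then show ?thesis
  proof (induction rule: fin_supp_induct)
    case (step d c pq)
    then show ?case using x
      by (cases pq) (simp add: single_pair lmul2_simps fin_supp_vadd fin_supp_vscal fin_supp_tens fin_supp_fmul
          fin_supp_monom fin1_def)
  qed (simp add: lmul2_simps fin_supp_vzero)
qed

lemma fin_supp_rmul2: "fin1 x \<Longrightarrow> fin_supp d \<Longrightarrow> fin_supp (rmul2 d (x :: _ \<Rightarrow> 'k::field))"
proof -
  assume x: "fin1 x"
  assume "fin_supp d" then show ?thesis
  proof (induction rule: fin_supp_induct)
    case (step d c pq)
    then show ?case using x
      by (cases pq) (simp add: single_pair rmul2_simps fin_supp_vadd fin_supp_vscal fin_supp_tens fin_supp_fmul
          fin_supp_monom fin1_def)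
  qed (simp add: rmul2_simps fin_supp_vzero)
qed

lemma sw_simps: "sw vzero = (vzero :: _ \<Rightarrow> 'k::field)" "sw (vadd d d') = vadd (sw d) (sw (d' :: _ \<Rightarrow> 'k))"
  "sw (vscal c d) = vscal c (sw (d :: _ \<Rightarrow> 'k))" "sw (tens f g) = tens g (f :: _ \<Rightarrow> 'k)"
  by (auto simp: sw_def vzero_def vadd_def vscal_def tens_def)

lemma fin_supp_sw: "fin_supp d \<Longrightarrow> fin_supp (sw (d :: _ \<Rightarrow> 'k::field))"
proof (induction rule: fin_supp_induct)
  case (step d c pq)
  then show ?case by (cases pq) (simp add: single_pair sw_simps fin_supp_vadd fin_supp_vscal fin_supp_tens
      fin_supp_monom)
qed (simp add: sw_simps fin_supp_vzero)

lemma ev_sw: "fin_supp d \<Longrightarrow> ev (sw (d :: _ \<Rightarrow> 'k::field)) \<phi> = ev d (\<lambda>(p,q). \<phi> (q,p))"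
proof (induction rule: fin_supp_induct)
  case (step d c pq)
  then show ?case by (cases pq) (simp add: single_pair sw_simps ev_vadd ev_vscal fin_supp_sw fin_supp_vscal
      fin_supp_tens fin_supp_monom ev_tens ev_monom)
qed (simp add: sw_simps ev_vzero)

lemma tau_simps: "tau vzero = (vzero :: _ \<Rightarrow> 'k::field)" "tau (vadd d d') = vadd (tau d) (tau (d' :: _ \<Rightarrow> 'k))"
  "tau (vscal c d) = vscal c (tau (d :: _ \<Rightarrow> 'k))" "tau (tens3 f g h) = tens3 h f (g :: _ \<Rightarrow> 'k)"
  by (auto simp: tau_def vzero_def vadd_def vscal_def tens3_def)

lemma fin_supp_tau: "fin_supp d \<Longrightarrow> fin_supp (tau (d :: _ \<Rightarrow> 'k::field))"
proof (induction rule: fin_supp_induct)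
  case (step d c pq)
  then show ?case by (cases pq) (simp add: single_triple tau_simps fin_supp_vadd fin_supp_vscal fin_supp_tens3
      fin_supp_monom)
qed (simp add: tau_simps fin_supp_vzero)

lemma ev_tau: "fin_supp d \<Longrightarrow> ev (tau (d :: _ \<Rightarrow> 'k::field)) \<phi> = ev d (\<lambda>(p,q,r). \<phi> (r,p,q))"
proof (induction rule: fin_supp_induct)
  case (step d c pq)
  then show ?case by (cases pq) (simp add: single_triple tau_simps ev_vadd ev_vscal fin_supp_tau fin_supp_vscal
      fin_supp_tens3 fin_supp_monom ev_tens3 ev_monom)
qed (simp add: tau_simps ev_vzero)

context ordered_quiver begin

section \<open>Evaluating forms on representatives\<close>

definition eval2 where "eval2 \<beta> d = ev d (\<lambda>(p,q). \<beta> (rw p) (rw q))"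
definition eval3 where "eval3 f d = ev d (\<lambda>(p,q,r). f (rw p) (rw q) (rw r))"

lemma eval2_simps:
  "fin_supp d \<Longrightarrow> fin_supp d' \<Longrightarrow> eval2 \<beta> (vadd d d') = eval2 \<beta> d + eval2 \<beta> d'" "fin_supp d \<Longrightarrow> fin_supp d'
      \<Longrightarrow> eval2 \<beta> (vsub d d') = eval2 \<beta> d - eval2 \<beta> d'"
  "fin_supp d \<Longrightarrow> eval2 \<beta> (vscal c d) = c * eval2 \<beta> d" "fin_supp d \<Longrightarrow> eval2 \<beta> (vneg d) =
      - eval2 \<beta> d" "eval2 \<beta> vzero = 0"
  "fin_supp d \<Longrightarrow> eval2 \<beta> (sw d) = eval2 (\<lambda>p q. \<beta> q p) d"
  by (simp_all add: eval2_def ev_vadd ev_vsub ev_vscal ev_vneg ev_vzero ev_sw split_def)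

lemma eval2_tens: "bil \<beta> \<Longrightarrow> fin1 x \<Longrightarrow> fin1 y \<Longrightarrow> eval2 \<beta> (tens x y) = \<beta> (rho x) (rho y)"
proof -
  assume \<beta>: "bil \<beta>" and x: "fin1 x" "fin1 y"
  have lin: "lin (\<beta> a)" "lin (\<lambda>a. \<beta> a b)" for a b using \<beta> by (auto simp: bilinear_form_def)
  show ?thesis unfolding eval2_def using x
    by (simp add: ev_tens fin1_def[symmetric] ev_rho[OF _ lin(1)] ev_rho[OF _ lin(2)])
qed

lemma eval3_tens: "tril f \<Longrightarrow> fin1 x \<Longrightarrow> fin1 y \<Longrightarrow> fin1 z \<Longrightarrow> eval3 f (tens3 x y z) = f (rho x) (rho y) (rho z)"
proof -
  assume f: "tril f" and x: "fin1 x" "fin1 y" "fin1 z"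
  have lin: "lin (f a b)" "lin (\<lambda>b. f a b c)" "lin (\<lambda>a. f a b c)" for a b c
    using f by (auto simp: trilinear_form_def)
  show ?thesis unfolding eval3_def using x
    by (simp add: ev_tens3 fin1_def[symmetric] ev_rho[OF _ lin(1)] ev_rho[OF _ lin(2)] ev_rho[OF _ lin(3)])
qed

lemma eval2_lmul2: "fin1 x \<Longrightarrow> bil \<beta> \<Longrightarrow> fin_supp d \<Longrightarrow> eval2 \<beta> (lmul2 x d) = eval2 (\<lambda>p q. \<beta> (rho x * p) q) d"
proof -
  assume x: "fin1 x" and \<beta>: "bil \<beta>"
  assume "fin_supp d" then show ?thesis
  proof (induction rule: fin_supp_induct)
    case (step d c pq)
    then show ?case using x bil_mult(1)[OF \<beta>] \<beta>
      by (cases pq) (simp add: single_pair lmul2_simps eval2_simps eval2_tens fin_supp_lmul2 fin_supp_vscal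
          fin_supp_tens fin_supp_fmul fin_supp_monom fin1_def[symmetric] fin rho_simps)
  qed (simp add: lmul2_simps eval2_simps)
qed

lemma eval2_rmul2: "fin1 x \<Longrightarrow> bil \<beta> \<Longrightarrow> fin_supp d \<Longrightarrow> eval2 \<beta> (rmul2 d x) = eval2 (\<lambda>p q. \<beta> p (q * rho x)) d"
proof -
  assume x: "fin1 x" and \<beta>: "bil \<beta>"
  assume "fin_supp d" then show ?thesis
  proof (induction rule: fin_supp_induct)
    case (step d c pq)
    then show ?case using x bil_mult(4)[OF \<beta>] \<beta>
      by (cases pq) (simp add: single_pair rmul2_simps eval2_simps eval2_tens fin_supp_rmul2 fin_supp_vscal
          fin_supp_tens fin_supp_fmul fin_supp_monom fin1_def[symmetric] fin rho_simps)
  qed (simp add: rmul2_simps eval2_simps)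
qed

lemma eval2_brx: "fin1 f \<Longrightarrow> fin1 f' \<Longrightarrow> eval2 \<beta> (brx br f f') = form_bracket f f' \<beta>"
  unfolding eval2_def by (rule ev_brx_form_bracket)

lemma eqA2I: assumes "fin_supp d" "fin_supp d'" "\<And>\<beta>. bil \<beta> \<Longrightarrow> eval2 \<beta> d = eval2 \<beta> d'" shows "eqA2 t h g d d'"
  unfolding eqA2_def by (rule separation2) (use assms in \<open>simp_all add: fin_supp_vsub eval2_def[symmetric]
      eval2_simps\<close>)

lemma eqA3I: assumes "fin_supp d" "fin_supp d'" "\<And>f. tril f \<Longrightarrow> eval3 f d = eval3 f d'" shows "eqA3 t h g d d'"
  unfolding eqA3_def by (rule separation3) (use assms in \<open>simp_all add: fin_supp_vsub ev_vsub eval3_def\<close>)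

lemma eqA_iff: "fin1 f \<Longrightarrow> fin1 f' \<Longrightarrow> eqA t h g f f' \<longleftrightarrow> rho f = rho f'"
  unfolding eqA_def by (simp add: rho_eq_0[symmetric] rho_simps fin)

lemma form_bracket_vzero: "form_bracket vzero f \<beta> = 0" "form_bracket f vzero \<beta> = 0"
  by (simp_all add: form_bracket_def diff_pairing_simps diff_pairing_zero)

lemma br_is_dbracket: "is_dbracket t h g br"
  unfolding is_dbracket_def
proof (intro conjI allI impI; (elim conjE)?)
  show "fin2 (br u v)" for u v by (simp add: fin2_def br_def fin_supp_list_fun)
next
  fix f f' :: "('v,'a) gen list \<Rightarrow> 'k" assume f: "fin1 f" "fin1 f'" "f \<in> J"
  then have "rho f = rho vzero" by (simp add: rho_vzero rho_eq_0)
  then have 0: "form_bracket f f' \<beta> = 0" "form_bracket f' f \<beta> = 0" if "bil \<beta>" for \<beta>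
    using form_bracket_cong[OF that f(1), of vzero f'] by (simp_all add: fin form_bracket_vzero)
  show "brx br f f' \<in> fideal2 J" "brx br f' f \<in> fideal2 J"
    by (rule separation2; use f 0 in \<open>simp add: fin_supp_brx ev_brx_form_bracket\<close>)+
next
  fix s and f :: "('v,'a) gen list \<Rightarrow> 'k" assume f: "fin1 f"
  show "eqA2 t h g (brx br (fe s) f) vzero" "eqA2 t h g (brx br f (fe s)) vzero"
    by (rule eqA2I; use f in \<open>simp add: fin_supp_brx fin_supp_vzero fin eval2_brx eval2_simps form_bracket_fe
        form_bracket_anti[of "fe s"]\<close>)+
next
  fix f f' :: "('v,'a) gen list \<Rightarrow> 'k" assume f: "fin1 f" "fin1 f'"
  show "eqA2 t h g (brx br f f') (vneg (sw (brx br f' f)))"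
    by (rule eqA2I; use f form_bracket_anti[of f f'] in \<open>simp add: fin_supp_brx fin_supp_vneg fin_supp_sw
        eval2_brx eval2_simps\<close>)
next
  fix f x y :: "('v,'a) gen list \<Rightarrow> 'k" assume f: "fin1 f" "fin1 x" "fin1 y"
  show "eqA2 t h g (brx br f (fmul x y)) (vadd (rmul2 (brx br f x) y) (lmul2 x (brx br f y)))"
    by (rule eqA2I; use f in \<open>simp add: fin_supp_brx fin_supp_vadd fin_supp_lmul2 fin_supp_rmul2 fin eval2_brx
        eval2_simps eval2_lmul2 eval2_rmul2 form_bracket_fmul\<close>)
qed

text \<open>The summation range in \<open>trip_aux\<close> varies with the third word. Adding one
  basis tensor at a time yields the induction step by which finiteness and evaluation pass from
  \<open>brx\<close> to \<open>trip_aux\<close>.\<close>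

lemma trip_aux_simps:
  "trip_aux br x (vzero :: _ \<Rightarrow> 'k) = vzero"
  "fin_supp d \<Longrightarrow> trip_aux br x (vadd d (vscal c (\<lambda>y. if y = (p, q) then 1 else 0))) =
    vadd (trip_aux br x d) (vscal c (\<lambda>(y1,y2,y3). brx br x (monom p) (y1,y2) * monom q y3))"
proof -
  show "trip_aux br x (vzero :: _ \<Rightarrow> 'k) = vzero" by (auto simp: trip_aux_def vzero_def)
  assume d: "fin_supp d"
  have aux: "trip_aux br x d (y1,y2,y3) = ev (\<lambda>u. d (u, y3)) (\<lambda>u. brx br x (monom u) (y1,y2))" for d y1 y2 y3
    by (simp add: trip_aux_def ev_def)
  have slice: "fin_supp (\<lambda>u. d (u, y3))" for y3
    using finite_vimageI[OF d, of "\<lambda>u. (u, y3)"] by (simp add: vimage_def inj_on_def)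
  have "(\<lambda>u. vadd d (vscal c (\<lambda>y. if y = (p, q) then 1 else 0)) (u, y3))
      = vadd (\<lambda>u. d (u, y3)) (vscal (c * monom q y3) (monom p))" for y3
    by (auto simp: vadd_def vscal_def monom_def)
  then show "trip_aux br x (vadd d (vscal c (\<lambda>y. if y = (p, q) then 1 else 0))) =
    vadd (trip_aux br x d) (vscal c (\<lambda>(y1,y2,y3). brx br x (monom p) (y1,y2) * monom q y3))"
    by (intro ext) (auto simp: aux ev_vadd ev_vscal slice fin_supp_vscal fin_supp_monom ev_monom, auto simp:
        vadd_def vscal_def aux)
qed

lemma fin_supp_append3: "fin_supp (d :: _ \<Rightarrow> 'k) \<Longrightarrow> fin_supp (\<lambda>(y1,y2,y3). d (y1,y2) * monom q y3)"
  by (rule finite_subset[of _ "(\<lambda>(y1,y2). (y1,y2,q)) ` {z. d z \<noteq> 0}"])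
      (auto simp: monom_def image_iff split: if_splits)

lemma eval3_append3: "fin_supp (d :: _ \<Rightarrow> 'k) \<Longrightarrow> eval3 f (\<lambda>(y1,y2,y3). d (y1,y2) * monom q y3)
    = eval2 (\<lambda>x y. f x y (rw q)) d"
  unfolding eval3_def eval2_def
  by (subst ev_superset[of "(\<lambda>(y1,y2). (y1,y2,q)) ` {z. d z \<noteq> 0}"])
    (auto simp: monom_def image_iff ev_def sum.reindex inj_on_def split_def split: if_splits)

lemma fin_supp_trip_aux: "fin1 x \<Longrightarrow> fin_supp d \<Longrightarrow> fin_supp (trip_aux br x d)"
proof -
  assume x: "fin1 x"
  assume "fin_supp d" then show ?thesis
  proof (induction rule: fin_supp_induct)
    case (step d c pq)
    then show ?case using x
      by (cases pq) (simp add: trip_aux_simps fin_supp_vadd fin_supp_vscal fin_supp_append3 fin_supp_brx fin)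
  qed (simp add: trip_aux_simps fin_supp_vzero)
qed

lemma eval3_trip_aux: "fin1 x \<Longrightarrow> fin_supp d \<Longrightarrow> eval3 f (trip_aux br x d)
    = ev d (\<lambda>(u,v). form_bracket x (monom u) (\<lambda>p q. f p q (rw v)))"
proof -
  assume x: "fin1 x"
  assume "fin_supp d" then show ?thesis
  proof (induction rule: fin_supp_induct)
    case (step d c pq)
    have eval3: "eval3 f (vadd d (vscal c d')) = eval3 f d
        + c * eval3 f d'" if "fin_supp d" "fin_supp d'" for d d'
      using that by (simp add: eval3_def ev_vadd ev_vscal fin_supp_vscal)
    obtain p q where pq: "pq = (p, q)" by (cases pq)
    show ?case using x step
      by (simp add: pq trip_aux_simps eval3 fin_supp_trip_aux fin_supp_append3 fin_supp_brx fin eval3_append3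
          eval2_brx ev_vadd ev_vscal fin_supp_vscal)
        (simp add: ev_def)
  qed (simp add: trip_aux_simps eval3_def ev_vzero)
qed

lemma eval3_trip_nested: assumes f: "tril f" and fin1: "fin1 a" "fin1 b" "fin1 c"
  shows "eval3 f (trip_aux br a (brx br b c)) = nested_bracket (rho a) (rho b) (rho c) f"
proof -
  have "form_bracket a (mn u) (\<lambda>p q. f p q (rw v)) = quot_bracket (rho a) (rw u) (\<lambda>p q. f p q (rw v))" for u v
    by (simp add: quot_bracket_rho tril_bil f fin1 fin)
  then have "eval3 f (trip_aux br a (brx br b c)) = eval2 (\<lambda>u v. quot_bracket (rho a) u (\<lambda>p q. f p q v))
      (brx br b c)"
    by (simp add: eval3_trip_aux fin1 fin_supp_brx eval2_def)
  then show ?thesis using fin1 by (simp add: eval2_brx nested_bracket_def quot_bracket_rho nested_bracket_bil f)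
qed

lemma eval3_tau: "fin_supp d \<Longrightarrow> eval3 f (tau d) = eval3 (\<lambda>p q v. f v p q) d"
  unfolding eval3_def by (simp add: ev_tau split_def)

lemma eval3_trip: assumes f: "tril f" and fin1: "fin1 a" "fin1 b" "fin1 c"
  shows "eval3 f (trip br a b c) = triple_bracket (rho a) (rho b) (rho c) f" "fin_supp (trip br a b c)"
proof -
  have fin_supp: "fin_supp (trip_aux br x (brx br y z))" if "fin1 x" "fin1 y" "fin1 z" for x y z
    using that by (simp add: fin_supp_trip_aux fin_supp_brx)
  have eval3: "eval3 f (vadd d d') = eval3 f d + eval3 f d'" if "fin_supp d" "fin_supp d'" for d d'
    using that by (simp add: eval3_def ev_vadd)
  show "eval3 f (trip br a b c) = triple_bracket (rho a) (rho b) (rho c) f"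
    using fin1 by (simp add: trip_def eval3 fin_supp fin_supp_tau fin_supp_vadd eval3_tau eval3_trip_nested f
        tril_perm[OF f] triple_bracket_def)
  show "fin_supp (trip br a b c)" using fin1 by (simp add: trip_def fin_supp fin_supp_tau fin_supp_vadd)
qed

lemma eval3_qp: assumes f: "tril f" and fin1: "fin1 a" "fin1 b" "fin1 c"
  shows "eval3 f (qp_rhs a b c) = qp_form (rho a) (rho b) (rho c) f" "fin_supp (qp_rhs a b c)"
proof -
  define q where "q s = (vsub (vadd (vadd (vsub (vadd (vsub (vsub (tens3 (fmul (fmul c (fe s)) a) (fmul
      (fe s) b) (fe s))
      (tens3 (fmul (fmul c (fe s)) a) (fe s) (fmul b (fe s))))
      (tens3 (fmul c (fe s)) (fmul (fmul a (fe s)) b) (fe s)))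
      (tens3 (fmul c (fe s)) (fmul a (fe s)) (fmul b (fe s))))
      (tens3 (fmul (fe s) a) (fmul (fe s) b) (fmul (fe s) c)))
      (tens3 (fmul (fe s) a) (fe s) (fmul (fmul b (fe s)) c)))
      (tens3 (fe s) (fmul (fmul a (fe s)) b) (fmul (fe s) c)))
      (tens3 (fe s) (fmul a (fe s)) (fmul (fmul b (fe s)) c)) :: _ \<Rightarrow> 'k)" for s
  have eq: "qp_rhs a b c = vscal (1/4) (\<lambda>p. \<Sum>s\<in>UNIV. q s p)"
    by (simp add: qp_rhs_def q_def vscal_def vadd_def vsub_def)
  have fs3: "fin_supp (tens3 x y z)" if "fin1 x" "fin1 y" "fin1 z" for x y z :: "('v,'a) gen list \<Rightarrow> 'k"
    using that by (simp add: fin1_def fin_supp_tens3)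
  have fin_supp: "fin_supp (q s)" for s unfolding q_def
    by (intro fin_supp_vadd fin_supp_vsub fs3; simp add: fin fin1)
  have eval3: "eval3 f (vadd d d') = eval3 f d + eval3 f d'" "eval3 f (vsub d d') = eval3 f d
      - eval3 f d'" if "fin_supp d" "fin_supp d'" for d d'
    using that by (simp_all add: eval3_def ev_vadd ev_vsub)
  have "eval3 f (qp_rhs a b c) = 1/4 * (\<Sum>s\<in>UNIV. eval3 f (q s))"
    unfolding eq using fin_supp by (simp add: eval3_def ev_vscal fin_supp_sum ev_sum)
  also have "\<dots> = qp_form (rho a) (rho b) (rho c) f"
    unfolding qp_form_def q_def using fin1
    by (simp add: eval3 fs3 fin fin_supp_vadd fin_supp_vsub eval3_tens f rho_gens)
  finally show "eval3 f (qp_rhs a b c) = qp_form (rho a) (rho b) (rho c) f" .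
  show "fin_supp (qp_rhs a b c)" unfolding eq using fin_supp by (intro fin_supp_vscal fin_supp_sum) simp_all
qed

lemma trilinear_form_zero: "tril (\<lambda>p q r. 0)" by (simp add: trilinear_form_def linear_form_def)

lemma br_is_qPoisson: "is_qPoisson t h g br"
  unfolding is_qPoisson_def
proof (intro conjI allI impI; (elim conjE)?)
  fix a b c :: "('v,'a) gen list \<Rightarrow> 'k" assume fin1: "fin1 a" "fin1 b" "fin1 c"
  have "rho a \<in> quot_alg" "rho b \<in> quot_alg" "rho c \<in> quot_alg" using fin1 by (simp_all add: quot_alg_def)
  then show "eqA3 t h g (trip br a b c) (qp_rhs a b c)"
    using eval3_trip(2)[OF trilinear_form_zero fin1] eval3_qp(2)[OF trilinear_form_zero fin1]
    by (intro eqA3I) (simp_all add: eval3_trip(1) eval3_qp(1) fin1 triple_bracket_eq_qp_form)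
qed (rule br_is_dbracket)

section \<open>The moment map\<close>

lemma ex_sorted: "finite S \<Longrightarrow> S \<subseteq> {b. src b = s} \<Longrightarrow> \<exists>xs. set xs = S \<and> sorted_wrt (lt s) xs"
proof (induction S rule: finite_induct)
  case (insert x S)
  then obtain xs where xs: "set xs = S" "sorted_wrt (lt s) xs" by auto
  let ?ys = "filter (\<lambda>y. lt s y x) xs @ x # filter (\<lambda>y. lt s x y) xs"
  have "lt s y x \<or> lt s x y" if "y \<in> S" for y
    using that insert.hyps(2) insert.prems lt_total[of x s y] by auto
  then have "set ?ys = insert x S" using xs(1) by auto
  moreover have "sorted_wrt (lt s) ?ys"
    using xs(2) lt_trans[of s _ x] by (auto simp: sorted_wrt_append sorted_wrt_filter)
  ultimately show ?case by blast
qed simp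

lemma sorted_unique: "sorted_wrt (lt s) xs \<Longrightarrow> sorted_wrt (lt s) ys \<Longrightarrow> set xs = set ys \<Longrightarrow> xs = ys"
proof (induction xs arbitrary: ys)
  case (Cons x xs)
  then obtain y ys' where ys: "ys = y # ys'" by (cases ys) auto
  have asym: "lt s a b \<Longrightarrow> \<not> lt s b a" for a b using lt_trans[of s a b a] lt_irrefl[of s a] by blast
  have "x = y"
  proof (rule ccontr)
    assume "x \<noteq> y"
    then have "x \<in> set ys'" "y \<in> set xs" using Cons.prems(3) ys by auto
    then show False using Cons.prems(1,2) ys asym[of x y] by auto
  qed
  moreover have "x \<notin> set xs" "y \<notin> set ys'" using Cons.prems(1,2) ys lt_irrefl[of s x] lt_irrefl[of s y] by auto
  ultimately have "set xs = set ys'" using Cons.prems(3) ys by auto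
  then show ?case using Cons ys \<open>x = y\<close> by auto
qed simp

lemma finite_darr: "finite (S :: 'a darr set)"
proof (rule finite_subset)
  show "S \<subseteq> Pos ` UNIV \<union> Star ` UNIV" by (metis UnCI darr.exhaust rangeI subsetI)
qed simp

lemma Tlist: "set (Tlist lt t h s) = {b. src b = s}" "sorted_wrt (lt s) (Tlist lt t h s)"
proof -
  obtain xs where xs: "set xs = {b. src b = s} \<and> sorted_wrt (lt s) xs"
    using ex_sorted[OF finite_darr, of "{b. src b = s}" s] by auto
  then have "set (Tlist lt t h s) = {b. src b = s} \<and> sorted_wrt (lt s) (Tlist lt t h s)"
    unfolding Tlist_def by (rule theI) (use xs sorted_unique in blast)
  then show "set (Tlist lt t h s) = {b. src b = s}" "sorted_wrt (lt s) (Tlist lt t h s)" by simp_all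
qed

lemma sorted_os: "sorted_wrt (lt s) bs \<Longrightarrow> set bs \<subseteq> {b. src b = s} \<Longrightarrow> sorted_wrt (\<lambda>b c. os b c = 1) bs
    \<and> distinct bs"
  using lt_irrefl[of s] by (induction bs) (auto simp: os_eq)

abbreviation "Ts s \<equiv> Tlist lt t h s"
abbreviation "Phs s \<equiv> Phis lt t h g s :: ('v,'a) gen list \<Rightarrow> 'k"

lemma rho_mfac: "rho (mfac t h g b) = mom_factor b" "fin1 (mfac t h g b :: ('v,'a) gen list \<Rightarrow> 'k)"
  by (cases b; simp add: mfac_def mom_factor_def loc_factor_def rho_locfac ii_def fin)+

lemma rho_Phis: "rho (Phs s) = mom_prod s (Ts s)" "fin1 (Phs s)"
proof -
  have "rho (foldr (\<lambda>b acc. fmul (mfac t h g b) acc) bs (fe s)) = mom_prod s bs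
      \<and> fin1 (foldr (\<lambda>b acc. fmul (mfac t h g b) acc) bs (fe s) :: ('v,'a) gen list \<Rightarrow> 'k)" for bs
    by (induction bs) (auto simp: mom_prod_def ee_def[symmetric] rho_mfac rho_simps fin)
  then show "rho (Phs s) = mom_prod s (Ts s)" "fin1 (Phs s)" by (simp_all add: Phis_def)
qed

definition inv_factor where "inv_factor b = (if deps b = (1::'k) then ii b else loc_factor b)"

lemma mom_factor_inv_factor: "mom_factor b * inv_factor b = ee (src b)" "inv_factor b * mom_factor b
    = ee (src b)" "ee (src b) * inv_factor b = inv_factor b" "inv_factor b \<in> quot_alg"
  using ii_left[of b] ii_right[of b] by (simp_all add: mom_factor_def inv_factor_def loc_factor_def[symmetric]
      ee_ii e_loc_factor A_loc_factor A_iv)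

text \<open>The condition \<open>ee s * y = y\<close> confines the inverse to the vertex
  \<open>s\<close>. Inverses at different vertices then annihilate the other moment maps and can be
  added up to an inverse of the whole sum.\<close>

lemma mom_prod_inverse:
  assumes "set bs \<subseteq> {b. src b = s}"
  shows "\<exists>y\<in>quot_alg. mom_prod s bs * y = ee s \<and> y * mom_prod s bs = ee s \<and> ee s * y = y"
  using assms
proof (induction bs)
  case Nil
  then show ?case by (intro bexI[of _ "ee s"]) (simp_all add: mom_prod_def ee_absorb A_e)
next
  case (Cons b bs)
  then obtain y where y: "y \<in> quot_alg" "mom_prod s bs * y = ee s" "y * mom_prod s bs = ee s" "ee s * y
      = y" by auto
  have s: "src b = s" and sub: "set bs \<subseteq> {b. src b = s}" using Cons.prems by auto
  note f = mom_factor_inv_factor[of b, unfolded s]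
  have "mom_factor b * mom_prod s bs * (y * inv_factor b)
      = mom_factor b * (mom_prod s bs * y) * inv_factor b" by (simp add: mult.assoc)
  also have "\<dots> = ee s" using y f mom_factor_e[of b] s by simp
  finally have 1: "mom_factor b * mom_prod s bs * (y * inv_factor b) = ee s" .
  have "y * inv_factor b * (mom_factor b * mom_prod s bs)
      = y * (inv_factor b * mom_factor b) * mom_prod s bs" by (simp add: mult.assoc)
  also have "\<dots> = ee s" using y f e_mom_prod[OF sub] by (simp add: mult.assoc)
  finally have 2: "y * inv_factor b * (mom_factor b * mom_prod s bs) = ee s" .
  show ?case
    by (rule bexI[of _ "y * inv_factor b"]) (use 1 2 y f in \<open>simp_all add: mom_prod_def A_mult
        mult.assoc[symmetric]\<close>)
qed

lemma moment_invertible: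
  "\<exists>\<psi>. fin1 \<psi> \<and> eqA t h g (fmul (\<lambda>w. \<Sum>s\<in>UNIV. Phs s w) \<psi>) fone \<and> eqA t h g (fmul \<psi> (\<lambda>w. \<Sum>s\<in>UNIV. Phs s w)) fone"
proof -
  have sub: "set (Ts s) \<subseteq> {b. src b = s}" for s using Tlist(1) by simp
  have "\<forall>s. \<exists>\<psi>. fin1 \<psi> \<and> rho (Phs s) * rho \<psi> = ee s \<and> rho \<psi> * rho (Phs s) = ee s \<and> ee s * rho \<psi> = rho \<psi>"
    using mom_prod_inverse[OF sub] unfolding rho_Phis quot_alg_def by blast
  then obtain \<psi> where \<psi>: "\<And>s. fin1 (\<psi> s)" "\<And>s. rho (Phs s) * rho (\<psi> s) = ee s" "\<And>s. rho (\<psi> s) * rho (Phs s)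
      = ee s"
    "\<And>s. ee s * rho (\<psi> s) = rho (\<psi> s)" by metis
  have P: "rho (Phs s) * ee s = rho (Phs s)" "ee s * rho (Phs s) = rho (Phs s)" for s
    by (simp_all add: rho_Phis mom_prod_e[OF sub] e_mom_prod[OF sub])
  have \<psi>e: "rho (\<psi> s) * ee s = rho (\<psi> s)" for s
  proof -
    have "rho (\<psi> s) * ee s = rho (\<psi> s) * rho (Phs s) * rho (\<psi> s)" by (simp only: \<psi>(2) mult.assoc)
    then show ?thesis by (simp only: \<psi>(3,4))
  qed
  have 0: "rho (Phs s) * rho (\<psi> s') = 0" "rho (\<psi> s) * rho (Phs s') = 0" if "s \<noteq> s'" for s s'
  proof -
    have ee: "ee s * ee s' = 0" using that by (simp add: ee_ee kron_def escale_0)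
    have "rho (Phs s) * rho (\<psi> s') = rho (Phs s) * (ee s * ee s') * rho (\<psi> s')"
      by (simp add: mult.assoc \<psi>(4)) (simp add: mult.assoc[symmetric] P)
    then show "rho (Phs s) * rho (\<psi> s') = 0" by (simp add: ee)
    have "rho (\<psi> s) * rho (Phs s') = rho (\<psi> s) * (ee s * ee s') * rho (Phs s')"
      by (simp add: mult.assoc P) (simp add: mult.assoc[symmetric] \<psi>e)
    then show "rho (\<psi> s) * rho (Phs s') = 0" by (simp add: ee)
  qed
  have "(\<Sum>s\<in>UNIV. rho (Phs s)) * (\<Sum>s\<in>UNIV. rho (\<psi> s)) = (\<Sum>s\<in>UNIV. \<Sum>s'\<in>UNIV. if s = s' then ee s else 0)"
    unfolding sum_product by (intro sum.cong) (auto simp: 0 \<psi>)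
  then have 1: "(\<Sum>s\<in>UNIV. rho (Phs s)) * (\<Sum>s\<in>UNIV. rho (\<psi> s)) = rho fone" by (simp add: ee_sum)
  have "(\<Sum>s\<in>UNIV. rho (\<psi> s)) * (\<Sum>s\<in>UNIV. rho (Phs s)) = (\<Sum>s\<in>UNIV. \<Sum>s'\<in>UNIV. if s = s' then ee s else 0)"
    unfolding sum_product by (intro sum.cong) (auto simp: 0 \<psi>)
  then have 2: "(\<Sum>s\<in>UNIV. rho (\<psi> s)) * (\<Sum>s\<in>UNIV. rho (Phs s)) = rho fone" by (simp add: ee_sum)
  show ?thesis
    by (rule exI[of _ "\<lambda>w. \<Sum>s\<in>UNIV. \<psi> s w"])
      (use 1 2 in \<open>simp add: eqA_iff fin fin1_sum \<psi>(1) rho_Phis(2) rho_simps rho_sum\<close>)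
qed

lemma fin_supp_tens_fin1: "fin1 x \<Longrightarrow> fin1 y \<Longrightarrow> fin_supp (tens x (y :: ('v,'a) gen list \<Rightarrow> 'k))"
  by (simp add: fin1_def fin_supp_tens)

lemmas fins = fin_supp_brx fin_supp_vadd fin_supp_vsub fin_supp_vscal fin_supp_tens_fin1 fin

lemma br_is_qHam: "is_qHam t h g br (Phis lt t h g)"
  unfolding is_qHam_def
proof (intro conjI allI impI; (elim conjE)?)
  have sub: "set (Ts s) \<subseteq> {b. src b = s}" for s using Tlist(1) by simp
  show "eqA t h g (Phs s) (fmul (fmul (fe s) (Phs s)) (fe s))" for s
    by (simp add: eqA_iff fin rho_Phis rho_gens mom_prod_e[OF sub] e_mom_prod[OF sub])
  fix s and f :: "('v,'a) gen list \<Rightarrow> 'k" assume f: "fin1 f"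
  have "2 * form_bracket (Phs s) f \<beta> = \<beta> (rho f * ee s) (rho (Phs s)) - \<beta> (ee s) (rho (Phs s) * rho f)
      + (\<beta> (rho f * rho (Phs s)) (ee s) - \<beta> (rho (Phs s)) (ee s * rho f))" if "bil \<beta>" for \<beta>
    using moment_map[OF Tlist(1), of s \<beta>
        "rho f"] sorted_os[OF Tlist(2) sub, of s] that f quot_bracket_rho[OF that rho_Phis(2) f]
    by (simp add: quot_alg_def rho_Phis)
  then have "form_bracket (Phs s) f \<beta> = (1/2) * (\<beta> (rho f * ee s) (rho (Phs s)) - \<beta> (ee s) (rho (Phs s) * rho f)
      + (\<beta> (rho f * rho (Phs s)) (ee s) - \<beta> (rho (Phs s)) (ee s * rho f)))" if "bil \<beta>" for \<beta>
    using that by (simp add: field_simps)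
  then show "eqA2 t h g (brx br (Phs s) f)
      (vscal (1/2) (vadd (vsub (tens (fmul f (fe s)) (Phs s)) (tens (fe s) (fmul (Phs s) f)))
        (vsub (tens (fmul f (Phs s)) (fe s)) (tens (Phs s) (fmul (fe s) f)))))"
    by (intro eqA2I) (simp_all add: fins f rho_Phis(2) eval2_simps eval2_tens eval2_brx rho_gens)
qed (rule br_is_qPoisson rho_Phis(2) moment_invertible)+

section \<open>Values of the bracket on arrows\<close>

lemma eval2_far: "bil \<beta> \<Longrightarrow> eval2 \<beta> (brx br (far b) (far c)) = (1/2) * (ord_bracket b c \<beta> + edge_bracket b c \<beta>)"
  unfolding arrow_form_eq[symmetric] by (simp add: eval2_brx fin form_bracket_far)

text \<open>Only the two terms comparing \<open>a\<close> with \<open>dstar a\<close> survive, and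
  antisymmetry of the sign combines them.\<close>

lemma br_far_far: "eqA2 t h g (brx br (far a) (far a))
    (vscal ((1/2) * osgn lt t h (src a) a (dstar a)) (vsub (tens (fmul (far a) (far a)) (fe (src a))) (tens (fe
        (tgt a)) (fmul (far a) (far a)))))"
proof (rule eqA2I)
  fix \<beta> assume \<beta>: "bil \<beta>"
  have "a \<noteq> dstar a" by (cases a) auto
  then show "eval2 \<beta> (brx br (far a) (far a)) = eval2 \<beta> (vscal ((1/2) * osgn lt t h (src a) a (dstar a))
      (vsub (tens (fmul (far a) (far a)) (fe (src a))) (tens (fe (tgt a)) (fmul (far a) (far a)))))"
    using os_anti[of "dstar a" a]
    by (simp add: eval2_far \<beta> eval2_simps eval2_tens fins rho_gens os_def[symmetric] ord_bracket_def
        edge_bracket_def os_eq[of a a] os_eq[of "dstar a" "dstar a"] algebra_simps)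
qed (simp_all add: fins)

lemma br_far_star: "eqA2 t h g (brx br (far (Pos a)) (far (Star a)))
          (vadd (vscal (g a) (tens (fe (h a)) (fe (t a))))
          (vadd (vscal (1/2) (tens (fmul (far (Star a)) (far (Pos a))) (fe (t a))))
          (vadd (vscal (1/2) (tens (fe (h a)) (fmul (far (Pos a)) (far (Star a)))))
                (vscal ((1/2) * osgn lt t h (t a) (Pos a) (Star a))
                   (vsub (tens (far (Star a)) (far (Pos a))) (tens (far (Pos a)) (far (Star a))))))))"
proof (rule eqA2I)
  fix \<beta> assume \<beta>: "bil \<beta>"
  show "eval2 \<beta> (brx br (far (Pos a)) (far (Star a))) = eval2 \<beta> (vadd (vscal (g a) (tens (fe (h a)) (fe (t a))))
          (vadd (vscal (1/2) (tens (fmul (far (Star a)) (far (Pos a))) (fe (t a))))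
          (vadd (vscal (1/2) (tens (fe (h a)) (fmul (far (Pos a)) (far (Star a)))))
                (vscal ((1/2) * osgn lt t h (t a) (Pos a) (Star a))
                   (vsub (tens (far (Star a)) (far (Pos a))) (tens (far (Pos a)) (far (Star a))))))))"
    using os_anti[of "Star a" "Pos a"] os_def[of "Pos a" "Star a"]
    by (simp add: eval2_far \<beta> eval2_simps eval2_tens fins rho_gens ord_bracket_def edge_bracket_def os_eq[of
        "Pos a" "Pos a"] os_eq[of "Star a" "Star a"] algebra_simps)
qed (simp_all add: fins)

lemma br_far_other:
  assumes "c \<noteq> b" "c \<noteq> dstar b"
  shows "eqA2 t h g (brx br (far b) (far c))
          (vadd (vscal (- (1/2) * osgn lt t h (src b) b c) (tens (far b) (far c)))
          (vadd (vscal (- (1/2) * osgn lt t h (tgt b) (dstar b) (dstar c)) (tens (far c) (far b)))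
          (vadd (vscal ((1/2) * osgn lt t h (src b) b (dstar c)) (tens (fmul (far c) (far b)) (fe (src b))))
                (vscal ((1/2) * osgn lt t h (tgt b) (dstar b) c) (tens (fe (tgt b)) (fmul (far b) (far c)))))))"
proof (rule eqA2I)
  fix \<beta> assume \<beta>: "bil \<beta>"
  show "eval2 \<beta> (brx br (far b) (far c)) = eval2 \<beta> (vadd (vscal (- (1/2) * osgn lt t h (src b) b c) (tens
      (far b) (far c)))
          (vadd (vscal (- (1/2) * osgn lt t h (tgt b) (dstar b) (dstar c)) (tens (far c) (far b)))
          (vadd (vscal ((1/2) * osgn lt t h (src b) b (dstar c)) (tens (fmul (far c) (far b)) (fe (src b))))
                (vscal ((1/2) * osgn lt t h (tgt b) (dstar b) c) (tens (fe (tgt b)) (fmul (far b) (far c)))))))"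
    using assms os_def[of b] os_def[of "dstar b"]
    by (simp add: eval2_far \<beta> eval2_simps eval2_tens fins rho_gens ord_bracket_def edge_bracket_def src_dstar
        algebra_simps)
qed (simp_all add: fins)

end

theorem theorem3p3:
  fixes t h :: "'a::finite \<Rightarrow> 'v::finite"
    and \<gamma> :: "'a \<Rightarrow> 'k::field_char_0"
    and lt :: "'v \<Rightarrow> 'a darr \<Rightarrow> 'a darr \<Rightarrow> bool"
  assumes "\<forall>s. strict_linear_order_on {b. dtl t h b = s} {(x, y). lt s x y}"
  shows "\<exists>br :: ('v,'a) gen list \<Rightarrow> ('v,'a) gen list \<Rightarrow> ('v,'a) gen list \<times> ('v,'a) gen list \<Rightarrow> 'k.
     is_qPoisson t h \<gamma> br
   \<and> (\<forall>a. eqA2 t h \<gamma> (brx br (far a) (far a))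
          (vscal ((1/2) * osgn lt t h (dtl t h a) a (dstar a))
             (vsub (tens (fmul (far a) (far a)) (fe (dtl t h a)))
                   (tens (fe (dhd t h a)) (fmul (far a) (far a))))))
   \<and> (\<forall>a. eqA2 t h \<gamma> (brx br (far (Pos a)) (far (Star a)))
          (vadd (vscal (\<gamma> a) (tens (fe (h a)) (fe (t a))))
          (vadd (vscal (1/2) (tens (fmul (far (Star a)) (far (Pos a))) (fe (t a))))
          (vadd (vscal (1/2) (tens (fe (h a)) (fmul (far (Pos a)) (far (Star a)))))
                (vscal ((1/2) * osgn lt t h (t a) (Pos a) (Star a))
                   (vsub (tens (far (Star a)) (far (Pos a))) (tens (far (Pos a)) (far (Star a)))))))))
   \<and> (\<forall>b c. c \<noteq> b \<and> c \<noteq> dstar b \<longrightarrow> eqA2 t h \<gamma> (brx br (far b) (far c))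
          (vadd (vscal (- (1/2) * osgn lt t h (dtl t h b) b c) (tens (far b) (far c)))
          (vadd (vscal (- (1/2) * osgn lt t h (dhd t h b) (dstar b) (dstar c)) (tens (far c) (far b)))
          (vadd (vscal ((1/2) * osgn lt t h (dtl t h b) b (dstar c))
                   (tens (fmul (far c) (far b)) (fe (dtl t h b))))
                (vscal ((1/2) * osgn lt t h (dhd t h b) (dstar b) c)
                   (tens (fe (dhd t h b)) (fmul (far b) (far c))))))))
   \<and> is_qHam t h \<gamma> br (Phis lt t h \<gamma>)"
proof -
  interpret ordered_quiver t h \<gamma> lt by standard (rule assms)
  show ?thesis
    by (rule exI[of _ br], intro conjI allI impI; (elim conjE)?)
      (rule br_is_qPoisson br_far_far br_far_star br_is_qHam br_far_other; assumption?)+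
qed

end
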